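(* Let $M>0$, let $H\in\mathbb{R}$, let $c_1>-8M^3H$ and $\bar c_1\in\mathbb{R}$, and let $\Sigma^1=\Sigma^1_{H,c_1,\bar c_1}$ be the corresponding SS-CMC hypersurface in region I. Put $\tilde k_H(r)=-Hr^3+r^{3/2}(2M-r)^{1/2}$ on $(0,2M)$, let $R_H\in(0,2M)$ be its unique maximum point, and $C_H=\tilde k_H(R_H)$ (so $C_H>-8M^3H$). Then there is $\bar c_4'\in\mathbb{R}$ such that $\Sigma^1$ connects smoothly with the SS-CMC hypersurface $\Sigma^4=\Sigma^4_{H,c_1,\bar c_4'}$ in region II$'$. Moreover: (a) If $c_1>C_H$, then $\Sigma^4$ is defined for $r\in(0,2M)$, and $\Sigma^1\cup\Sigma^4$ forms a complete and smooth SS-CMC hypersurface in the Kruskal extension with two ends. (b) If $c_1=C_H$, then $\Sigma^4$ is defined for $r\in(R_H,2M)$, and $\Sigma^1\cup\Sigma^4$ forms a complete and smooth SS-CMC hypersurface in the Kruskal extension with two ends. (c) If $-8M^3H<c_1<C_H$, then $\Sigma^4$ also connects smoothly with an SS-CMC hypersurface $\Sigma^3=\Sigma^3_{H,c_1,\bar c_3}$ in region I$'$ for some $\bar c_3\in\mathbb{R}$, and $\Sigma^1\cup\Sigma^4\cup\Sigma^3$ forms a complete and smooth SS-CMC hypersurface in the Kruskal extension with two ends.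
   Context: Kruskal extension: for $M>0$ and $h(r)=1-\frac{2M}{r}$, it is the manifold $\{(U,V)\in\mathbb{R}^2: UV>-2M\}\times\mathbb{S}^2$ with metric $\mathrm{d}s^2=\frac{16M^2e^{-r/2M}}{r}\,\mathrm{d}U\,\mathrm{d}V+r^2(\mathrm{d}\theta^2+\sin^2\theta\,\mathrm{d}\phi^2)$, where $r>0$ is determined by $(r-2M)e^{r/2M}=UV$. With $X=\frac{V+U}2$, $T=\frac{V-U}2$ one has $\mathrm{d}U\,\mathrm{d}V=-\mathrm{d}T^2+\mathrm{d}X^2$, and $\partial_T$ is taken to be future directed. Regions: I $=\{U>0,V>0\}$, II $=\{U<0,V>0\}$, I$'=\{U<0,V<0\}$, II$'=\{U>0,V<0\}$. In each region one uses coordinates $(t,r,\theta,\phi)$ with $t=2M\ln|V/U|$; equivalently, with $u=t-(r+2M\ln|r-2M|)$, $v=t+(r+2M\ln|r-2M|)$, one has $|U|=e^{-u/4M}$, $|V|=e^{v/4M}$. In these coordinates $\mathrm{d}s^2=-h\,\mathrm{d}t^2+h^{-1}\mathrm{d}r^2+r^2(\mathrm{d}\theta^2+\sin^2\theta\,\mathrm{d}\phi^2)$; regions I, I$'$ correspond to $r>2M$ and II, II$'$ to $0<r<2M$. The future direction is increasing $t$ in I, decreasing $r$ in II, decreasing $t$ in I$'$, increasing $r$ in II$'$. SS-CMC means spacelike, spherically symmetric, with constant mean curvature. The mean curvature is $H=\frac13\sum_i\langle\nabla_{e_i}N,e_i\rangle$, where $N$ is the future directed unit timelike normal and $\{e_i\}$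 is an orthonormal tangent frame. $\Sigma^1_{H,c,\bar c}$ is the hypersurface $t=f_1(r)$, $r>2M$, in region I with $f_1(r)=\int_{r_1}^r\frac{l_1(x)}{h(x)}\frac{\mathrm{d}x}{\sqrt{1+l_1(x)^2}}+\bar c$, $l_1(r)=\frac1{\sqrt{h(r)}}\left(Hr+\frac{c}{r^2}\right)$, where $r_1>2M$ is fixed. $\Sigma^3_{H,c,\bar c}$ is the hypersurface $t=f_3(r)$, $r>2M$, in region I$'$ with $f_3(r)=\int_{r_3}^r\frac{l_3(x)}{h(x)}\frac{\mathrm{d}x}{\sqrt{1+l_3(x)^2}}+\bar c$, $l_3=-l_1$, where $r_3>2M$ is fixed. In region II$'$, let $l_4(r)=\frac1{\sqrt{-h(r)}}\left(Hr+\frac{c}{r^2}\right)$ and $f_4^*(r)=\int_{r_4}^r\frac1{-h(x)}\sqrt{\frac{l_4(x)^2}{l_4(x)^2-1}}\,\mathrm{d}x+\bar c$, $f_4^{**}(r)=\int_{r_4'}^r\frac1{h(x)}\sqrt{\frac{l_4(x)^2}{l_4(x)^2-1}}\,\mathrm{d}x+\bar c'$, defined where $l_4>1$ (equivalently $\tilde k_H(r)<c$) and also at points with $\tilde k_H(r)=c$ at which the integral is finite. For $c>C_H$ the domain is $(0,2M)$; for $c=C_H$ the relevant component of the domain is $(R_H,2M)$; in these two cases $\Sigma^4_{H,c,\bar c'}$ is the hypersurface $t=f_4^{**}(r)$ in region II$'$ over that interval. For $-8M^3H<c<C_H$ the relevant component of the domain is $[r'',2M)$ with $\tilde k_H(r'')=c$,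 and $\Sigma^4_{H,c,\bar c'}$ is the union of the hypersurfaces $t=f_4^*(r)$ and $t=f_4^{**}(r)$ over $[r'',2M)$ with $r_4=r_4'=r''$ and $\bar c=\bar c'$. Two such hypersurfaces in adjacent regions connect smoothly if their union, together with the limiting 2-sphere on the common boundary $r=2M$ of the two regions, is a smooth spacelike hypersurface in the Kruskal extension; unions are understood to include these limiting spheres. A hypersurface is complete if it has no boundary and is a closed subset of the spacetime (ends may approach $r=0$, $r=\infty$, or be asymptotic to a hypersurface $r=\text{const}$). *)

theory Defs
  imports "HOL-Analysis.Analysis"
begin

section \<open>Smooth maps\<close>

primrec Ck_on :: "nat \<Rightarrow> 'a::euclidean_space set \<Rightarrow> ('a \<Rightarrow> 'b::real_normed_vector) \<Rightarrow> bool" where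
  "Ck_on 0 S f \<longleftrightarrow> continuous_on S f"
| "Ck_on (Suc k) S f \<longleftrightarrow>
     (\<forall>x\<in>S. f differentiable (at x)) \<and> (\<forall>v. Ck_on k S (\<lambda>x. frechet_derivative f (at x) v))"

text \<open>Only meant for open sets: the derivatives are taken in the full space.\<close>

definition smooth_on :: "'a::euclidean_space set \<Rightarrow> ('a \<Rightarrow> 'b::real_normed_vector) \<Rightarrow> bool" where
  "smooth_on S f \<longleftrightarrow> (\<forall>k. Ck_on k S f)"

section \<open>Hypersurfaces of a four-dimensional Lorentzian coordinate patch\<close>

text \<open>A metric on an open subset of \<open>\<real>\<^sup>4\<close> is given by its component matrix
  \<open>g :: real^4 \<Rightarrow> real^4^4\<close>; the signature is \<open>(-,+,+,+)\<close>.\<close>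

definition gprod :: "(real^4 \<Rightarrow> real^4^4) \<Rightarrow> real^4 \<Rightarrow> real^4 \<Rightarrow> real^4 \<Rightarrow> real" where
  "gprod g p v w = v \<bullet> (g p *v w)"

definition partial :: "4 \<Rightarrow> (real^4 \<Rightarrow> real) \<Rightarrow> real^4 \<Rightarrow> real" where
  "partial i f p = frechet_derivative f (at p) (axis i 1)"

definition christoffel :: "(real^4 \<Rightarrow> real^4^4) \<Rightarrow> real^4 \<Rightarrow> 4 \<Rightarrow> 4 \<Rightarrow> 4 \<Rightarrow> real" where
  "christoffel g p k i j =
     1/2 * (\<Sum>l\<in>UNIV. matrix_inv (g p) $ k $ l *
       (partial i (\<lambda>x. g x $ j $ l) p + partial j (\<lambda>x. g x $ i $ l) p - partial l (\<lambda>x. g x $ i $ j) p))"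

text \<open>The Levi-Civita derivative of the vector field \<open>N\<close> in the direction \<open>v\<close>.\<close>

definition cov_deriv :: "(real^4 \<Rightarrow> real^4^4) \<Rightarrow> (real^4 \<Rightarrow> real^4) \<Rightarrow> real^4 \<Rightarrow> real^4 \<Rightarrow> real^4" where
  "cov_deriv g N p v = frechet_derivative N (at p) v +
     (\<chi> k. \<Sum>i\<in>UNIV. \<Sum>j\<in>UNIV. christoffel g p k i j * v $ i * N p $ j)"

text \<open>Embedded hypersurfaces without boundary.\<close>

definition hypersurface_in :: "(real^4) set \<Rightarrow> (real^4) set \<Rightarrow> bool" where
  "hypersurface_in D S \<longleftrightarrow> S \<subseteq> D \<and>
     (\<forall>p\<in>S. \<exists>W (\<rho> :: real^4 \<Rightarrow> real). open W \<and> p \<in> W \<and> W \<subseteq> D \<and> smooth_on W \<rho> \<and>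
        (\<forall>x\<in>W. frechet_derivative \<rho> (at x) \<noteq> (\<lambda>_. 0)) \<and> S \<inter> W = {x\<in>W. \<rho> x = 0})"

definition tangent_space :: "(real^4) set \<Rightarrow> real^4 \<Rightarrow> (real^4) set" where
  "tangent_space S p = {v. \<exists>\<gamma>. \<gamma> 0 = p \<and> (\<forall>\<^sub>F s in at 0. \<gamma> s \<in> S) \<and> (\<gamma> has_vector_derivative v) (at (0::real))}"

definition spacelike_in :: "(real^4 \<Rightarrow> real^4^4) \<Rightarrow> (real^4) set \<Rightarrow> bool" where
  "spacelike_in g S \<longleftrightarrow> (\<forall>p\<in>S. \<forall>v\<in>tangent_space S p. v \<noteq> 0 \<longrightarrow> gprod g p v v > 0)"

text \<open>\<open>\<tau>\<close> is a future directed timelike vector field; a timelike vector \<open>n\<close> is then future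
  directed iff its product with \<open>\<tau>\<close> is negative.\<close>

definition future_unit_normal ::
  "(real^4 \<Rightarrow> real^4^4) \<Rightarrow> (real^4 \<Rightarrow> real^4) \<Rightarrow> (real^4) set \<Rightarrow> real^4 \<Rightarrow> real^4 \<Rightarrow> bool" where
  "future_unit_normal g \<tau> S p n \<longleftrightarrow>
     (\<forall>v\<in>tangent_space S p. gprod g p n v = 0) \<and> gprod g p n n = -1 \<and> gprod g p n (\<tau> p) < 0"

text \<open>\<open>N\<close> extends the normal field to a neighbourhood; the value \<open>H\<close> depends neither on this
  extension nor on the orthonormal frame.\<close>

definition has_mean_curvature ::
  "(real^4 \<Rightarrow> real^4^4) \<Rightarrow> (real^4 \<Rightarrow> real^4) \<Rightarrow> (real^4) set \<Rightarrow> real^4 \<Rightarrow> real \<Rightarrow> bool" where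
  "has_mean_curvature g \<tau> S p H \<longleftrightarrow>
     (\<exists>W N (e :: 3 \<Rightarrow> real^4). open W \<and> p \<in> W \<and> smooth_on W N \<and>
        (\<forall>x\<in>S \<inter> W. future_unit_normal g \<tau> S x (N x)) \<and>
        (\<forall>i. e i \<in> tangent_space S p) \<and>
        (\<forall>i j. gprod g p (e i) (e j) = (if i = j then 1 else 0)) \<and>
        H = 1/3 * (\<Sum>i\<in>UNIV. gprod g p (cov_deriv g N p (e i)) (e i)))"

section \<open>The Kruskal extension\<close>

text \<open>Points are triples \<open>(U, V, \<omega>)\<close> with \<open>\<omega>\<close> in the unit sphere of \<open>\<real>\<^sup>3\<close>.\<close>

type_synonym event = "real \<times> real \<times> (real^3)"

definition kruskal :: "real \<Rightarrow> event set" where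
  "kruskal M = {(U, V, \<omega>). U * V > -2 * M \<and> norm \<omega> = 1}"

definition kruskal_r :: "real \<Rightarrow> real \<Rightarrow> real \<Rightarrow> real" where
  "kruskal_r M U V = (THE r. r > 0 \<and> (r - 2 * M) * exp (r / (2 * M)) = U * V)"

definition kruskal_t :: "real \<Rightarrow> real \<Rightarrow> real \<Rightarrow> real" where
  "kruskal_t M U V = 2 * M * ln \<bar>V / U\<bar>"

text \<open>The coordinates are \<open>(U, V, \<theta>, \<phi>)\<close>. The manifold is covered by the spherical coordinate
  patches rotated by \<open>A\<close> in \<open>SO(3)\<close>, and the metric has the same components in each of them.\<close>

definition patch_dom :: "real \<Rightarrow> (real^4) set" where
  "patch_dom M = {x. x$1 * x$2 > -2 * M \<and> 0 < x$3 \<and> x$3 < pi \<and> 0 < x$4 \<and> x$4 < 2 * pi}"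

definition patch :: "real^3^3 \<Rightarrow> real^4 \<Rightarrow> event" where
  "patch A x = (x$1, x$2, A *v vector [sin (x$3) * cos (x$4), sin (x$3) * sin (x$4), cos (x$3)])"

definition in_patch :: "real \<Rightarrow> real^3^3 \<Rightarrow> event set \<Rightarrow> (real^4) set" where
  "in_patch M A S = {x \<in> patch_dom M. patch A x \<in> S}"

text \<open>\<open>dU dV\<close> is the symmetric product, which accounts for the factor \<open>1/2\<close>.\<close>

definition kruskal_metric :: "real \<Rightarrow> real^4 \<Rightarrow> real^4^4" where
  "kruskal_metric M x =
     (let r = kruskal_r M (x$1) (x$2); F = 16 * M^2 * exp (- r / (2 * M)) / r
      in vector [vector [0, F / 2, 0, 0],
                 vector [F / 2, 0, 0, 0],
                 vector [0, 0, r^2, 0],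
                 vector [0, 0, 0, r^2 * (sin (x$3))^2]])"

text \<open>\<open>\<partial>\<^sub>T = \<partial>\<^sub>V - \<partial>\<^sub>U\<close>, since \<open>U = X - T\<close> and \<open>V = X + T\<close>.\<close>

definition time_dir :: "real^4 \<Rightarrow> real^4" where
  "time_dir x = vector [-1, 1, 0, 0]"

definition hypersurface :: "real \<Rightarrow> event set \<Rightarrow> bool" where
  "hypersurface M S \<longleftrightarrow> S \<subseteq> kruskal M \<and>
     (\<forall>A. rotation_matrix A \<longrightarrow> hypersurface_in (patch_dom M) (in_patch M A S))"

definition spacelike_hypersurface :: "real \<Rightarrow> event set \<Rightarrow> bool" where
  "spacelike_hypersurface M S \<longleftrightarrow> hypersurface M S \<and>
     (\<forall>A. rotation_matrix A \<longrightarrow> spacelike_in (kruskal_metric M) (in_patch M A S))"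

definition spherically_symmetric :: "event set \<Rightarrow> bool" where
  "spherically_symmetric S \<longleftrightarrow>
     (\<forall>A U V \<omega>. rotation_matrix A \<longrightarrow> (U, V, \<omega>) \<in> S \<longrightarrow> (U, V, A *v \<omega>) \<in> S)"

definition ss_cmc :: "real \<Rightarrow> real \<Rightarrow> event set \<Rightarrow> bool" where
  "ss_cmc M H S \<longleftrightarrow> spacelike_hypersurface M S \<and> spherically_symmetric S \<and>
     (\<forall>A. rotation_matrix A \<longrightarrow>
        (\<forall>p\<in>in_patch M A S. has_mean_curvature (kruskal_metric M) time_dir (in_patch M A S) p H))"

text \<open>A \<open>hypersurface\<close> has no boundary by definition, so completeness only adds closedness.\<close>

definition complete_hypersurface :: "real \<Rightarrow> event set \<Rightarrow> bool" where
  "complete_hypersurface M S \<longleftrightarrow> hypersurface M S \<and> closedin (top_of_set (kruskal M)) S"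

text \<open>The number of ends of a space: the eventual number of components of the complement of a
  compact set that are not relatively compact. (This number is monotone in the compact set.)\<close>

definition has_ends :: "'a::topological_space set \<Rightarrow> nat \<Rightarrow> bool" where
  "has_ends X n \<longleftrightarrow> (\<exists>K\<^sub>0. compact K\<^sub>0 \<and> K\<^sub>0 \<subseteq> X \<and>
     (\<forall>K. compact K \<and> K\<^sub>0 \<subseteq> K \<and> K \<subseteq> X \<longrightarrow>
        finite {C \<in> components (X - K). \<not> compact (X \<inter> closure C)} \<and>
        card {C \<in> components (X - K). \<not> compact (X \<inter> closure C)} = n))"

definition region_I :: "real \<Rightarrow> event set" where
  "region_I M = {(U, V, \<omega>) \<in> kruskal M. U > 0 \<and> V > 0}"

definition region_I' :: "real \<Rightarrow> event set" where
  "region_I' M = {(U, V, \<omega>) \<in> kruskal M. U < 0 \<and> V < 0}"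

definition region_II' :: "real \<Rightarrow> event set" where
  "region_II' M = {(U, V, \<omega>) \<in> kruskal M. U > 0 \<and> V < 0}"

text \<open>For two adjacent regions (disjoint and relatively open), the common boundary is the
  intersection of the closures; \<open>r = 2M\<close> holds on it.\<close>

definition limit_set :: "event set \<Rightarrow> event set \<Rightarrow> event set \<Rightarrow> event set" where
  "limit_set R R' A = closure A \<inter> (closure R \<inter> closure R')"

definition join :: "event set \<Rightarrow> event set \<Rightarrow> event set \<Rightarrow> event set \<Rightarrow> event set" where
  "join R R' A B = A \<union> B \<union> (limit_set R R' A \<inter> limit_set R R' B)"

definition connects_smoothly :: "real \<Rightarrow> event set \<Rightarrow> event set \<Rightarrow> event set \<Rightarrow> event set \<Rightarrow> bool" where
  "connects_smoothly M R R' A B \<longleftrightarrow>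
     (\<exists>U V. limit_set R R' A = {U} \<times> {V} \<times> sphere 0 1 \<and> limit_set R R' B = {U} \<times> {V} \<times> sphere 0 1) \<and>
     spacelike_hypersurface M (join R R' A B)"

section \<open>The hypersurfaces\<close>

definition schw_h :: "real \<Rightarrow> real \<Rightarrow> real" where
  "schw_h M r = 1 - 2 * M / r"

definition l1 :: "real \<Rightarrow> real \<Rightarrow> real \<Rightarrow> real \<Rightarrow> real" where
  "l1 M H c r = 1 / sqrt (schw_h M r) * (H * r + c / r^2)"

definition l3 :: "real \<Rightarrow> real \<Rightarrow> real \<Rightarrow> real \<Rightarrow> real" where
  "l3 M H c r = - l1 M H c r"

definition l4 :: "real \<Rightarrow> real \<Rightarrow> real \<Rightarrow> real \<Rightarrow> real" where
  "l4 M H c r = 1 / sqrt (- schw_h M r) * (H * r + c / r^2)"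

text \<open>The first argument after \<open>c\<close> is the base point of the integral, the second one the additive
  constant. The interval integrals are oriented.\<close>

definition f1 :: "real \<Rightarrow> real \<Rightarrow> real \<Rightarrow> real \<Rightarrow> real \<Rightarrow> real \<Rightarrow> real" where
  "f1 M H c r\<^sub>1 cb r =
     (LBINT x=ereal r\<^sub>1..ereal r. l1 M H c x / schw_h M x * (1 / sqrt (1 + (l1 M H c x)^2))) + cb"

definition f3 :: "real \<Rightarrow> real \<Rightarrow> real \<Rightarrow> real \<Rightarrow> real \<Rightarrow> real \<Rightarrow> real" where
  "f3 M H c r\<^sub>3 cb r =
     (LBINT x=ereal r\<^sub>3..ereal r. l3 M H c x / schw_h M x * (1 / sqrt (1 + (l3 M H c x)^2))) + cb"

definition f4_integrand :: "real \<Rightarrow> real \<Rightarrow> real \<Rightarrow> real \<Rightarrow> real" where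
  "f4_integrand M H c x = 1 / schw_h M x * sqrt ((l4 M H c x)^2 / ((l4 M H c x)^2 - 1))"

definition f4_star :: "real \<Rightarrow> real \<Rightarrow> real \<Rightarrow> real \<Rightarrow> real \<Rightarrow> real \<Rightarrow> real" where
  "f4_star M H c r\<^sub>4 cb r = (LBINT x=ereal r\<^sub>4..ereal r. - f4_integrand M H c x) + cb"

definition f4_star2 :: "real \<Rightarrow> real \<Rightarrow> real \<Rightarrow> real \<Rightarrow> real \<Rightarrow> real \<Rightarrow> real" where
  "f4_star2 M H c r\<^sub>4 cb r = (LBINT x=ereal r\<^sub>4..ereal r. f4_integrand M H c x) + cb"

definition ktilde :: "real \<Rightarrow> real \<Rightarrow> real \<Rightarrow> real" where
  "ktilde M H r = - H * r^3 + r powr (3/2) * (2 * M - r) powr (1/2)"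

definition R_max :: "real \<Rightarrow> real \<Rightarrow> real" where
  "R_max M H = (THE R. R \<in> {0<..<2*M} \<and> (\<forall>r\<in>{0<..<2*M}. r \<noteq> R \<longrightarrow> ktilde M H r < ktilde M H R))"

definition C_max :: "real \<Rightarrow> real \<Rightarrow> real" where
  "C_max M H = ktilde M H (R_max M H)"

text \<open>At a point with \<open>ktilde M H r = c\<close> the integral is finite if the integrand is integrable up to
  \<open>r\<close> from an adjacent interval (on either side) on which \<open>ktilde M H < c\<close>.\<close>

definition f4_dom :: "real \<Rightarrow> real \<Rightarrow> real \<Rightarrow> real set" where
  "f4_dom M H c = {r \<in> {0<..<2*M}. ktilde M H r < c \<or>
     (ktilde M H r = c \<and> (\<exists>s\<in>{0<..<2*M}. s \<noteq> r \<and>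
        (\<forall>x\<in>closed_segment s r - {r}. ktilde M H x < c) \<and>
        interval_lebesgue_integrable lborel (ereal (min s r)) (ereal (max s r)) (f4_integrand M H c)))}"

text \<open>The component of the domain that is adjacent to the horizon \<open>r = 2M\<close>.\<close>

definition Sigma4_dom :: "real \<Rightarrow> real \<Rightarrow> real \<Rightarrow> real set" where
  "Sigma4_dom M H c = {r. 0 < r \<and> r < 2 * M \<and> {r..<2*M} \<subseteq> f4_dom M H c}"

definition r_turn :: "real \<Rightarrow> real \<Rightarrow> real \<Rightarrow> real" where
  "r_turn M H c = (THE r. Sigma4_dom M H c = {r..<2*M} \<and> r \<in> {0<..<2*M} \<and> ktilde M H r = c)"

text \<open>The hypersurface \<open>t = f(r)\<close>, \<open>r \<in> J\<close>, inside the region \<open>R\<close>.\<close>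

definition graph_over :: "real \<Rightarrow> event set \<Rightarrow> real set \<Rightarrow> (real \<Rightarrow> real) \<Rightarrow> event set" where
  "graph_over M R J f =
     {(U, V, \<omega>) \<in> R. kruskal_r M U V \<in> J \<and> kruskal_t M U V = f (kruskal_r M U V)}"

definition Sigma1 :: "real \<Rightarrow> real \<Rightarrow> real \<Rightarrow> real \<Rightarrow> real \<Rightarrow> event set" where
  "Sigma1 M H c r\<^sub>1 cb = graph_over M (region_I M) {2*M<..} (f1 M H c r\<^sub>1 cb)"

definition Sigma3 :: "real \<Rightarrow> real \<Rightarrow> real \<Rightarrow> real \<Rightarrow> real \<Rightarrow> event set" where
  "Sigma3 M H c r\<^sub>3 cb = graph_over M (region_I' M) {2*M<..} (f3 M H c r\<^sub>3 cb)"

text \<open>For \<open>c < C_max M H\<close> the base point of both integrals is \<open>r_turn M H c\<close>, and the argument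
  \<open>r\<^sub>4\<close> is not used.\<close>

definition Sigma4 :: "real \<Rightarrow> real \<Rightarrow> real \<Rightarrow> real \<Rightarrow> real \<Rightarrow> event set" where
  "Sigma4 M H c r\<^sub>4 cb =
     (if c < C_max M H
      then graph_over M (region_II' M) (Sigma4_dom M H c) (f4_star M H c (r_turn M H c) cb) \<union>
           graph_over M (region_II' M) (Sigma4_dom M H c) (f4_star2 M H c (r_turn M H c) cb)
      else graph_over M (region_II' M) (Sigma4_dom M H c) (f4_star2 M H c r\<^sub>4 cb))"

end

theory Submission
  imports Defs
begin

text \<open>
  Let \<open>k(r) = H r + c/r\<^sup>2\<close> and \<open>W = h + k\<^sup>2\<close>. Since \<open>\<partial>\<^sub>t\<close> is a Killing field, the mean
  curvature equation has a first integral: it says that the future unit normal \<open>N\<close> satisfies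
  \<open>N(r) = k(r)\<close>. The profile curve in the \<open>(U, V)\<close>-plane with unit tangent \<open>(n, m)\<close> then has
  \<open>r\<close>-velocity \<open>p\<close> with \<open>p\<^sup>2 = W\<close>, so \<open>r\<close> moves like a particle in a potential. Everything
  else follows from \<open>n\<close>, which solves a linear equation with coefficients that are
  smooth across the horizon: \<open>U = 4 M (p + k) n\<close> and \<open>V = 4 M (p - k) m\<close>. In regions I, II' and
  I' the curve is the graph of the given integrals, because \<open>t = 2 M ln \<bar>V/U\<bar>\<close> has
  velocity \<open>k/h\<close>. It crosses \<open>V = 0\<close> where \<open>p = k\<close> and \<open>U = 0\<close> where \<open>p = - k\<close>, and
  \<open>c > - 8 M\<^sup>3 H\<close> means \<open>k(2M) > 0\<close>.

  Where \<open>r < 2M\<close> and \<open>k > 0\<close>, \<open>W\<close> has the sign of \<open>c - ktilde\<close>. For \<open>c > C_max\<close> the curve reaches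
  \<open>r = 0\<close>. For \<open>c = C_max\<close> the zero of \<open>W\<close> at \<open>R_max\<close> is double and the curve is
  asymptotic to \<open>r = R_max\<close>. For \<open>c < C_max\<close> the zero is simple, \<open>r\<close> turns there, and the curve
  leaves through \<open>U = 0\<close> into region I'. Finally \<open>U\<close> is increasing along the curve, so the
  hypersurface is a graph \<open>V = \<phi>(U)\<close> over an interval, times a sphere.
\<close>

section \<open>Smooth functions of one variable\<close>

text \<open>The obstacle is the horizon: the integrands of the given graphs have a pole at r = 2M
  and t is infinite there, so matching the pieces directly would need expansions to every order.
  Hence the whole curve is built as one object, without t, and the given hypersurfaces are
  recognised in it afterwards. The formulas for U and V come from inverting the geometry: the
  r-components of the tangent (n, m) and the normal (-n, m) are linear in U and V. Demanding U' = n
  then fixes n'/n. A quotient by p + k would appear in it, but p^2 - k^2 = h removes this quotient,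
  and so the equation for n is regular where p + k or p - k vanishes. The parameter y of the curve
  is kept general, with speed a. The radius itself serves as long as W > 0, but at a turning point
  it is no coordinate and sqrt W is not smooth in it. Since all fields depend on one coordinate,
  every smoothness question is reduced to functions of one real variable.\<close>

primrec Cr :: "nat \<Rightarrow> real set \<Rightarrow> (real \<Rightarrow> real) \<Rightarrow> bool" where
  "Cr 0 S f \<longleftrightarrow> continuous_on S f"
| "Cr (Suc k) S f \<longleftrightarrow> (\<exists>f'. (\<forall>x\<in>S. (f has_real_derivative f' x) (at x)) \<and> Cr k S f')"

text \<open>Derivatives enter as existential witnesses, so that closure under products and
  composition is a plain induction on the order. The passage to \<open>smooth_on\<close> in four
  variables is made only for the normal field and for the defining function of a graph.\<close>

definition smooth1 :: "real set \<Rightarrow> (real \<Rightarrow> real) \<Rightarrow> bool" where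
  "smooth1 S f \<longleftrightarrow> (\<forall>k. Cr k S f)"

lemma Cr_SucI:
  "(\<And>x. x \<in> S \<Longrightarrow> (f has_real_derivative f' x) (at x)) \<Longrightarrow> Cr k S f' \<Longrightarrow> Cr (Suc k) S f"
  by auto

lemma Cr_imp_continuous_on: "Cr k S f \<Longrightarrow> continuous_on S f"
proof (cases k)
  case (Suc j)
  moreover assume "Cr k S f"
  ultimately obtain f' where "\<forall>x\<in>S. (f has_real_derivative f' x) (at x)" by auto
  then show ?thesis by (metis DERIV_isCont continuous_at_imp_continuous_on)
qed simp

lemma Cr_Suc_imp: "Cr (Suc k) S f \<Longrightarrow> Cr k S f"
proof (induction k arbitrary: f)
  case 0
  then show ?case using Cr_imp_continuous_on by fastforce
next
  case (Suc k)
  then obtain f' where "\<forall>x\<in>S. (f has_real_derivative f' x) (at x)" "Cr (Suc k) S f'"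
    by (metis Cr.simps(2))
  with Suc.IH[of f'] show ?case by auto
qed

lemma Cr_subset: "Cr k S f \<Longrightarrow> T \<subseteq> S \<Longrightarrow> Cr k T f"
  by (induction k arbitrary: f) (auto intro: continuous_on_subset)

lemma Cr_const: "Cr k S (\<lambda>_. c)"
proof (induction k arbitrary: c)
  case (Suc k)
  show ?case
    by (rule Cr_SucI[of _ _ "\<lambda>_. 0"]) (use Suc in auto)
qed simp

lemma Cr_ident: "Cr k S (\<lambda>x. x)"
proof (cases k)
  case (Suc j)
  show ?thesis
    unfolding Suc by (rule Cr_SucI[of _ _ "\<lambda>_. 1"]) (use Cr_const in auto)
qed simp

lemma Cr_add: "Cr k S f \<Longrightarrow> Cr k S g \<Longrightarrow> Cr k S (\<lambda>x. f x + g x)"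
proof (induction k arbitrary: f g)
  case (Suc k)
  then obtain f' g' where d: "\<forall>x\<in>S. (f has_real_derivative f' x) (at x)" "Cr k S f'"
     "\<forall>x\<in>S. (g has_real_derivative g' x) (at x)" "Cr k S g'" by auto
  have "((\<lambda>x. f x + g x) has_real_derivative f' x + g' x) (at x)" if "x \<in> S" for x
    using DERIV_add[of f "f' x" x UNIV g "g' x"] d that by blast
  from Cr_SucI[OF this Suc.IH[OF d(2,4)]] show ?case .
qed (simp add: continuous_on_add)

lemma Cr_mult: "Cr k S f \<Longrightarrow> Cr k S g \<Longrightarrow> Cr k S (\<lambda>x. f x * g x)"
proof (induction k arbitrary: f g)
  case (Suc k)
  then obtain f' g' where d: "\<forall>x\<in>S. (f has_real_derivative f' x) (at x)" "Cr k S f'"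
     "\<forall>x\<in>S. (g has_real_derivative g' x) (at x)" "Cr k S g'" by auto
  have *: "Cr k S (\<lambda>x. f' x * g x + g' x * f x)"
    by (intro Cr_add Suc.IH d Cr_Suc_imp[OF Suc.prems(1)] Cr_Suc_imp[OF Suc.prems(2)])
  have "((\<lambda>x. f x * g x) has_real_derivative f' x * g x + g' x * f x) (at x)" if "x \<in> S" for x
    using DERIV_mult[of f "f' x" x UNIV g "g' x"] d that by blast
  from Cr_SucI[OF this *] show ?case .
qed (simp add: continuous_on_mult)

lemma Cr_compose:
  "Cr k T f \<Longrightarrow> Cr k S g \<Longrightarrow> g ` S \<subseteq> T \<Longrightarrow> Cr k S (\<lambda>x. f (g x))"
proof (induction k arbitrary: f g)
  case 0
  then show ?case by (simp add: continuous_on_compose2)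
next
  case (Suc k)
  then obtain f' g' where d: "\<forall>x\<in>T. (f has_real_derivative f' x) (at x)" "Cr k T f'"
     "\<forall>x\<in>S. (g has_real_derivative g' x) (at x)" "Cr k S g'" by auto
  have *: "Cr k S (\<lambda>x. f' (g x) * g' x)"
    by (rule Cr_mult[OF Suc.IH[OF d(2) Cr_Suc_imp[OF Suc.prems(2)] Suc.prems(3)] d(4)])
  have "((\<lambda>x. f (g x)) has_real_derivative f' (g x) * g' x) (at x)" if "x \<in> S" for x
    using DERIV_chain2[of f "f' (g x)" g x "g' x" UNIV] d that Suc.prems(3) by auto
  from Cr_SucI[OF this *] show ?case .
qed

lemma smooth1_imp_continuous_on: "smooth1 S f \<Longrightarrow> continuous_on S f"
  unfolding smooth1_def using Cr_imp_continuous_on by blast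

lemma smooth1_subset: "smooth1 S f \<Longrightarrow> T \<subseteq> S \<Longrightarrow> smooth1 T f"
  unfolding smooth1_def using Cr_subset by blast

lemma smooth1_const: "smooth1 S (\<lambda>_. c)"
  by (simp add: smooth1_def Cr_const)

lemma smooth1_ident: "smooth1 S (\<lambda>x. x)"
  by (simp add: smooth1_def Cr_ident)

lemma smooth1_add: "smooth1 S f \<Longrightarrow> smooth1 S g \<Longrightarrow> smooth1 S (\<lambda>x. f x + g x)"
  by (simp add: smooth1_def Cr_add)

lemma smooth1_mult: "smooth1 S f \<Longrightarrow> smooth1 S g \<Longrightarrow> smooth1 S (\<lambda>x. f x * g x)"
  by (simp add: smooth1_def Cr_mult)

lemma smooth1_minus: "smooth1 S f \<Longrightarrow> smooth1 S (\<lambda>x. - f x)"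
  using smooth1_mult[OF smooth1_const[of S "-1"]] by simp

lemma smooth1_diff: "smooth1 S f \<Longrightarrow> smooth1 S g \<Longrightarrow> smooth1 S (\<lambda>x. f x - g x)"
  using smooth1_add[OF _ smooth1_minus, of S f g] by simp

lemma smooth1_power: "smooth1 S f \<Longrightarrow> smooth1 S (\<lambda>x. f x ^ j)"
  by (induction j) (simp_all add: smooth1_const smooth1_mult)

lemma smooth1_compose:
  "smooth1 T f \<Longrightarrow> smooth1 S g \<Longrightarrow> g ` S \<subseteq> T \<Longrightarrow> smooth1 S (\<lambda>x. f (g x))"
  unfolding smooth1_def using Cr_compose by metis

text \<open>If f is C^k, then so is f', and f is C^(k+1): each round gains one order. This serves
  wherever a derivative is expressed through the function itself: linear equations,
  \<open>inverse\<close>, \<open>sqrt\<close> and inverse functions.\<close>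

lemma smooth1_bootstrap:
  assumes "\<And>x. x \<in> S \<Longrightarrow> (f has_real_derivative f' x) (at x)" "\<And>k. Cr k S f \<Longrightarrow> Cr k S f'"
  shows "smooth1 S f"
proof -
  have "Cr k S f" for k
  proof (induction k)
    case 0
    show ?case using assms(1) by simp (metis DERIV_isCont continuous_at_imp_continuous_on)
  next
    case (Suc k)
    from Cr_SucI[OF assms(1) assms(2)[OF this]] show ?case .
  qed
  then show ?thesis by (simp add: smooth1_def)
qed

lemma smooth1_linear_ode:
  assumes "\<And>x. x \<in> S \<Longrightarrow> (f has_real_derivative b x * f x) (at x)" "smooth1 S b"
  shows "smooth1 S f"
  by (rule smooth1_bootstrap[where f' = "\<lambda>x. b x * f x"])
    (use assms in \<open>auto intro!: Cr_mult simp: smooth1_def\<close>)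

lemma smooth1_inverse:
  assumes "open S" "smooth1 S f" "\<And>x. x \<in> S \<Longrightarrow> f x \<noteq> 0"
  shows "smooth1 S (\<lambda>x. inverse (f x))"
proof -
  have "smooth1 (-{0}) inverse"
  proof (rule smooth1_bootstrap)
    show "(inverse has_real_derivative - (inverse x * inverse x)) (at x)" if "x \<in> -{0}" for x :: real
      using DERIV_inverse[of x UNIV] that by (simp add: power2_eq_square)
    show "Cr k (- {0}) (\<lambda>x. - (inverse x * inverse x))" if "Cr k (- {0}) inverse" for k
      using Cr_mult[OF Cr_const[of k _ "-1"] Cr_mult[OF that that]] by simp
  qed
  show ?thesis
    by (rule smooth1_compose[OF \<open>smooth1 (-{0}) inverse\<close> assms(2)]) (use assms(3) in auto)
qed

lemma smooth1_divide:
  assumes "open S" "smooth1 S f" "smooth1 S g" "\<And>x. x \<in> S \<Longrightarrow> g x \<noteq> 0"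
  shows "smooth1 S (\<lambda>x. f x / g x)"
  using smooth1_mult[OF assms(2) smooth1_inverse[OF assms(1,3)]] assms(4)
  by (simp add: divide_inverse)

lemma smooth1_sqrt:
  assumes "open S" "smooth1 S f" "\<And>x. x \<in> S \<Longrightarrow> f x > 0"
  shows "smooth1 S (\<lambda>x. sqrt (f x))"
proof -
  have inv: "smooth1 {0<..} inverse"
    by (rule smooth1_inverse) (auto intro: smooth1_ident)
  have "smooth1 {0<..} sqrt"
  proof (rule smooth1_bootstrap)
    show "(sqrt has_real_derivative inverse (sqrt x) / 2) (at x)" if "x \<in> {0<..}" for x
      using DERIV_real_sqrt[of x] that by simp
    show "Cr k {0<..} (\<lambda>x. inverse (sqrt x) / 2)" if "Cr k {0<..} sqrt" for k
    proof -
      have "Cr k {0<..} (\<lambda>x. inverse (sqrt x))"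
        by (rule Cr_compose[of _ "{0<..}"]) (use inv that in \<open>auto simp: smooth1_def\<close>)
      from Cr_mult[OF this Cr_const[of k _ "1/2"]] show ?thesis by simp
    qed
  qed
  show ?thesis
    by (rule smooth1_compose[OF \<open>smooth1 {0<..} sqrt\<close> assms(2)]) (use assms(3) in auto)
qed

section \<open>Smooth maps depending on the first coordinate only\<close>

lemma Ck_on_cong:
  assumes "open S" "\<And>x. x \<in> S \<Longrightarrow> f x = g x" "Ck_on k S f"
  shows "Ck_on k S g"
  using assms(2,3)
proof (induction k arbitrary: f g)
  case 0
  then show ?case using continuous_on_cong by force
next
  case (Suc k)
  have g: "(g has_derivative frechet_derivative f (at x)) (at x)" if "x \<in> S" for x
  proof -
    have "(f has_derivative frechet_derivative f (at x)) (at x)"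
      using Suc.prems(2) that by (simp add: frechet_derivative_works)
    then show ?thesis
      using has_derivative_transform_within_open[OF _ \<open>open S\<close> that] Suc.prems(1) by blast
  qed
  have eq: "frechet_derivative f (at x) = frechet_derivative g (at x)" if "x \<in> S" for x
    by (rule frechet_derivative_at[OF g[OF that]])
  have "Ck_on k S (\<lambda>x. frechet_derivative g (at x) v)" for v
    by (rule Suc.IH[where f = "\<lambda>x. frechet_derivative f (at x) v"]) (use Suc.prems(2) eq in simp_all)
  then show ?case by (simp add: differentiableI[OF g])
qed

lemma open_coord_preimage: "open J \<Longrightarrow> open {x::real^4. x$1 \<in> J}"
  using open_vimage[of J "\<lambda>x::real^4. x$1"] by (simp add: vimage_def continuous_on_component)

lemma has_derivative_first_coord:
  fixes v w :: "'b::real_normed_vector" and x :: "real^4"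
  assumes "(f has_real_derivative f') (at (x$1))" "(g has_real_derivative g') (at (x$1))"
  shows "((\<lambda>x. f (x$1) *\<^sub>R v + g (x$1) *\<^sub>R w) has_derivative
    (\<lambda>z. f' *\<^sub>R (z$1 *\<^sub>R v) + g' *\<^sub>R (z$1 *\<^sub>R w))) (at x)"
proof -
  have p: "((\<lambda>x::real^4. x$1) has_derivative (\<lambda>z. z$1)) (at x)"
    by (rule bounded_linear_imp_has_derivative[OF bounded_linear_vec_nth])
  have 1: "((\<lambda>x. f (x$1)) has_derivative (\<lambda>z. f' * z$1)) (at x)"
    using has_derivative_compose[OF p assms(1)[unfolded has_field_derivative_def]] .
  have 2: "((\<lambda>x. g (x$1)) has_derivative (\<lambda>z. g' * z$1)) (at x)"
    using has_derivative_compose[OF p assms(2)[unfolded has_field_derivative_def]] .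
  show ?thesis
    using has_derivative_add[OF has_derivative_scaleR_left[OF 1] has_derivative_scaleR_left[OF 2]]
    by simp
qed

text \<open>The shape f v + g w reproduces itself under differentiation in a fixed direction z, with
  both vectors rescaled by z$1; hence v and w vary in the induction. The normal field of a graph has
  this shape.\<close>

lemma Ck_on_first_coord:
  fixes v w :: "'b::real_normed_vector"
  assumes "open J" "Cr k J f" "Cr k J g"
  shows "Ck_on k {x::real^4. x$1 \<in> J} (\<lambda>x. f (x$1) *\<^sub>R v + g (x$1) *\<^sub>R w)"
  using assms(2,3)
proof (induction k arbitrary: f g v w)
  case 0
  have *: "continuous_on {x::real^4. x$1 \<in> J} (\<lambda>x. h (x$1))" if "continuous_on J h" for h :: "real \<Rightarrow> real"
    by (rule continuous_on_compose2[OF that]) (auto intro: continuous_intros)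
  show ?case using 0 by (auto intro!: continuous_intros *)
next
  case (Suc k)
  then obtain f' g' where d: "\<forall>x\<in>J. (f has_real_derivative f' x) (at x)" "Cr k J f'"
     "\<forall>x\<in>J. (g has_real_derivative g' x) (at x)" "Cr k J g'" by auto
  let ?F = "\<lambda>x::real^4. f (x$1) *\<^sub>R v + g (x$1) *\<^sub>R w"
  have D: "(?F has_derivative (\<lambda>z. f' (x$1) *\<^sub>R (z$1 *\<^sub>R v) + g' (x$1) *\<^sub>R (z$1 *\<^sub>R w))) (at x)"
    if "x$1 \<in> J" for x
    using d that by (intro has_derivative_first_coord) auto
  have "Ck_on k {x::real^4. x$1 \<in> J} (\<lambda>x. frechet_derivative ?F (at x) z)" for z
    by (rule Ck_on_cong[OF open_coord_preimage[OF assms(1)] _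
          Suc.IH[of f' g' "z$1 *\<^sub>R v" "z$1 *\<^sub>R w", OF d(2,4)]])
      (use frechet_derivative_at[OF D] in \<open>auto simp: fun_eq_iff\<close>)
  moreover have "?F differentiable (at x)" if "x$1 \<in> J" for x
    by (rule differentiableI[OF D[OF that]])
  ultimately show ?case by simp
qed

lemma has_derivative_graph_function:
  assumes "(\<phi> has_real_derivative \<phi>') (at (x$1))"
  shows "((\<lambda>x::real^4. x$2 - \<phi> (x$1)) has_derivative (\<lambda>z. z$2 - \<phi>' * z$1)) (at x)"
proof -
  have 1: "((\<lambda>x. 0 *\<^sub>R (1::real) + \<phi> (x$1) *\<^sub>R 1) has_derivative
    (\<lambda>z. 0 *\<^sub>R (z$1 *\<^sub>R 1) + \<phi>' *\<^sub>R (z$1 *\<^sub>R 1))) (at x)"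
    by (rule has_derivative_first_coord[where v = "1::real" and w = 1 and f = "\<lambda>_. 0"]) (use assms in auto)
  have 2: "((\<lambda>x::real^4. x$2) has_derivative (\<lambda>z. z$2)) (at x)"
    by (rule bounded_linear_imp_has_derivative[OF bounded_linear_vec_nth])
  show ?thesis using has_derivative_diff[OF 2 1] by simp
qed

lemma smooth_on_subset:
  assumes "smooth_on S f" "T \<subseteq> S"
  shows "smooth_on T f"
proof -
  have "Ck_on k S f \<Longrightarrow> Ck_on k T f" for k
    by (induction k arbitrary: f) (use assms(2) in \<open>auto intro: continuous_on_subset\<close>)
  then show ?thesis using assms(1) by (simp add: smooth_on_def)
qed

text \<open>The summand x$2 keeps the function itself out of reach of
  \<open>Ck_on_first_coord\<close>, but each directional derivative z$2 - \<phi>'(x$1) z$1 has the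
  required shape.\<close>

lemma smooth_on_graph_function:
  assumes "open J" "smooth1 J \<phi>"
  shows "smooth_on {x::real^4. x$1 \<in> J} (\<lambda>x. x$2 - \<phi> (x$1))"
proof -
  have "Ck_on k {x::real^4. x$1 \<in> J} (\<lambda>x. x$2 - \<phi> (x$1))" for k
  proof (cases k)
    case 0
    have "continuous_on {x::real^4. x$1 \<in> J} (\<lambda>x. \<phi> (x$1))"
      by (rule continuous_on_compose2[OF smooth1_imp_continuous_on[OF assms(2)]])
        (auto intro: continuous_intros)
    then show ?thesis using 0 by (auto intro!: continuous_intros)
  next
    case (Suc j)
    then obtain \<phi>' where d: "\<forall>x\<in>J. (\<phi> has_real_derivative \<phi>' x) (at x)" "Cr j J \<phi>'"
      using assms(2) unfolding smooth1_def by (metis Cr.simps(2))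
    let ?F = "\<lambda>x::real^4. x$2 - \<phi> (x$1)"
    have D: "(?F has_derivative (\<lambda>z. z$2 - \<phi>' (x$1) * z$1)) (at x)" if "x$1 \<in> J" for x
      using d that by (intro has_derivative_graph_function) auto
    have "Ck_on j {x::real^4. x$1 \<in> J} (\<lambda>x. frechet_derivative ?F (at x) z)" for z
      by (rule Ck_on_cong[OF open_coord_preimage[OF assms(1)] _
          Ck_on_first_coord[OF assms(1) Cr_const[of j J 1] d(2), where v = "z$2" and w = "- (z$1)"]])
        (use frechet_derivative_at[OF D] in \<open>auto simp: fun_eq_iff\<close>)
    moreover have "?F differentiable (at x)" if "x$1 \<in> J" for x
      by (rule differentiableI[OF D[OF that]])
    ultimately show ?thesis by (simp add: Suc)
  qed
  then show ?thesis by (simp add: smooth_on_def)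
qed

section \<open>The function \<open>ktilde\<close>\<close>

lemma ktilde_eq:
  assumes "0 \<le> r" "r \<le> 2 * M"
  shows "ktilde M H r = - H * r^3 + sqrt (r^3 * (2 * M - r))"
proof (cases "r = 0")
  case False
  then have "r powr (3/2) = (r powr 3) powr (1/2)"
    by (simp add: powr_powr)
  also have "\<dots> = sqrt (r^3)"
    using assms False by (simp add: powr_half_sqrt)
  finally show ?thesis
    using assms by (simp add: ktilde_def powr_half_sqrt real_sqrt_mult)
qed (simp add: ktilde_def)

lemma continuous_on_ktilde: "continuous_on {0..2*M} (ktilde M H)"
proof -
  have "continuous_on {0..2*M} (\<lambda>r. - H * r^3 + sqrt (r^3 * (2 * M - r)))"
    by (intro continuous_intros)
  then show ?thesis by (simp add: ktilde_eq cong: continuous_on_cong_simp)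
qed

lemma DERIV_sqrt_radicand:
  assumes "0 < r" "r < 2 * M"
  shows "((\<lambda>r. sqrt (r^3 * (2 * M - r))) has_real_derivative
    (2 * r\<^sup>2 * (3 * M - 2 * r)) * (inverse (sqrt (r^3 * (2 * M - r))) / 2)) (at r)"
proof -
  have d: "((\<lambda>r. r^3 * (2 * M - r)) has_real_derivative 2 * r\<^sup>2 * (3 * M - 2 * r)) (at r)"
    by (auto intro!: derivative_eq_intros) (simp add: algebra_simps power2_eq_square power3_eq_cube)
  have "r^3 * (2 * M - r) > 0" using assms by simp
  from DERIV_chain2[OF DERIV_real_sqrt[OF this] d] show ?thesis
    unfolding mult.commute[of "2 * r\<^sup>2 * (3 * M - 2 * r)"] .
qed

text \<open>What remains of the derivative of \<open>ktilde\<close> when the factor r^2 and the term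
  with H are split off. It does not depend on H, so its monotonicity settles the shape of
  \<open>ktilde\<close> for all H at once.\<close>

definition kt_slope :: "real \<Rightarrow> real \<Rightarrow> real" where
  "kt_slope M r = (3 * M - 2 * r) / sqrt (r^3 * (2 * M - r))"

lemma DERIV_ktilde:
  assumes "0 < r" "r < 2 * M"
  shows "(ktilde M H has_real_derivative r\<^sup>2 * (kt_slope M r - 3 * H)) (at r)"
proof (rule has_field_derivative_transform_within_open[of "\<lambda>r. - H * r^3 + sqrt (r^3 * (2 * M - r))" _ _ "{0<..<2*M}"])
  define D where "D = r^3 * (2 * M - r)"
  have D: "D > 0" using assms by (simp add: D_def)
  have "((\<lambda>r. - H * r^3 + sqrt (r^3 * (2 * M - r))) has_real_derivative
      - H * (3 * r\<^sup>2) + (2 * r\<^sup>2 * (3 * M - 2 * r)) * (inverse (sqrt D) / 2)) (at r)"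
    unfolding D_def
  proof (rule DERIV_add)
    show "((\<lambda>r. - H * r^3) has_real_derivative - H * (3 * r\<^sup>2)) (at r)"
      by (rule DERIV_cmult) (auto intro!: derivative_eq_intros)
  qed (rule DERIV_sqrt_radicand[OF assms])
  also have "- H * (3 * r\<^sup>2) + (2 * r\<^sup>2 * (3 * M - 2 * r)) * (inverse (sqrt D) / 2) =
      r\<^sup>2 * (kt_slope M r - 3 * H)"
  proof -
    have "- H * (3 * r\<^sup>2) + (2 * r\<^sup>2 * (3 * M - 2 * r)) * (i / 2) = r\<^sup>2 * ((3 * M - 2 * r) * i - 3 * H)" for i
      by (simp add: algebra_simps)
    then show ?thesis unfolding kt_slope_def D_def divide_inverse[of "3 * M - 2 * r"] .
  qed
  finally show "((\<lambda>r. - H * r^3 + sqrt (r^3 * (2 * M - r))) has_real_derivative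
      r\<^sup>2 * (kt_slope M r - 3 * H)) (at r)" .
qed (use assms in \<open>auto simp: ktilde_eq\<close>)

text \<open>The derivative of the radicand contains the numerator 3M - 2r as a factor, so the second
  term of the quotient rule is minus a square over a root and has the same sign as the
  first.\<close>

lemma kt_slope_decreasing:
  assumes "0 < x" "x < y" "y < 2 * M"
  shows "kt_slope M y < kt_slope M x"
proof (rule DERIV_neg_imp_decreasing[OF \<open>x < y\<close>])
  fix r assume "x \<le> r" "r \<le> y"
  then have r: "0 < r" "r < 2 * M" using assms by auto
  define D where "D = r^3 * (2 * M - r)"
  have D: "D > 0" using r by (simp add: D_def)
  have der: "(kt_slope M has_real_derivative
      (- 2 * sqrt D - (3 * M - 2 * r) * ((2 * r\<^sup>2 * (3 * M - 2 * r)) * (inverse (sqrt D) / 2))) / (sqrt D * sqrt D)) (at r)"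
    unfolding kt_slope_def[abs_def] D_def
  proof (rule DERIV_divide)
    show "((\<lambda>r. 3 * M - 2 * r) has_real_derivative - 2) (at r)"
      by (auto intro!: derivative_eq_intros)
    show "sqrt (r^3 * (2 * M - r)) \<noteq> 0" using r by simp
  qed (rule DERIV_sqrt_radicand[OF r])
  have "(3 * M - 2 * r) * ((2 * r\<^sup>2 * (3 * M - 2 * r)) * (inverse (sqrt D) / 2)) \<ge> 0"
  proof -
    have "(3 * M - 2 * r) * ((2 * r\<^sup>2 * (3 * M - 2 * r)) * (inverse (sqrt D) / 2))
        = (3 * M - 2 * r)\<^sup>2 * r\<^sup>2 * inverse (sqrt D)"
      by (simp add: power2_eq_square)
    also have "\<dots> \<ge> 0" using D by simp
    finally show ?thesis .
  qed
  moreover have "sqrt D > 0" "sqrt D * sqrt D > 0" using D by simp_all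
  ultimately have "(- 2 * sqrt D - (3 * M - 2 * r) * ((2 * r\<^sup>2 * (3 * M - 2 * r)) * (inverse (sqrt D) / 2))) / (sqrt D * sqrt D) < 0"
    by (intro divide_neg_pos) linarith+
  with der show "\<exists>y. (kt_slope M has_real_derivative y) (at r) \<and> y < 0" by (intro exI conjI)
qed

text \<open>The radicand tends to 0 from above at both ends of (0, 2M), while the numerator tends to
  3M > 0 at 0 and to -M < 0 at 2M. So the slope runs from plus to minus infinity and meets 3H for
  every real H.\<close>

lemma ktilde_slope_zero:
  assumes "M > 0"
  shows "\<exists>R\<in>{0<..<2*M}. kt_slope M R = 3 * H"
proof -
  have sq: "((\<lambda>r. sqrt (r^3 * (2 * M - r))) \<longlongrightarrow> 0) (at_right 0)"
    "((\<lambda>r. sqrt (r^3 * (2 * M - r))) \<longlongrightarrow> 0) (at_left (2*M))"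
    by (auto intro!: tendsto_eq_intros)
  have pos: "\<forall>\<^sub>F r in at_right 0. 0 < sqrt (r^3 * (2 * M - r))"
    using assms by (auto simp: eventually_at_right intro!: exI[of _ "2*M"])
  have pos': "\<forall>\<^sub>F r in at_left (2*M). 0 < sqrt (r^3 * (2 * M - r))"
    using assms unfolding eventually_at_left_field by (intro exI[of _ 0]) auto
  have "filterlim (kt_slope M) at_top (at_right 0)"
    unfolding kt_slope_def[abs_def]
    by (rule LIM_at_top_divide[of _ "3 * M"]) (use assms sq pos in \<open>auto intro!: tendsto_eq_intros\<close>)
  then have "\<forall>\<^sub>F r in at_right 0. 3 * H < kt_slope M r"
    by (auto simp: filterlim_at_top_dense)
  then obtain b where b: "b > 0" "\<And>r. 0 < r \<Longrightarrow> r < b \<Longrightarrow> 3 * H < kt_slope M r"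
    unfolding eventually_at_right_field by blast
  have "filterlim (\<lambda>r. (2 * r - 3 * M) / sqrt (r^3 * (2 * M - r))) at_top (at_left (2*M))"
    by (rule LIM_at_top_divide[of _ "M"]) (use assms sq pos' in \<open>auto intro!: tendsto_eq_intros\<close>)
  then have "\<forall>\<^sub>F r in at_left (2*M). - 3 * H < (2 * r - 3 * M) / sqrt (r^3 * (2 * M - r))"
    by (auto simp: filterlim_at_top_dense)
  then have "\<forall>\<^sub>F r in at_left (2*M). 3 * H > kt_slope M r"
    by eventually_elim (simp add: kt_slope_def diff_divide_distrib)
  then obtain a where a: "a < 2*M" "\<And>r. a < r \<Longrightarrow> r < 2*M \<Longrightarrow> 3 * H > kt_slope M r"
    unfolding eventually_at_left_field by blast
  define x where "x = min (b/2) M / 2"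
  define y where "y = max ((a + 2*M)/2) (3*M/2)"
  have xy: "0 < x" "x < b" "x < y" "y < 2*M" "a < y"
    using a(1) b(1) assms by (auto simp: x_def y_def min_def max_def)
  have "continuous_on {x..y} (kt_slope M)"
    unfolding kt_slope_def[abs_def] using xy by (intro continuous_intros) auto
  then have "\<exists>R\<ge>x. R \<le> y \<and> kt_slope M R = 3 * H"
    using a(2)[of y] b(2)[of x] xy by (intro IVT2') auto
  then show ?thesis using xy by force
qed

lemma ktilde_shape:
  assumes "M > 0"
  shows R_max_in: "R_max M H \<in> {0<..<2*M}"
    and ktilde_increasing: "\<And>x y. 0 < x \<Longrightarrow> x < y \<Longrightarrow> y \<le> R_max M H \<Longrightarrow> ktilde M H x < ktilde M H y"
    and ktilde_decreasing: "\<And>x y. R_max M H \<le> x \<Longrightarrow> x < y \<Longrightarrow> y \<le> 2 * M \<Longrightarrow> ktilde M H y < ktilde M H x"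
    and kt_slope_R_max: "kt_slope M (R_max M H) = 3 * H"
proof -
  obtain R where R: "0 < R" "R < 2 * M" "kt_slope M R = 3 * H"
    using ktilde_slope_zero[OF assms, of H] by auto
  have inc: "ktilde M H x < ktilde M H y" if "0 < x" "x < y" "y \<le> R" for x y
  proof (rule DERIV_pos_imp_increasing_open[OF \<open>x < y\<close>])
    show "\<exists>D. (ktilde M H has_real_derivative D) (at r) \<and> 0 < D" if "x < r" "r < y" for r
      using DERIV_ktilde[of r M H] kt_slope_decreasing[of r R M] that \<open>0 < x\<close> \<open>y \<le> R\<close> R
      by (intro exI[of _ "r\<^sup>2 * (kt_slope M r - 3 * H)"]) auto
    show "continuous_on {x..y} (ktilde M H)"
      by (rule continuous_on_subset[OF continuous_on_ktilde]) (use that R in auto)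
  qed
  have dec: "ktilde M H y < ktilde M H x" if "R \<le> x" "x < y" "y \<le> 2 * M" for x y
  proof (rule DERIV_neg_imp_decreasing_open[OF \<open>x < y\<close>])
    show "\<exists>D. (ktilde M H has_real_derivative D) (at r) \<and> D < 0" if "x < r" "r < y" for r
      using DERIV_ktilde[of r M H] kt_slope_decreasing[of R r M] that \<open>R \<le> x\<close> \<open>y \<le> 2 * M\<close> R
      by (intro exI[of _ "r\<^sup>2 * (kt_slope M r - 3 * H)"]) (auto intro!: mult_pos_neg)
    show "continuous_on {x..y} (ktilde M H)"
      by (rule continuous_on_subset[OF continuous_on_ktilde]) (use that R in auto)
  qed
  have max: "ktilde M H r < ktilde M H R" if "r \<in> {0<..<2*M}" "r \<noteq> R" for r
    using inc[of r R] dec[of R r] that by (cases "r < R") auto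
  have "R_max M H = R"
    unfolding R_max_def
  proof (rule the_equality)
    fix R' assume R': "R' \<in> {0<..<2*M} \<and> (\<forall>r\<in>{0<..<2*M}. r \<noteq> R' \<longrightarrow> ktilde M H r < ktilde M H R')"
    show "R' = R"
    proof (rule ccontr)
      assume "R' \<noteq> R"
      then show False using max[of R'] R' R by force
    qed
  qed (use R max in auto)
  with R inc dec show "R_max M H \<in> {0<..<2*M}"
    "\<And>x y. 0 < x \<Longrightarrow> x < y \<Longrightarrow> y \<le> R_max M H \<Longrightarrow> ktilde M H x < ktilde M H y"
    "\<And>x y. R_max M H \<le> x \<Longrightarrow> x < y \<Longrightarrow> y \<le> 2 * M \<Longrightarrow> ktilde M H y < ktilde M H x"
    "kt_slope M (R_max M H) = 3 * H"
    by auto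
qed

lemma ktilde_less_C_max:
  assumes "M > 0" "0 < r" "r < 2 * M" "r \<noteq> R_max M H"
  shows "ktilde M H r < C_max M H"
  using ktilde_increasing[OF assms(1), of r "R_max M H" H] ktilde_decreasing[OF assms(1), of H "R_max M H" r] assms
  by (cases "r < R_max M H") (auto simp: C_max_def)

text \<open>The radial components of the normal and of the tangent are \<open>kfun\<close> and \<open>\<plusminus>sqrt Wfun\<close>.\<close>

definition kfun :: "real \<Rightarrow> real \<Rightarrow> real \<Rightarrow> real" where
  "kfun H c r = H * r + c / r^2"

definition Wfun :: "real \<Rightarrow> real \<Rightarrow> real \<Rightarrow> real \<Rightarrow> real" where
  "Wfun M H c r = schw_h M r + (kfun H c r)^2"

text \<open>This is r^4 times \<open>Wfun\<close>, as a genuine polynomial, so that the order of a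
  zero of \<open>Wfun\<close> can be found by dividing out linear factors.\<close>

definition Wpoly :: "real \<Rightarrow> real \<Rightarrow> real \<Rightarrow> real poly" where
  "Wpoly M H c = [:c^2, 0, 0, 2 * H * c - 2 * M, 1, 0, H^2:]"

lemma poly_Wpoly: "poly (Wpoly M H c) r = (H * r^3 + c)^2 + r^4 - 2 * M * r^3"
  by (simp add: Wpoly_def algebra_simps power2_eq_square power3_eq_cube power4_eq_xxxx)

lemma Wfun_Wpoly: "r \<noteq> 0 \<Longrightarrow> Wfun M H c r = poly (Wpoly M H c) r / r^4"
  by (simp add: Wfun_def kfun_def schw_h_def poly_Wpoly field_simps power2_eq_square power3_eq_cube power4_eq_xxxx)

text \<open>A difference of squares: r^4 - 2 M r^3 is minus the square of s = sqrt (r^3 (2M - r)),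
  and H r^3 + c - s is c minus \<open>ktilde\<close>. Inside (0, 2M) the other factor is positive
  wherever \<open>ktilde\<close> is at most c.\<close>

lemma Wpoly_factor:
  assumes "0 \<le> r" "r \<le> 2 * M"
  shows "poly (Wpoly M H c) r = (c - ktilde M H r) * (H * r^3 + c + sqrt (r^3 * (2 * M - r)))"
proof -
  have "sqrt (r^3 * (2 * M - r)) * sqrt (r^3 * (2 * M - r)) = r^3 * (2 * M - r)"
    using assms by simp
  then show ?thesis
    using assms by (simp add: ktilde_eq poly_Wpoly algebra_simps power2_eq_square power3_eq_cube power4_eq_xxxx)
qed

lemma kfun_pos_inside:
  assumes "0 < r" "r < 2 * M" "ktilde M H r \<le> c"
  shows "kfun H c r > 0" and "H * r^3 + c \<ge> sqrt (r^3 * (2 * M - r))"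
proof -
  have "sqrt (r^3 * (2 * M - r)) > 0" using assms by simp
  with assms show "H * r^3 + c \<ge> sqrt (r^3 * (2 * M - r))" by (simp add: ktilde_eq)
  with \<open>sqrt _ > 0\<close> have "H * r^3 + c > 0" by linarith
  then have "(H * r^3 + c) / r^2 > 0" using assms by simp
  then show "kfun H c r > 0" using assms by (simp add: kfun_def field_simps power2_eq_square power3_eq_cube)
qed

lemma kfun_pos_horizon:
  assumes "M > 0" "c > - 8 * M^3 * H"
  shows "kfun H c (2 * M) > 0"
proof -
  have "kfun H c (2 * M) = (c + 8 * M^3 * H) / (2*M)^2"
    using assms by (simp add: kfun_def field_simps power2_eq_square power3_eq_cube)
  also have "\<dots> > 0" using assms by simp
  finally show ?thesis .
qed

lemma Wfun_pos:
  assumes "M > 0" "c > - 8 * M^3 * H" "0 < r" "r < 2 * M \<Longrightarrow> ktilde M H r < c"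
  shows "Wfun M H c r > 0"
proof -
  consider "r < 2 * M" | "r = 2 * M" | "r > 2 * M" by linarith
  then show ?thesis
  proof cases
    case 1
    then have "sqrt (r^3 * (2 * M - r)) > 0" using assms by simp
    moreover have "H * r^3 + c \<ge> sqrt (r^3 * (2 * M - r))"
      using kfun_pos_inside(2)[of r M H c] assms 1 by simp
    ultimately have "H * r^3 + c + sqrt (r^3 * (2 * M - r)) > 0" by linarith
    then have "poly (Wpoly M H c) r > 0"
      using assms 1 by (simp add: Wpoly_factor)
    then show ?thesis using assms by (simp add: Wfun_Wpoly)
  next
    case 2
    then show ?thesis using kfun_pos_horizon[OF assms(1,2)] assms by (simp add: Wfun_def schw_h_def)
  next
    case 3
    then have "schw_h M r > 0" using assms by (simp add: schw_h_def)
    then show ?thesis by (simp add: Wfun_def add_pos_nonneg)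
  qed
qed

text \<open>With l4^2 = k^2 / (-h) the quotient under the root is k^2 / (k^2 + h). As k > 0 here,
  the root is k / sqrt W without absolute value, and the integrand takes the same form as in
  \<open>f1_integrand_eq\<close>: the rate of t with respect to r along the curve.\<close>

lemma f4_integrand_eq:
  assumes "M > 0" "0 < r" "r < 2 * M" "ktilde M H r < c" "c > - 8 * M^3 * H"
  shows "f4_integrand M H c r = kfun H c r / (schw_h M r * sqrt (Wfun M H c r))"
proof -
  have h: "schw_h M r < 0" using assms by (simp add: schw_h_def)
  have k: "kfun H c r > 0" using kfun_pos_inside(1) assms by force
  have W: "Wfun M H c r > 0" by (rule Wfun_pos) (use assms in auto)
  have l: "(l4 M H c r)^2 = (kfun H c r)^2 / (- schw_h M r)"
    using h by (simp add: l4_def kfun_def power_mult_distrib power_divide)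
  have "(l4 M H c r)^2 / ((l4 M H c r)^2 - 1) = (kfun H c r)^2 / Wfun M H c r"
    using h W unfolding l by (simp add: Wfun_def divide_simps) (simp add: algebra_simps)
  then show ?thesis using k by (simp add: f4_integrand_def real_sqrt_divide)
qed

lemma f1_integrand_eq:
  assumes "M > 0" "2 * M < r"
  shows "l1 M H c r / schw_h M r * (1 / sqrt (1 + (l1 M H c r)^2)) =
    kfun H c r / (schw_h M r * sqrt (Wfun M H c r))"
proof -
  have h: "schw_h M r > 0" using assms by (simp add: schw_h_def)
  then have W: "Wfun M H c r > 0" by (simp add: Wfun_def add_pos_nonneg)
  have l: "(l1 M H c r)^2 = (kfun H c r)^2 / schw_h M r"
    using h by (simp add: l1_def kfun_def power_mult_distrib power_divide)
  have "1 + (l1 M H c r)^2 = Wfun M H c r / schw_h M r"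
    using h unfolding l by (simp add: Wfun_def field_simps)
  then show ?thesis using h W by (simp add: real_sqrt_divide l1_def kfun_def)
qed

section \<open>Divergence at a double zero\<close>

text \<open>The integral over the whole interval dominates every increment of the primitive, f being
  nonnegative. It is used contrapositively: an unbounded primitive, a logarithm below, rules out
  integrability.\<close>

lemma primitive_bounded_of_integrable:
  fixes f F :: "real \<Rightarrow> real"
  assumes F: "\<And>x. x \<in> {a<..<b} \<Longrightarrow> (F has_real_derivative f x) (at x)"
    and f: "continuous_on {a<..<b} f" "\<And>x. x \<in> {a<..<b} \<Longrightarrow> 0 \<le> f x"
    and int: "set_integrable lborel {a<..<b} f"
  shows "\<exists>B. \<forall>x y. a < x \<longrightarrow> x \<le> y \<longrightarrow> y < b \<longrightarrow> F y - F x \<le> B"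
proof (intro exI[of _ "set_lebesgue_integral lborel {a<..<b} f"] allI impI)
  fix x y assume xy: "a < x" "x \<le> y" "y < b"
  have sub: "{x..y} \<subseteq> {a<..<b}" using xy by auto
  have "set_lebesgue_integral lborel {x..y} f = F y - F x"
    unfolding set_lebesgue_integral_def
    by (rule integral_FTC_atLeastAtMost[OF xy(2)])
      (use F sub continuous_on_subset[OF f(1) sub] in
        \<open>auto simp flip: has_real_derivative_iff_has_vector_derivative
          intro!: has_field_derivative_at_within F\<close>)
  moreover have "set_lebesgue_integral lborel {x..y} f \<le> set_lebesgue_integral lborel {a<..<b} f"
    unfolding set_lebesgue_integral_def
    by (rule integral_mono)
      (use set_integrable_subset[OF int _ sub] int f sub in \<open>auto simp: set_integrable_def indicator_def\<close>)
  ultimately show "F y - F x \<le> set_lebesgue_integral lborel {a<..<b} f" by simp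
qed

lemma not_integrable_simple_pole_right:
  fixes a :: real
  assumes "a < b"
  shows "\<not> set_integrable lborel {a<..<b} (\<lambda>x. 1 / (x - a))"
proof
  assume "set_integrable lborel {a<..<b} (\<lambda>x. 1 / (x - a))"
  then obtain B where B: "\<And>x y. a < x \<Longrightarrow> x \<le> y \<Longrightarrow> y < b \<Longrightarrow> ln (y - a) - ln (x - a) \<le> B"
    using primitive_bounded_of_integrable[of a b "\<lambda>x. ln (x - a)" "\<lambda>x. 1 / (x - a)"]
    by (force intro!: derivative_eq_intros continuous_intros)
  define d where "d = (b - a) / 2"
  have d: "d > 0" "a + d < b" using assms by (simp_all add: d_def field_simps)
  \<comment> \<open>Chosen so that ln d - ln e = |B| + 1, which exceeds the supposed bound
    B.\<close>
  define e where "e = d * exp (- \<bar>B\<bar> - 1)"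
  have "e > 0" "e \<le> d * 1" unfolding e_def using d by (simp, intro mult_left_mono) auto
  then have "ln d - ln e \<le> B" using B[of "a + e" "a + d"] d by simp
  moreover have "ln d - ln e = \<bar>B\<bar> + 1" using d by (simp add: e_def ln_mult)
  ultimately show False by linarith
qed

lemma not_integrable_simple_pole_left:
  fixes b :: real
  assumes "a < b"
  shows "\<not> set_integrable lborel {a<..<b} (\<lambda>x. 1 / (b - x))"
proof
  assume "set_integrable lborel {a<..<b} (\<lambda>x. 1 / (b - x))"
  then obtain B where B: "\<And>x y. a < x \<Longrightarrow> x \<le> y \<Longrightarrow> y < b \<Longrightarrow> - ln (b - y) + ln (b - x) \<le> B"
    using primitive_bounded_of_integrable[of a b "\<lambda>x. - ln (b - x)" "\<lambda>x. 1 / (b - x)"]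
    by (force intro!: derivative_eq_intros continuous_intros)
  define d where "d = (b - a) / 2"
  have d: "d > 0" "a < b - d" using assms by (simp_all add: d_def field_simps)
  define e where "e = d * exp (- \<bar>B\<bar> - 1)"
  have "e > 0" "e \<le> d * 1" unfolding e_def using d by (simp, intro mult_left_mono) auto
  then have "ln d - ln e \<le> B" using B[of "b - d" "b - e"] d by simp
  moreover have "ln d - ln e = \<bar>B\<bar> + 1" using d by (simp add: e_def ln_mult)
  ultimately show False by linarith
qed

section \<open>The area radius of the Kruskal extension\<close>

text \<open>The product UV on the sphere of radius r. Of the two companions, \<open>Pk\<close> is
  its derivative in r and \<open>Fk\<close> the coefficient of dU dV in the metric.\<close>

definition Gk :: "real \<Rightarrow> real \<Rightarrow> real" where
  "Gk M r = (r - 2 * M) * exp (r / (2 * M))"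

definition Pk :: "real \<Rightarrow> real \<Rightarrow> real" where
  "Pk M r = r / (2 * M) * exp (r / (2 * M))"

definition Fk :: "real \<Rightarrow> real \<Rightarrow> real" where
  "Fk M r = 16 * M\<^sup>2 * exp (- r / (2 * M)) / r"

lemma Pk_pos: "M > 0 \<Longrightarrow> r > 0 \<Longrightarrow> Pk M r > 0"
  by (simp add: Pk_def)

lemma Fk_pos: "M > 0 \<Longrightarrow> r > 0 \<Longrightarrow> Fk M r > 0"
  by (simp add: Fk_def)

text \<open>This constant product ties the metric to the radius: a tangent (n, m) has unit length, n
  m F = 1, exactly when P = 8 M n m.\<close>

lemma Fk_Pk: "M > 0 \<Longrightarrow> r > 0 \<Longrightarrow> Fk M r * Pk M r = 8 * M"
  by (simp add: Fk_def Pk_def exp_minus field_simps power2_eq_square)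

lemma DERIV_Gk:
  assumes "M > 0" shows "(Gk M has_real_derivative Pk M r) (at r)"
proof -
  have "((\<lambda>r. (r - 2 * M) * exp (r / (2 * M))) has_real_derivative
      1 * exp (r / (2 * M)) + exp (r / (2 * M)) * (1 / (2 * M)) * (r - 2 * M)) (at r)"
    by (rule DERIV_mult) (use assms in \<open>auto intro!: derivative_eq_intros\<close>)
  also have "1 * exp (r / (2 * M)) + exp (r / (2 * M)) * (1 / (2 * M)) * (r - 2 * M) = Pk M r"
    using assms by (simp add: Pk_def field_simps)
  finally show ?thesis unfolding Gk_def[abs_def] .
qed

lemma DERIV_Pk:
  assumes "M > 0" "r > 0" shows "(Pk M has_real_derivative (1 / r + 1 / (2 * M)) * Pk M r) (at r)"
proof -
  have "((\<lambda>r. r / (2 * M) * exp (r / (2 * M))) has_real_derivative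
      1 / (2 * M) * exp (r / (2 * M)) + exp (r / (2 * M)) * (1 / (2 * M)) * (r / (2 * M))) (at r)"
    by (rule DERIV_mult) (use assms in \<open>auto intro!: derivative_eq_intros\<close>)
  also have "1 / (2 * M) * exp (r / (2 * M)) + exp (r / (2 * M)) * (1 / (2 * M)) * (r / (2 * M)) =
      (1 / r + 1 / (2 * M)) * Pk M r"
    using assms by (simp add: Pk_def field_simps)
  finally show ?thesis unfolding Pk_def[abs_def] .
qed

lemma DERIV_Fk:
  assumes "M > 0" "r > 0"
  shows "(Fk M has_real_derivative - (1 / r + 1 / (2 * M)) * Fk M r) (at r)"
proof -
  have "((\<lambda>r. 16 * M\<^sup>2 * exp (- r / (2 * M)) / r) has_real_derivative
      (16 * M\<^sup>2 * (exp (- r / (2 * M)) * (- 1 / (2 * M))) * r - 16 * M\<^sup>2 * exp (- r / (2 * M)) * 1) / (r * r)) (at r)"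
    by (rule DERIV_divide) (use assms in \<open>auto intro!: derivative_eq_intros\<close>)
  also have "(16 * M\<^sup>2 * (exp (- r / (2 * M)) * (- 1 / (2 * M))) * r - 16 * M\<^sup>2 * exp (- r / (2 * M)) * 1) / (r * r)
      = - (1 / r + 1 / (2 * M)) * Fk M r"
    using assms by (simp add: Fk_def field_simps)
  finally show ?thesis unfolding Fk_def[abs_def] .
qed

lemma Gk_strict_mono:
  assumes "M > 0" "0 \<le> x" "x < y" shows "Gk M x < Gk M y"
proof (rule DERIV_pos_imp_increasing_open[OF \<open>x < y\<close>])
  show "\<exists>D. (Gk M has_real_derivative D) (at r) \<and> 0 < D" if "x < r" "r < y" for r
    using DERIV_Gk[OF assms(1)] Pk_pos[OF assms(1)] that assms(2) by (intro exI[of _ "Pk M r"]) auto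
  show "continuous_on {x..y} (Gk M)"
    unfolding Gk_def[abs_def] using assms by (intro continuous_intros) auto
qed

lemma Gk_inj: "M > 0 \<Longrightarrow> 0 \<le> x \<Longrightarrow> 0 \<le> y \<Longrightarrow> Gk M x = Gk M y \<Longrightarrow> x = y"
  using Gk_strict_mono[of M x y] Gk_strict_mono[of M y x] by (cases x y rule: linorder_cases) auto

lemma Gk_0: "Gk M 0 = - 2 * M"
  by (simp add: Gk_def)

lemma Gk_sgn:
  assumes "M > 0"
  shows "Gk M r > 0 \<longleftrightarrow> r > 2 * M" "Gk M r < 0 \<longleftrightarrow> r < 2 * M" "Gk M r = 0 \<longleftrightarrow> r = 2 * M"
  by (auto simp: Gk_def zero_less_mult_iff mult_less_0_iff)

lemma Gk_gt: "M > 0 \<Longrightarrow> r > 0 \<Longrightarrow> Gk M r > - 2 * M"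
  using Gk_strict_mono[of M 0 r] by (simp add: Gk_0)

lemma Gk_Pk: "M > 0 \<Longrightarrow> r > 0 \<Longrightarrow> Gk M r = 2 * M * schw_h M r * Pk M r"
  by (simp add: Gk_def Pk_def schw_h_def field_simps)

lemma Gk_surj:
  assumes "M > 0" "z > - 2 * M"
  obtains r where "r > 0" "Gk M r = z"
proof -
  \<comment> \<open>At r = 2M + |z| the linear factor is |z| and the exponential is at least 1, so
    \<open>Gk\<close> is at least z there; at r = 0 it is -2M < z.\<close>
  have "1 * \<bar>z\<bar> \<le> exp ((2 * M + \<bar>z\<bar>) / (2 * M)) * \<bar>z\<bar>"
    using assms by (intro mult_right_mono) (auto simp: divide_simps)
  then have "z \<le> Gk M (2 * M + \<bar>z\<bar>)" by (simp add: Gk_def mult.commute)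
  moreover have "continuous_on {0..2 * M + \<bar>z\<bar>} (Gk M)"
    unfolding Gk_def[abs_def] using assms by (intro continuous_intros) auto
  ultimately have "\<exists>r\<ge>0. r \<le> 2 * M + \<bar>z\<bar> \<and> Gk M r = z"
    using assms by (intro IVT') (auto simp: Gk_0)
  then obtain r where "r \<ge> 0" "Gk M r = z" by auto
  then show ?thesis using that[of r] assms by (cases "r = 0") (auto simp: Gk_0)
qed

lemma kruskal_r_unique:
  assumes "M > 0" "r > 0" "Gk M r = U * V"
  shows "kruskal_r M U V = r"
  unfolding kruskal_r_def
proof (rule the_equality)
  show "r' = r" if "0 < r' \<and> (r' - 2 * M) * exp (r' / (2 * M)) = U * V" for r'
    using that assms Gk_inj[OF assms(1), of r' r] by (simp add: Gk_def)
qed (use assms in \<open>auto simp: Gk_def\<close>)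

lemma kruskal_r_props:
  assumes "M > 0" "U * V > - 2 * M"
  shows kruskal_r_pos: "kruskal_r M U V > 0" and Gk_kruskal_r: "Gk M (kruskal_r M U V) = U * V"
proof -
  obtain r where r: "r > 0" "Gk M r = U * V" using Gk_surj[OF assms] .
  with kruskal_r_unique[OF assms(1) this] show "kruskal_r M U V > 0" "Gk M (kruskal_r M U V) = U * V"
    by auto
qed

text \<open>Only the product UV enters, so with first argument 1 the radius becomes a function of
  one real variable, the inverse of \<open>Gk\<close>.\<close>

lemma kruskal_r_prod: "kruskal_r M U V = kruskal_r M 1 (U * V)"
  by (simp add: kruskal_r_def)

lemma DERIV_inverse_strong:
  fixes f g :: "real \<Rightarrow> real"
  assumes "open S" "x \<in> S" "continuous_on S f" "\<And>x. x \<in> S \<Longrightarrow> g (f x) = x"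
    and "(f has_real_derivative D) (at x)" "D \<noteq> 0"
  shows "(g has_real_derivative inverse D) (at (f x))"
proof -
  have "(g has_derivative (*) (inverse D)) (at (f x))"
    by (rule has_derivative_inverse_strong[OF assms(1-4), of "(*) D"])
      (use assms(5,6) in \<open>auto simp: has_field_derivative_def fun_eq_iff\<close>)
  then show ?thesis by (simp add: has_field_derivative_def)
qed

lemma DERIV_kruskal_r:
  assumes "M > 0" "z > - 2 * M"
  shows "(kruskal_r M 1 has_real_derivative 1 / Pk M (kruskal_r M 1 z)) (at z)"
proof -
  have r: "kruskal_r M 1 z > 0" "Gk M (kruskal_r M 1 z) = z"
    using kruskal_r_props[of M 1 z] assms by simp_all
  have "(kruskal_r M 1 has_real_derivative inverse (Pk M (kruskal_r M 1 z))) (at (Gk M (kruskal_r M 1 z)))"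
  proof (rule DERIV_inverse_strong[where S = "{0<..}" and f = "Gk M" and x = "kruskal_r M 1 z"])
    show "continuous_on {0<..} (Gk M)"
      unfolding Gk_def[abs_def] using assms by (intro continuous_intros) auto
    show "Pk M (kruskal_r M 1 z) \<noteq> 0" using Pk_pos[OF assms(1) r(1)] by simp
    show "kruskal_r M 1 (Gk M x) = x" if "x \<in> {0<..}" for x
      using kruskal_r_unique[of M x 1 "Gk M x"] assms(1) that by simp
    show "(Gk M has_real_derivative Pk M (kruskal_r M 1 z)) (at (kruskal_r M 1 z))"
      by (rule DERIV_Gk[OF assms(1)])
  qed (use r in simp_all)
  then show ?thesis using r by (simp add: divide_inverse)
qed

lemma has_derivative_kruskal_r:
  fixes x :: "real^4"
  assumes "M > 0" "x$1 * x$2 > - 2 * M"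
  shows "((\<lambda>x. kruskal_r M (x$1) (x$2)) has_derivative
    (\<lambda>z. 1 / Pk M (kruskal_r M (x$1) (x$2)) * (x$1 * z$2 + z$1 * x$2))) (at x)"
proof -
  have p: "((\<lambda>x::real^4. x$i) has_derivative (\<lambda>z. z$i)) (at x)" for i
    by (rule bounded_linear_imp_has_derivative[OF bounded_linear_vec_nth])
  show ?thesis
    using has_derivative_compose[OF has_derivative_mult[OF p[of 1] p[of 2]]
      DERIV_kruskal_r[OF assms, unfolded has_field_derivative_def]]
    by (simp flip: kruskal_r_prod)
qed

section \<open>Levi-Civita derivatives without the inverse metric\<close>

lemma matrix_inv_right:
  fixes A :: "real^'n^'n"
  assumes "invertible A" shows "A ** matrix_inv A = mat 1"
proof -
  have "\<exists>B. A ** B = mat 1 \<and> B ** A = mat 1" using assms unfolding invertible_def .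
  from someI_ex[OF this] show ?thesis unfolding matrix_inv_def by blast
qed

lemma vector_4 [simp]:
  "(vector [x, y, z, w] :: ('a::zero)^4) $ 1 = x"
  "(vector [x, y, z, w] :: ('a::zero)^4) $ 2 = y"
  "(vector [x, y, z, w] :: ('a::zero)^4) $ 3 = z"
  "(vector [x, y, z, w] :: ('a::zero)^4) $ 4 = w"
  unfolding vector_def by simp_all

text \<open>Lowering the upper index with g cancels the inverse metric in the Christoffel symbols.
  Since v fills both slots i and l, the two metric derivatives that are exchanged by swapping i and
  l cancel, and half the derivative of g along N, evaluated on (v, v), is left.\<close>

lemma gprod_cov_deriv:
  assumes sym: "\<And>x i j. g x $ i $ j = g x $ j $ i" and inv: "invertible (g p)"
  shows "gprod g p (cov_deriv g N p v) v = gprod g p (frechet_derivative N (at p) v) v +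
    1/2 * (\<Sum>l\<in>UNIV. \<Sum>i\<in>UNIV. \<Sum>j\<in>UNIV. partial j (\<lambda>x. g x $ i $ l) p * v$i * N p$j * v$l)"
proof -
  define A where "A i j l = partial i (\<lambda>x. g x $ j $ l) p + partial j (\<lambda>x. g x $ i $ l) p
    - partial l (\<lambda>x. g x $ i $ j) p" for i j l
  define a where "a = (\<chi> l. \<Sum>i\<in>UNIV. \<Sum>j\<in>UNIV. A i j l * v$i * N p$j)"
  define B where "B = matrix_inv (g p)"
  have tg: "transpose (g p) = g p" by (simp add: transpose_def vec_eq_iff sym)
  have "transpose B ** g p = transpose (g p ** B)"
    by (simp add: matrix_transpose_mul tg)
  also have "\<dots> = mat 1"
    using inv by (simp add: B_def matrix_inv_right transpose_mat)
  finally have tB: "transpose B ** g p = mat 1" .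
  have "(\<Sum>i\<in>UNIV. \<Sum>j\<in>UNIV. christoffel g p k i j * v $ i * N p $ j) = (1/2 * (B *v a) $ k)" for k
  proof -
    have "(\<Sum>i\<in>UNIV. \<Sum>j\<in>UNIV. christoffel g p k i j * v $ i * N p $ j) =
      (\<Sum>i\<in>UNIV. \<Sum>j\<in>UNIV. \<Sum>l\<in>UNIV. 1/2 * (B$k$l * (A i j l * v$i * N p$j)))"
      by (simp add: christoffel_def A_def B_def sum_distrib_left sum_distrib_right mult_ac)
    also have "\<dots> = (\<Sum>i\<in>UNIV. \<Sum>l\<in>UNIV. \<Sum>j\<in>UNIV. 1/2 * (B$k$l * (A i j l * v$i * N p$j)))"
      by (intro sum.cong refl sum.swap)
    also have "\<dots> = (\<Sum>l\<in>UNIV. \<Sum>i\<in>UNIV. \<Sum>j\<in>UNIV. 1/2 * (B$k$l * (A i j l * v$i * N p$j)))"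
      by (rule sum.swap)
    also have "\<dots> = 1/2 * (B *v a) $ k"
      by (simp add: matrix_vector_mult_def a_def sum_distrib_left)
    finally show ?thesis .
  qed
  then have cov: "cov_deriv g N p v = frechet_derivative N (at p) v + (1/2) *\<^sub>R (B *v a)"
    unfolding cov_deriv_def by (simp add: vec_eq_iff)
  have "(B *v a) \<bullet> (g p *v v) = a \<bullet> (transpose B *v (g p *v v))"
    by (metis dot_lmul_matrix transpose_matrix_vector transpose_transpose)
  also have "\<dots> = a \<bullet> v"
    by (simp add: matrix_vector_mul_assoc tB)
  finally have "gprod g p (cov_deriv g N p v) v = gprod g p (frechet_derivative N (at p) v) v + 1/2 * (a \<bullet> v)"
    by (simp add: cov gprod_def inner_add_left)
  moreover have "a \<bullet> v = (\<Sum>l\<in>UNIV. \<Sum>i\<in>UNIV. \<Sum>j\<in>UNIV. partial j (\<lambda>x. g x $ i $ l) p * v$i * N p$j * v$l)"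
  proof -
    define f where "f i j l = partial i (\<lambda>x. g x $ j $ l) p * v$i * N p$j * v$l" for i j l
    define f' where "f' i j l = partial j (\<lambda>x. g x $ i $ l) p * v$i * N p$j * v$l" for i j l
    have s: "partial l (\<lambda>x. g x $ i $ j) p = partial l (\<lambda>x. g x $ j $ i) p" for i j l
      by (rule arg_cong[of _ _ "\<lambda>h. partial l h p"]) (simp add: fun_eq_iff sym)
    have "a \<bullet> v = (\<Sum>l\<in>UNIV. \<Sum>i\<in>UNIV. \<Sum>j\<in>UNIV. f i j l + f' i j l - f l j i)"
      unfolding inner_vec_def a_def A_def f_def f'_def
      by (simp add: sum_distrib_left sum_distrib_right s algebra_simps)
    also have "\<dots> = (\<Sum>l\<in>UNIV. \<Sum>i\<in>UNIV. \<Sum>j\<in>UNIV. f i j l) + (\<Sum>l\<in>UNIV. \<Sum>i\<in>UNIV. \<Sum>j\<in>UNIV. f' i j l)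
        - (\<Sum>l\<in>UNIV. \<Sum>i\<in>UNIV. \<Sum>j\<in>UNIV. f l j i)"
      by (simp only: sum.distrib sum_subtractf)
    also have "(\<Sum>l\<in>UNIV. \<Sum>i\<in>UNIV. \<Sum>j\<in>UNIV. f l j i) = (\<Sum>l\<in>UNIV. \<Sum>i\<in>UNIV. \<Sum>j\<in>UNIV. f i j l)"
      by (rule sum.swap)
    finally show ?thesis by (simp add: f'_def)
  qed
  ultimately show ?thesis by simp
qed

section \<open>The Kruskal metric\<close>

lemma kruskal_metric_eq:
  "kruskal_metric M x = (let r = kruskal_r M (x$1) (x$2) in
     vector [vector [0, Fk M r / 2, 0, 0], vector [Fk M r / 2, 0, 0, 0],
       vector [0, 0, r^2, 0], vector [0, 0, 0, r^2 * (sin (x$3))^2]])"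
  by (simp add: kruskal_metric_def Fk_def Let_def)

lemma gprod_kruskal:
  "gprod (kruskal_metric M) x v w = (let r = kruskal_r M (x$1) (x$2) in
     Fk M r / 2 * (v$1 * w$2 + v$2 * w$1) + r^2 * (v$3 * w$3) + r^2 * (sin (x$3))^2 * (v$4 * w$4))"
  by (simp add: gprod_def kruskal_metric_eq Let_def inner_vec_def matrix_vector_mult_def sum_4 algebra_simps)

lemma kruskal_metric_sym: "kruskal_metric M x $ i $ j = kruskal_metric M x $ j $ i"
proof -
  have "\<forall>i j. kruskal_metric M x $ i $ j = kruskal_metric M x $ j $ i"
    by (simp add: forall_4 kruskal_metric_eq Let_def)
  then show ?thesis by simp
qed

lemma patch_dom_open: "open (patch_dom M)"
proof -
  have "patch_dom M = {x. - 2 * M < x$1 * x$2} \<inter> {x. 0 < x$3} \<inter> {x. x$3 < pi} \<inter> {x. 0 < x$4} \<inter> {x. x$4 < 2 * pi}"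
    by (auto simp: patch_dom_def)
  then show ?thesis
    by (auto intro!: open_Int open_Collect_less continuous_intros)
qed

lemma kruskal_metric_invertible:
  assumes "M > 0" "x \<in> patch_dom M"
  shows "invertible (kruskal_metric M x)"
proof -
  define r where "r = kruskal_r M (x$1) (x$2)"
  have r: "r > 0" using kruskal_r_pos assms by (simp add: r_def patch_dom_def)
  have s: "sin (x$3) \<noteq> 0" using assms(2) sin_gt_zero[of "x$3"] by (auto simp: patch_dom_def)
  define B :: "real^4^4" where "B = vector [vector [0, 2 / Fk M r, 0, 0], vector [2 / Fk M r, 0, 0, 0],
       vector [0, 0, 1 / r^2, 0], vector [0, 0, 0, 1 / (r^2 * (sin (x$3))^2)]]"
  have "Fk M r \<noteq> 0" using Fk_pos[OF assms(1) r] by simp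
  then have "kruskal_metric M x ** B = mat 1 \<and> B ** kruskal_metric M x = mat 1"
    using r s by (simp add: kruskal_metric_eq Let_def B_def r_def[symmetric] matrix_matrix_mult_def mat_def
        vec_eq_iff forall_4 sum_4)
  then show ?thesis unfolding invertible_def by blast
qed

section \<open>Spherically symmetric graphs \<open>V = \<phi>(U)\<close>\<close>

definition graph_event :: "real set \<Rightarrow> (real \<Rightarrow> real) \<Rightarrow> event set" where
  "graph_event J \<phi> = {(U, V, \<omega>). U \<in> J \<and> V = \<phi> U \<and> norm \<omega> = 1}"

definition graph_patch :: "real \<Rightarrow> real set \<Rightarrow> (real \<Rightarrow> real) \<Rightarrow> (real^4) set" where
  "graph_patch M J \<phi> = {x \<in> patch_dom M. x$1 \<in> J \<and> x$2 = \<phi> (x$1)}"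

lemma norm_rotation: "rotation_matrix A \<Longrightarrow> norm (A *v x) = norm x"
  for A :: "real^'n^'n"
  using orthogonal_transformation_norm[of "(*v) A"]
  by (simp add: rotation_matrix_def orthogonal_transformation_matrix)

lemma norm_spherical: "norm (vector [sin \<theta> * cos \<phi>, sin \<theta> * sin \<phi>, cos \<theta>] :: real^3) = 1"
proof -
  have "(sin \<theta> * cos \<phi>)\<^sup>2 + (sin \<theta> * sin \<phi>)\<^sup>2 + (cos \<theta>)\<^sup>2
      = (sin \<theta>)\<^sup>2 * ((cos \<phi>)\<^sup>2 + (sin \<phi>)\<^sup>2) + (cos \<theta>)\<^sup>2"
    by (simp only: power_mult_distrib distrib_left)
  also have "\<dots> = 1" by simp
  finally show ?thesis by (simp add: norm_vec_def L2_set_def sum_3)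
qed

text \<open>A rotation preserves the unit sphere, so a spherically symmetric set looks the same in
  every rotated patch; all local conditions need checking in one patch only.\<close>

lemma in_patch_graph:
  assumes "rotation_matrix A"
  shows "in_patch M A (graph_event J \<phi>) = graph_patch M J \<phi>"
  by (auto simp: in_patch_def graph_event_def graph_patch_def patch_def norm_rotation[OF assms] norm_spherical)

lemma graph_event_kruskal:
  "(\<And>u. u \<in> J \<Longrightarrow> u * \<phi> u > - 2 * M) \<Longrightarrow> graph_event J \<phi> \<subseteq> kruskal M"
  by (auto simp: graph_event_def kruskal_def)

lemma spherically_symmetric_graph: "spherically_symmetric (graph_event J \<phi>)"
  by (auto simp: spherically_symmetric_def graph_event_def norm_rotation)

lemma has_vector_derivative_nth:
  "(\<gamma> has_vector_derivative v) F \<Longrightarrow> ((\<lambda>s. \<gamma> s $ i) has_vector_derivative v $ i) F"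
  by (rule bounded_linear.has_vector_derivative[OF bounded_linear_vec_nth])

lemma tangent_space_graph:
  assumes "open J" "p \<in> graph_patch M J \<phi>" "(\<phi> has_real_derivative d) (at (p$1))"
  shows "tangent_space (graph_patch M J \<phi>) p = {v. v$2 = d * v$1}"
proof (intro equalityI subsetI CollectI)
  fix v assume "v \<in> tangent_space (graph_patch M J \<phi>) p"
  then obtain \<gamma> where \<gamma>: "\<gamma> 0 = p" "\<forall>\<^sub>F s in at 0. \<gamma> s \<in> graph_patch M J \<phi>"
      "(\<gamma> has_vector_derivative v) (at (0::real))"
    unfolding tangent_space_def by blast
  have d1: "((\<lambda>s. \<gamma> s $ i) has_real_derivative v$i) (at 0)" for i
    using has_vector_derivative_nth[OF \<gamma>(3)] by (simp add: has_real_derivative_iff_has_vector_derivative)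
  have d2: "((\<lambda>s. \<phi> (\<gamma> s $ 1)) has_real_derivative d * v$1) (at 0)"
    by (rule DERIV_chain2[OF _ d1]) (use assms(3) \<gamma>(1) in simp)
  have "\<forall>\<^sub>F s in nhds 0. \<gamma> s $ 2 = \<phi> (\<gamma> s $ 1)"
    unfolding eventually_nhds_conv_at
    using \<gamma> assms(2) by (auto simp: graph_patch_def elim!: eventually_mono)
  then have "((\<lambda>s. \<gamma> s $ 2) has_real_derivative d * v$1) (at 0)"
    using DERIV_cong_ev[of 0 0 "\<lambda>s. \<gamma> s $ 2" "\<lambda>s. \<phi> (\<gamma> s $ 1)"] d2 by simp
  then show "v$2 = d * v$1" using DERIV_unique d1 by blast
next
  fix v :: "real^4" assume "v \<in> {v. v$2 = d * v$1}"
  then have v: "v$2 = d * v$1" by simp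
  \<comment> \<open>The correction that keeps the straight line p + s v on the graph. It is of order
    o(s), because \<phi> has slope d, and so does not change the velocity at 0.\<close>
  define \<delta> where "\<delta> s = \<phi> (p$1 + s * v$1) - \<phi> (p$1) - s * (d * v$1)" for s
  define \<gamma> where "\<gamma> s = p + s *\<^sub>R v + \<delta> s *\<^sub>R axis 2 1" for s
  have "((\<lambda>s. \<phi> (p$1 + s * v$1)) has_real_derivative d * v$1) (at 0)"
    by (rule DERIV_chain2[of \<phi>]) (use assms(3) in \<open>auto intro!: derivative_eq_intros\<close>)
  moreover have "((\<lambda>s. s * (d * v$1)) has_real_derivative d * v$1) (at 0)"
    by (auto intro!: derivative_eq_intros)
  ultimately have "(\<delta> has_real_derivative (d * v$1 - 0) - d * v$1) (at 0)"
    unfolding \<delta>_def by (intro DERIV_diff DERIV_const)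
  then have "(\<delta> has_real_derivative 0) (at 0)" by simp
  from has_vector_derivative_scaleR[OF this has_vector_derivative_const, of "axis 2 1 :: real^4"]
  have "((\<lambda>s. \<delta> s *\<^sub>R axis 2 1 :: real^4) has_vector_derivative 0) (at 0)" by simp
  moreover from has_vector_derivative_scaleR[OF DERIV_ident has_vector_derivative_const, of v 0 UNIV]
  have "((\<lambda>s. s *\<^sub>R v) has_vector_derivative v) (at 0)" by simp
  ultimately have "(\<gamma> has_vector_derivative 0 + v + 0) (at 0)"
    unfolding \<gamma>_def by (intro has_vector_derivative_add has_vector_derivative_const)
  then have \<gamma>: "(\<gamma> has_vector_derivative v) (at 0)" by simp
  have \<gamma>0: "\<gamma> 0 = p" by (simp add: \<gamma>_def \<delta>_def)
  have c: "\<gamma> s $ 1 = p$1 + s * v$1" "\<gamma> s $ 2 = \<phi> (\<gamma> s $ 1)" for s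
    using assms(2) v by (auto simp: \<gamma>_def \<delta>_def axis_def graph_patch_def)
  have "(\<gamma> \<longlongrightarrow> p) (at 0)"
    using has_vector_derivative_continuous[OF \<gamma>] \<gamma>0 by (simp add: isCont_def)
  then have "\<forall>\<^sub>F s in at 0. \<gamma> s \<in> patch_dom M \<inter> {x. x$1 \<in> J}"
    by (rule topological_tendstoD)
      (use assms patch_dom_open open_coord_preimage in \<open>auto simp: graph_patch_def\<close>)
  then have "\<forall>\<^sub>F s in at 0. \<gamma> s \<in> graph_patch M J \<phi>"
    by eventually_elim (use c in \<open>auto simp: graph_patch_def\<close>)
  with \<gamma> \<gamma>0 show "v \<in> tangent_space (graph_patch M J \<phi>) p"
    unfolding tangent_space_def by blast
qed

lemma hypersurface_graph:
  assumes "open J" "smooth1 J \<phi>" "\<And>u. u \<in> J \<Longrightarrow> u * \<phi> u > - 2 * M"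
  shows "hypersurface M (graph_event J \<phi>)"
proof -
  have "hypersurface_in (patch_dom M) (graph_patch M J \<phi>)"
    unfolding hypersurface_in_def
  proof (intro conjI ballI)
    show "graph_patch M J \<phi> \<subseteq> patch_dom M" by (auto simp: graph_patch_def)
    fix p assume p: "p \<in> graph_patch M J \<phi>"
    define W where "W = patch_dom M \<inter> {x. x$1 \<in> J}"
    define \<rho> where "\<rho> = (\<lambda>x::real^4. x$2 - \<phi> (x$1))"
    have "frechet_derivative \<rho> (at x) \<noteq> (\<lambda>_. 0)" if "x \<in> W" for x
    proof -
      have "Cr (Suc 0) J \<phi>" "x$1 \<in> J" using assms(2) that unfolding smooth1_def W_def by auto
      then obtain d where "(\<phi> has_real_derivative d) (at (x$1))" by auto
      from frechet_derivative_at[OF has_derivative_graph_function[OF this]]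
      have "frechet_derivative \<rho> (at x) = (\<lambda>z. z$2 - d * z$1)" by (simp add: \<rho>_def)
      then have "frechet_derivative \<rho> (at x) (axis 2 1) = 1" by (simp add: axis_def)
      then show ?thesis by auto
    qed
    moreover have "smooth_on W \<rho>"
      using smooth_on_subset[OF smooth_on_graph_function[OF assms(1,2)]] by (simp add: W_def \<rho>_def)
    moreover have "open W" using patch_dom_open open_coord_preimage[OF assms(1)] by (auto simp: W_def)
    moreover have "p \<in> W" "W \<subseteq> patch_dom M" "graph_patch M J \<phi> \<inter> W = {x \<in> W. \<rho> x = 0}"
      using p by (auto simp: W_def \<rho>_def graph_patch_def)
    ultimately show "\<exists>W \<rho>. open W \<and> p \<in> W \<and> W \<subseteq> patch_dom M \<and> smooth_on W \<rho> \<and>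
        (\<forall>x\<in>W. frechet_derivative \<rho> (at x) \<noteq> (\<lambda>_. 0)) \<and> graph_patch M J \<phi> \<inter> W = {x \<in> W. \<rho> x = (0::real)}"
      by (intro exI[of _ W] exI[of _ \<rho>] conjI ballI)
  qed
  then show ?thesis
    using graph_event_kruskal[OF assms(3)] by (simp add: hypersurface_def in_patch_graph)
qed

lemma patch_dom_sin_pos: "x \<in> patch_dom M \<Longrightarrow> sin (x$3) > 0"
  by (simp add: patch_dom_def sin_gt_zero)

text \<open>Both coordinate directions U and V are null, so on a tangent vector with dV = d dU the
  metric is F d dU^2 plus the sphere part; a positive slope d makes this a sum of nonnegative
  terms.\<close>

lemma spacelike_graph:
  assumes "M > 0" "open J" "smooth1 J \<phi>" "\<And>u. u \<in> J \<Longrightarrow> u * \<phi> u > - 2 * M"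
    and d: "\<And>u. u \<in> J \<Longrightarrow> (\<phi> has_real_derivative d u) (at u)" "\<And>u. u \<in> J \<Longrightarrow> d u > 0"
  shows "spacelike_hypersurface M (graph_event J \<phi>)"
proof -
  have "gprod (kruskal_metric M) p v v > 0"
    if p: "p \<in> graph_patch M J \<phi>" and v: "v \<in> tangent_space (graph_patch M J \<phi>) p" "v \<noteq> 0" for p v
  proof -
    define r where "r = kruskal_r M (p$1) (p$2)"
    have pJ: "p$1 \<in> J" "p \<in> patch_dom M" using p by (auto simp: graph_patch_def)
    have v2: "v$2 = d (p$1) * v$1"
      using v tangent_space_graph[OF assms(2) p d(1)[OF pJ(1)]] by auto
    have r: "r > 0" using kruskal_r_pos[OF assms(1)] pJ by (simp add: r_def patch_dom_def)
    have s: "r\<^sup>2 * (sin (p$3))\<^sup>2 > 0" using r patch_dom_sin_pos[OF pJ(2)] by simp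
    have F: "Fk M r * d (p$1) > 0" using Fk_pos[OF assms(1) r] d(2)[OF pJ(1)] by simp
    have eq: "gprod (kruskal_metric M) p v v = (Fk M r * d (p$1)) * (v$1)\<^sup>2 + r\<^sup>2 * (v$3)\<^sup>2 + (r\<^sup>2 * (sin (p$3))\<^sup>2) * (v$4)\<^sup>2"
      unfolding gprod_kruskal Let_def r_def[symmetric] by (simp add: v2 power2_eq_square)
    have nn: "(Fk M r * d (p$1)) * (v$1)\<^sup>2 \<ge> 0" "r\<^sup>2 * (v$3)\<^sup>2 \<ge> 0" "(r\<^sup>2 * (sin (p$3))\<^sup>2) * (v$4)\<^sup>2 \<ge> 0"
      using F s by simp_all
    have "\<not> (v$1 = 0 \<and> v$3 = 0 \<and> v$4 = 0)"
      using v(2) v2 by (auto simp: vec_eq_iff forall_4)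
    then consider "v$1 \<noteq> 0" | "v$3 \<noteq> 0" | "v$4 \<noteq> 0" by auto
    then show ?thesis
    proof cases
      case 1
      then have "(Fk M r * d (p$1)) * (v$1)\<^sup>2 > 0" using F by simp
      then show ?thesis using nn eq by linarith
    next
      case 2
      then have "r\<^sup>2 * (v$3)\<^sup>2 > 0" using r by simp
      then show ?thesis using nn eq by linarith
    next
      case 3
      then have "(r\<^sup>2 * (sin (p$3))\<^sup>2) * (v$4)\<^sup>2 > 0" using s by simp
      then show ?thesis using nn eq by linarith
    qed
  qed
  then show ?thesis
    using hypersurface_graph[OF assms(2-4)]
    by (simp add: spacelike_hypersurface_def spacelike_in_def in_patch_graph)
qed

section \<open>The mean curvature of a graph\<close>

lemma partial_eq: "(f has_derivative f') (at p) \<Longrightarrow> partial i f p = f' (axis i 1)"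
  unfolding partial_def by (drule frechet_derivative_at) simp

lemma has_derivative_kruskal_metric:
  fixes p :: "real^4"
  assumes "M > 0" "p \<in> patch_dom M"
  defines "r \<equiv> kruskal_r M (p$1) (p$2)"
  defines "d \<equiv> \<lambda>z::real^4. 1 / Pk M r * (p$1 * z$2 + z$1 * p$2)"
  shows "((\<lambda>x. kruskal_metric M x $ i $ l) has_derivative
    (\<lambda>z. (vector [vector [0, - (1 / r + 1 / (2 * M)) * Fk M r * d z / 2, 0, 0],
       vector [- (1 / r + 1 / (2 * M)) * Fk M r * d z / 2, 0, 0, 0],
       vector [0, 0, 2 * r * d z, 0],
       vector [0, 0, 0, 2 * r * d z * (sin (p$3))\<^sup>2 + 2 * r\<^sup>2 * sin (p$3) * cos (p$3) * z$3]] :: real^4^4) $ i $ l)) (at p)"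
proof -
  have r: "r > 0" using kruskal_r_pos assms by (simp add: patch_dom_def)
  have dr: "((\<lambda>x. kruskal_r M (x$1) (x$2)) has_derivative d) (at p)"
    unfolding d_def r_def by (rule has_derivative_kruskal_r) (use assms in \<open>auto simp: patch_dom_def\<close>)
  have F: "((\<lambda>x. Fk M (kruskal_r M (x$1) (x$2)) / 2) has_derivative
      (\<lambda>z. - (1 / r + 1 / (2 * M)) * Fk M r * d z / 2)) (at p)"
    using has_derivative_mult_left[OF has_derivative_compose[OF dr DERIV_Fk[OF assms(1) r, unfolded r_def has_field_derivative_def]], of "1/2"]
    by (simp add: r_def)
  have q: "((\<lambda>x. (kruskal_r M (x$1) (x$2))\<^sup>2) has_derivative (\<lambda>z. 2 * r * d z)) (at p)"
    using has_derivative_power[OF dr, of 2] by (simp add: r_def mult_ac)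
  have s: "((\<lambda>x. sin (x$3)) has_derivative (\<lambda>z. cos (p$3) * z$3)) (at p)"
    using has_derivative_compose[OF bounded_linear_imp_has_derivative[OF bounded_linear_vec_nth, of 3]
      DERIV_sin[unfolded has_field_derivative_def]] .
  have s2: "((\<lambda>x. (kruskal_r M (x$1) (x$2))\<^sup>2 * (sin (x$3))\<^sup>2) has_derivative
      (\<lambda>z. 2 * r * d z * (sin (p$3))\<^sup>2 + 2 * r\<^sup>2 * sin (p$3) * cos (p$3) * z$3)) (at p)"
    using has_derivative_mult[OF q has_derivative_power[OF s, of 2]]
    by (simp add: r_def algebra_simps)
  have "\<forall>i l. ((\<lambda>x. kruskal_metric M x $ i $ l) has_derivative
    (\<lambda>z. (vector [vector [0, - (1 / r + 1 / (2 * M)) * Fk M r * d z / 2, 0, 0],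
       vector [- (1 / r + 1 / (2 * M)) * Fk M r * d z / 2, 0, 0, 0],
       vector [0, 0, 2 * r * d z, 0],
       vector [0, 0, 0, 2 * r * d z * (sin (p$3))\<^sup>2 + 2 * r\<^sup>2 * sin (p$3) * cos (p$3) * z$3]] :: real^4^4) $ i $ l)) (at p)"
    unfolding forall_4 kruskal_metric_eq Let_def vector_4
    by (intro conjI has_derivative_const F q s2)
  then show ?thesis by blast
qed

text \<open>\<nu> and \<mu> are the components of the unit tangent of the profile as functions of U;
  \<open>unit\<close> is its normalisation, and \<open>rad\<close> says that the normal changes r at
  the rate k. In the frame of this tangent and two unit vectors of the sphere the three terms of the
  trace are k' = H - 2c/r^3, which is what \<open>ab\<close> provides, and twice k/r.\<close>

lemma graph_mean_curvature:
  assumes M: "M > 0" and J: "open J" and sm: "smooth1 J \<nu>" "smooth1 J \<mu>"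
    and dom: "\<And>u. u \<in> J \<Longrightarrow> u * \<phi> u > - 2 * M"
    and pos: "\<And>u. u \<in> J \<Longrightarrow> \<nu> u > 0" "\<And>u. u \<in> J \<Longrightarrow> \<mu> u > 0"
    and der: "\<And>u. u \<in> J \<Longrightarrow> (\<phi> has_real_derivative \<mu> u / \<nu> u) (at u)"
      "\<And>u. u \<in> J \<Longrightarrow> (\<nu> has_real_derivative \<beta> u) (at u)"
      "\<And>u. u \<in> J \<Longrightarrow> (\<mu> has_real_derivative \<alpha> u * \<mu> u / \<nu> u) (at u)"
    and unit: "\<And>u. u \<in> J \<Longrightarrow> \<nu> u * \<mu> u * Fk M (kruskal_r M u (\<phi> u)) = 1"
    and rad: "\<And>u. u \<in> J \<Longrightarrow> u * \<mu> u - \<phi> u * \<nu> u =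
      Pk M (kruskal_r M u (\<phi> u)) * kfun H c (kruskal_r M u (\<phi> u))"
    and ab: "\<And>u. u \<in> J \<Longrightarrow> \<alpha> u - \<beta> u = 2 * (H - 2 * c / (kruskal_r M u (\<phi> u))^3) +
      (1 / kruskal_r M u (\<phi> u) + 1 / (2 * M)) * kfun H c (kruskal_r M u (\<phi> u))"
    and p: "p \<in> graph_patch M J \<phi>"
  shows "has_mean_curvature (kruskal_metric M) time_dir (graph_patch M J \<phi>) p H"
proof -
  \<comment> \<open>The normal is extended to a neighbourhood as a function of U alone, so that only
    the derivatives of \<nu> and \<mu> enter.\<close>
  define N :: "real^4 \<Rightarrow> real^4" where "N = (\<lambda>x. \<nu> (x$1) *\<^sub>R (- axis 1 1) + \<mu> (x$1) *\<^sub>R axis 2 1)"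
  have N: "N x $ 1 = - \<nu> (x$1)" "N x $ 2 = \<mu> (x$1)" "N x $ 3 = 0" "N x $ 4 = 0" for x
    by (simp_all add: N_def axis_def)
  have smN: "smooth_on {x. x$1 \<in> J} N"
    unfolding smooth_on_def N_def
    by (intro allI Ck_on_first_coord[OF J]) (use sm in \<open>auto simp: smooth1_def\<close>)
  have normal: "future_unit_normal (kruskal_metric M) time_dir (graph_patch M J \<phi>) x (N x)"
    if x: "x \<in> graph_patch M J \<phi>" for x
  proof -
    have u: "x$1 \<in> J" "x$2 = \<phi> (x$1)" using x by (auto simp: graph_patch_def)
    define r where "r = kruskal_r M (x$1) (x$2)"
    have F: "Fk M r > 0" using kruskal_r_pos[OF M dom[OF u(1)]] Fk_pos[OF M] u by (simp add: r_def)
    have FF: "\<nu> (x$1) * \<mu> (x$1) * Fk M r = 1" using unit[OF u(1)] u(2) by (simp add: r_def)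
    have "gprod (kruskal_metric M) x (N x) v = 0" if "v \<in> tangent_space (graph_patch M J \<phi>) x" for v
    proof -
      have "v$2 = \<mu> (x$1) / \<nu> (x$1) * v$1"
        using that tangent_space_graph[OF J x der(1)[OF u(1)]] by simp
      then show ?thesis
        using pos(1)[OF u(1)] by (simp add: gprod_kruskal Let_def N)
    qed
    moreover have "gprod (kruskal_metric M) x (N x) (N x) = -1"
      using FF by (simp add: gprod_kruskal Let_def N r_def[symmetric] algebra_simps)
    moreover have "gprod (kruskal_metric M) x (N x) (time_dir x) = - (Fk M r / 2 * (\<nu> (x$1) + \<mu> (x$1)))"
      by (simp add: gprod_kruskal Let_def N r_def[symmetric] time_dir_def algebra_simps)
    moreover have "Fk M r / 2 * (\<nu> (x$1) + \<mu> (x$1)) > 0"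
      using F pos[OF u(1)] by simp
    ultimately show ?thesis unfolding future_unit_normal_def by simp
  qed
  have pd: "p \<in> patch_dom M" and u: "p$1 \<in> J" "p$2 = \<phi> (p$1)" using p by (auto simp: graph_patch_def)
  define r where "r = kruskal_r M (p$1) (p$2)"
  define n m a b where "n = \<nu> (p$1)" and "m = \<mu> (p$1)" and "a = \<alpha> (p$1)" and "b = \<beta> (p$1)"
  define k where "k = kfun H c r"
  define s where "s = sin (p$3)"
  have r: "r > 0" using kruskal_r_pos[OF M] pd by (simp add: r_def patch_dom_def)
  have s: "s > 0" using patch_dom_sin_pos[OF pd] by (simp add: s_def)
  have nm: "n > 0" "m > 0" using pos u by (simp_all add: n_def m_def)
  have Fnm: "n * m * Fk M r = 1" using unit[OF u(1)] u(2) by (simp add: r_def n_def m_def)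
  have P: "Pk M r > 0" by (rule Pk_pos[OF M r])
  define E :: "real^4" where "E = vector [n, m, 0, 0]"
  define e :: "3 \<Rightarrow> real^4" where
    "e i = (if i = 1 then E else if i = 2 then axis 3 (1 / r) else axis 4 (1 / (r * s)))" for i
  have e: "e 1 = E" "e 2 = axis 3 (1 / r)" "e 3 = axis 4 (1 / (r * s))" by (simp_all add: e_def)
  have tan: "tangent_space (graph_patch M J \<phi>) p = {v. v$2 = m / n * v$1}"
    using tangent_space_graph[OF J p der(1)[OF u(1)]] by (simp add: n_def m_def)
  have et: "\<forall>i. e i \<in> tangent_space (graph_patch M J \<phi>) p"
    unfolding forall_3 e tan using nm by (simp add: E_def axis_def)
  have ortho: "\<forall>i j. gprod (kruskal_metric M) p (e i) (e j) = (if i = j then 1 else 0)"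
    unfolding forall_3 e using Fnm r s
    by (simp add: gprod_kruskal Let_def r_def[symmetric] s_def[symmetric] E_def axis_def power2_eq_square algebra_simps)
  have DN: "frechet_derivative N (at p) z = b *\<^sub>R (z$1 *\<^sub>R (- axis 1 1)) + (a * m / n) *\<^sub>R (z$1 *\<^sub>R axis 2 1)" for z
    unfolding N_def a_def b_def m_def n_def
    by (subst frechet_derivative_at[OF has_derivative_first_coord, symmetric]) (use der u in auto)
  define G where "G = - (1 / r + 1 / (2 * M)) * Fk M r * k / 2"
  \<comment> \<open>\<open>D i l\<close> is the derivative of g_il in the direction N. As N has no
    angular part and changes r at the rate k, every entry is k times a derivative in r.\<close>
  define D where "D i l = (\<Sum>j\<in>UNIV. partial j (\<lambda>x. kruskal_metric M x $ i $ l) p * N p $ j)" for i l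
  have Dv: "D i l = (vector [vector [0, G, 0, 0], vector [G, 0, 0, 0], vector [0, 0, 2 * r * k, 0],
      vector [0, 0, 0, 2 * r * k * s\<^sup>2]] :: real^4^4) $ i $ l" for i l
  proof -
    have "p$1 * m - n * p$2 = Pk M r * k"
      using rad[OF u(1)] u(2) by (simp add: m_def n_def r_def k_def mult.commute)
    then have k: "(p$1 * m - n * p$2) / Pk M r = k"
      using P by (simp add: field_simps)
    define Q where "Q = - (1 / r + 1 / (2 * M)) * Fk M r"
    have "\<forall>i l. D i l = (vector [vector [0, G, 0, 0], vector [G, 0, 0, 0], vector [0, 0, 2 * r * k, 0],
      vector [0, 0, 0, 2 * r * k * s\<^sup>2]] :: real^4^4) $ i $ l"
      unfolding forall_4 D_def sum_4 N n_def[symmetric] m_def[symmetric]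
        partial_eq[OF has_derivative_kruskal_metric[OF M pd]] r_def[symmetric] s_def[symmetric]
        G_def k[symmetric] vector_4 Q_def[symmetric]
      by (simp add: axis_def algebra_simps add_divide_distrib diff_divide_distrib)
    then show ?thesis by blast
  qed
  have cov: "gprod (kruskal_metric M) p (cov_deriv (kruskal_metric M) N p v) v =
      gprod (kruskal_metric M) p (frechet_derivative N (at p) v) v +
      1/2 * (\<Sum>l\<in>UNIV. \<Sum>i\<in>UNIV. D i l * v$i * v$l)" for v
    unfolding gprod_cov_deriv[where g = "kruskal_metric M", OF kruskal_metric_sym kruskal_metric_invertible[OF M pd]]
      D_def by (simp add: sum_distrib_left sum_distrib_right mult_ac)
  have c1: "gprod (kruskal_metric M) p (cov_deriv (kruskal_metric M) N p E) E = H - 2 * c / r^3"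
  proof -
    have "gprod (kruskal_metric M) p (cov_deriv (kruskal_metric M) N p E) E =
      (n * m * Fk M r) * ((a - b) / 2 - (1 / r + 1 / (2 * M)) * k / 2)"
      unfolding cov unfolding DN sum_4 Dv vector_4 gprod_kruskal Let_def r_def[symmetric] G_def
      using nm by (simp add: E_def axis_def field_simps)
    also have "\<dots> = H - 2 * c / r^3"
    proof -
      have "a - b = 2 * (H - 2 * c / r^3) + (1 / r + 1 / (2 * M)) * k"
        using ab[OF u(1)] u(2) by (simp add: a_def b_def r_def k_def)
      moreover have "x = 2 * z + y \<Longrightarrow> 1 * (x / 2 - y / 2) = z" for x y z :: real
        by (simp add: field_simps)
      ultimately show ?thesis unfolding Fnm by blast
    qed
    finally show ?thesis .
  qed
  have c2: "gprod (kruskal_metric M) p (cov_deriv (kruskal_metric M) N p (axis 3 (1 / r))) (axis 3 (1 / r)) = k / r"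
    unfolding cov unfolding DN sum_4 Dv vector_4 gprod_kruskal Let_def
    using r by (simp add: axis_def field_simps power2_eq_square)
  have c3: "gprod (kruskal_metric M) p (cov_deriv (kruskal_metric M) N p (axis 4 (1 / (r * s)))) (axis 4 (1 / (r * s))) = k / r"
    unfolding cov unfolding DN sum_4 Dv vector_4 gprod_kruskal Let_def
    using r s by (simp add: axis_def field_simps power2_eq_square)
  \<comment> \<open>k' + 2 k/r = 3H, or (r^2 k)' = 3 H r^2: this is where the formula of
    \<open>kfun\<close> comes from, with c as the constant of integration.\<close>
  have "H = 1/3 * (\<Sum>i\<in>UNIV. gprod (kruskal_metric M) p (cov_deriv (kruskal_metric M) N p (e i)) (e i))"
    unfolding sum_3 e c1 c2 c3 k_def kfun_def using r by (simp add: field_simps power2_eq_square power3_eq_cube)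
  then show ?thesis
    unfolding has_mean_curvature_def
    using smN normal et ortho open_coord_preimage[OF J] u(1)
    by (intro exI[of _ "{x. x$1 \<in> J}"] exI[of _ N] exI[of _ e]) auto
qed

lemma ss_cmc_graph:
  assumes "M > 0" "open J" "smooth1 J \<phi>" "smooth1 J \<nu>" "smooth1 J \<mu>"
    and "\<And>u. u \<in> J \<Longrightarrow> u * \<phi> u > - 2 * M"
    and "\<And>u. u \<in> J \<Longrightarrow> \<nu> u > 0" "\<And>u. u \<in> J \<Longrightarrow> \<mu> u > 0"
    and "\<And>u. u \<in> J \<Longrightarrow> (\<phi> has_real_derivative \<mu> u / \<nu> u) (at u)"
      "\<And>u. u \<in> J \<Longrightarrow> (\<nu> has_real_derivative \<beta> u) (at u)"
      "\<And>u. u \<in> J \<Longrightarrow> (\<mu> has_real_derivative \<alpha> u * \<mu> u / \<nu> u) (at u)"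
    and "\<And>u. u \<in> J \<Longrightarrow> \<nu> u * \<mu> u * Fk M (kruskal_r M u (\<phi> u)) = 1"
    and "\<And>u. u \<in> J \<Longrightarrow> u * \<mu> u - \<phi> u * \<nu> u =
      Pk M (kruskal_r M u (\<phi> u)) * kfun H c (kruskal_r M u (\<phi> u))"
    and "\<And>u. u \<in> J \<Longrightarrow> \<alpha> u - \<beta> u = 2 * (H - 2 * c / (kruskal_r M u (\<phi> u))^3) +
      (1 / kruskal_r M u (\<phi> u) + 1 / (2 * M)) * kfun H c (kruskal_r M u (\<phi> u))"
  shows "ss_cmc M H (graph_event J \<phi>)"
proof -
  have "spacelike_hypersurface M (graph_event J \<phi>)"
    by (rule spacelike_graph[where d = "\<lambda>u. \<mu> u / \<nu> u"]) (use assms in auto)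
  moreover have "has_mean_curvature (kruskal_metric M) time_dir (graph_patch M J \<phi>) p H"
    if "p \<in> graph_patch M J \<phi>" for p
    by (rule graph_mean_curvature[OF assms(1,2,4,5,6-)]) (use that in auto)
  ultimately show ?thesis
    by (simp add: ss_cmc_def spherically_symmetric_graph in_patch_graph)
qed

section \<open>The ends of a graph\<close>

lemma graph_event_image: "graph_event T \<phi> = (\<lambda>(u, \<omega>). (u, \<phi> u, \<omega>)) ` (T \<times> sphere 0 1)"
  by (auto simp: graph_event_def)

lemma continuous_on_graph_param:
  fixes \<phi> :: "real \<Rightarrow> real"
  assumes "continuous_on T \<phi>"
  shows "continuous_on (T \<times> sphere 0 1) (\<lambda>(u, \<omega>::real^3). (u, \<phi> u, \<omega>))"
proof -
  have "continuous_on (T \<times> sphere 0 1) (\<lambda>x::real \<times> (real^3). \<phi> (fst x))"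
    by (rule continuous_on_compose2[OF assms]) (auto intro: continuous_intros)
  then show ?thesis
    unfolding case_prod_unfold by (intro continuous_intros)
qed

lemma compact_graph_event: "compact T \<Longrightarrow> continuous_on T \<phi> \<Longrightarrow> compact (graph_event T \<phi>)"
  unfolding graph_event_image by (intro compact_continuous_image continuous_on_graph_param compact_Times) auto

lemma connected_graph_event: "connected T \<Longrightarrow> continuous_on T \<phi> \<Longrightarrow> connected (graph_event T \<phi>)"
  unfolding graph_event_image
  by (intro connected_continuous_image continuous_on_graph_param connected_Times connected_sphere) auto

lemma fst_graph_event: "fst ` graph_event T \<phi> = T"
proof -
  have "(u, \<phi> u, axis 1 1) \<in> graph_event T \<phi>" if "u \<in> T" for u
    using that by (simp add: graph_event_def)
  then have "T \<subseteq> fst ` graph_event T \<phi>" by (force simp: image_iff)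
  then show ?thesis by (auto simp: graph_event_def)
qed

lemma open_real_less: "open J \<Longrightarrow> a \<in> J \<Longrightarrow> \<exists>x\<in>J. x < (a::real)"
proof -
  assume "open J" "a \<in> J"
  then obtain e where "e > 0" "ball a e \<subseteq> J" by (meson openE)
  then show ?thesis by (intro bexI[of _ "a - e/2"]) (auto simp: dist_real_def subset_iff)
qed

lemma open_real_greater: "open J \<Longrightarrow> a \<in> J \<Longrightarrow> \<exists>x\<in>J. x > (a::real)"
proof -
  assume "open J" "a \<in> J"
  then obtain e where "e > 0" "ball a e \<subseteq> J" by (meson openE)
  then show ?thesis by (intro bexI[of _ "a + e/2"]) (auto simp: dist_real_def subset_iff)
qed

text \<open>A compact K lies over some [a, b] inside J. The parts of the graph left of a and right
  of b are connected and miss K, and any component of the complement other than the two containing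
  them lies over [a, b], where the graph is compact. One full sphere as \<open>?K0\<close> forces
  these two components to differ.\<close>

lemma has_ends_graph:
  assumes J: "open J" "connected J" "J \<noteq> {}" and \<phi>: "continuous_on J \<phi>"
  shows "has_ends (graph_event J \<phi>) 2"
proof -
  let ?X = "graph_event J \<phi>"
  obtain u0 where u0: "u0 \<in> J" using J(3) by auto
  let ?K0 = "graph_event {u0} \<phi>"
  define w where "w = (axis 1 1 :: real^3)"
  have w: "norm w = 1" by (simp add: w_def)
  have mono: "graph_event S \<phi> \<subseteq> graph_event T \<phi>" if "S \<subseteq> T" for S T
    using that by (auto simp: graph_event_def)
  have ivl: "is_interval J" using J(2) by (simp add: is_interval_connected_1)
  have main: "finite {C \<in> components (?X - K). \<not> compact (?X \<inter> closure C)} \<and>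
        card {C \<in> components (?X - K). \<not> compact (?X \<inter> closure C)} = 2"
    if K: "compact K" "?K0 \<subseteq> K" "K \<subseteq> ?X" for K
  proof -
    have fK: "compact (fst ` K)" "fst ` K \<subseteq> J" "u0 \<in> fst ` K"
      using K(1) image_mono[OF K(3), of fst] image_mono[OF K(2), of fst]
      unfolding fst_graph_event by (auto intro!: compact_continuous_image continuous_intros)
    obtain a where a: "a \<in> fst ` K" "\<And>x. x \<in> fst ` K \<Longrightarrow> a \<le> x"
      using compact_attains_inf[OF fK(1)] fK(3) by auto
    obtain b where b: "b \<in> fst ` K" "\<And>x. x \<in> fst ` K \<Longrightarrow> x \<le> b"
      using compact_attains_sup[OF fK(1)] fK(3) by auto
    have ab: "a \<in> J" "b \<in> J" "a \<le> u0" "u0 \<le> b" using a b fK by auto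
    let ?L = "graph_event (J \<inter> {..<a}) \<phi>" and ?R = "graph_event (J \<inter> {b<..}) \<phi>"
    obtain y z where yz: "y \<in> J" "y < a" "z \<in> J" "z > b"
      using open_real_less[OF J(1) ab(1)] open_real_greater[OF J(1) ab(2)] by auto
    have sub: "?L \<subseteq> ?X - K" "?R \<subseteq> ?X - K"
      using a b by (force simp: graph_event_def image_iff)+
    have conn: "connected ?L" "connected ?R"
      by (rule connected_graph_event;
          auto intro!: continuous_on_subset[OF \<phi>] is_interval_connected is_interval_Int ivl)+
    define yp where "yp = (y, \<phi> y, w)"
    define zp where "zp = (z, \<phi> z, w)"
    have mem: "yp \<in> ?L" "zp \<in> ?R" using yz w by (auto simp: graph_event_def yp_def zp_def)
    define CL where "CL = connected_component_set (?X - K) yp"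
    define CR where "CR = connected_component_set (?X - K) zp"
    have comp: "CL \<in> components (?X - K)" "CR \<in> components (?X - K)"
      using mem sub by (auto simp: CL_def CR_def components_def)
    have LR: "?L \<subseteq> CL" "?R \<subseteq> CR"
      unfolding CL_def CR_def using connected_component_maximal mem sub conn by blast+
    have CX: "CL \<subseteq> ?X - K" "CR \<subseteq> ?X - K" using comp in_components_subset by blast+
    \<comment> \<open>A compact set would have a least U-coordinate, but J is open and the component
      contains everything on the graph to the left of a.\<close>
    have ncL: "\<not> compact (?X \<inter> closure CL)"
    proof
      assume c: "compact (?X \<inter> closure CL)"
      have "compact (fst ` (?X \<inter> closure CL))"
        using c by (intro compact_continuous_image continuous_intros)
      moreover have "yp \<in> ?X \<inter> closure CL" using mem LR CX closure_subset by blast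
      ultimately obtain x0 where x0: "x0 \<in> fst ` (?X \<inter> closure CL)" "\<And>x. x \<in> fst ` (?X \<inter> closure CL) \<Longrightarrow> x0 \<le> x"
        using compact_attains_inf[of "fst ` (?X \<inter> closure CL)"] by blast
      then have "x0 \<in> J" using fst_graph_event[of J \<phi>] by auto
      then have "min x0 a \<in> J" using ab by (simp add: min_def)
      then obtain t where t: "t \<in> J" "t < min x0 a" using open_real_less[OF J(1)] by blast
      then have "(t, \<phi> t, w) \<in> ?L" using w by (simp add: graph_event_def)
      then have "(t, \<phi> t, w) \<in> ?X \<inter> closure CL" using LR CX closure_subset by blast
      then have "t \<in> fst ` (?X \<inter> closure CL)" by force
      then show False using x0(2) t by force
    qed
    have ncR: "\<not> compact (?X \<inter> closure CR)"
    proof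
      assume c: "compact (?X \<inter> closure CR)"
      have "compact (fst ` (?X \<inter> closure CR))"
        using c by (intro compact_continuous_image continuous_intros)
      moreover have "zp \<in> ?X \<inter> closure CR" using mem LR CX closure_subset by blast
      ultimately obtain x0 where x0: "x0 \<in> fst ` (?X \<inter> closure CR)" "\<And>x. x \<in> fst ` (?X \<inter> closure CR) \<Longrightarrow> x \<le> x0"
        using compact_attains_sup[of "fst ` (?X \<inter> closure CR)"] by blast
      then have "x0 \<in> J" using fst_graph_event[of J \<phi>] by auto
      then have "max x0 b \<in> J" using ab by (simp add: max_def)
      then obtain t where t: "t \<in> J" "t > max x0 b" using open_real_greater[OF J(1)] by blast
      then have "(t, \<phi> t, w) \<in> ?R" using w by (simp add: graph_event_def)
      then have "(t, \<phi> t, w) \<in> ?X \<inter> closure CR" using LR CX closure_subset by blast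
      then have "t \<in> fst ` (?X \<inter> closure CR)" by force
      then show False using x0(2) t by force
    qed
    have other: "compact (?X \<inter> closure C)" if C: "C \<in> components (?X - K)" "C \<noteq> CL" "C \<noteq> CR" for C
    proof -
      have "C \<inter> CL = {}" "C \<inter> CR = {}"
        using components_nonoverlap[OF C(1) comp(1)] components_nonoverlap[OF C(1) comp(2)] C by auto
      then have "C \<subseteq> ?X - ?L - ?R" using LR in_components_subset[OF C(1)] by blast
      moreover have "?X - ?L - ?R \<subseteq> graph_event {a..b} \<phi>"
        by (auto simp: graph_event_def)
      ultimately have CT: "C \<subseteq> graph_event {a..b} \<phi>" by (rule subset_trans)
      have abJ: "{a..b} \<subseteq> J"
        by (auto intro: mem_is_interval_1_I[OF ivl ab(1,2)])
      have T: "compact (graph_event {a..b} \<phi>)"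
        by (intro compact_graph_event continuous_on_subset[OF \<phi> abJ]) auto
      then have cl: "closure C \<subseteq> graph_event {a..b} \<phi>"
        using CT by (simp add: closure_minimal compact_imp_closed)
      then have "?X \<inter> closure C = graph_event {a..b} \<phi> \<inter> closure C"
        using mono[OF abJ] by blast
      then show ?thesis using T by (simp add: compact_Int_closed)
    qed
    have "CL \<noteq> CR"
    proof
      assume eq: "CL = CR"
      have "connected (fst ` CL)"
        unfolding CL_def by (intro connected_continuous_image continuous_intros connected_connected_component)
      moreover have "fst yp \<in> fst ` CL" "fst zp \<in> fst ` CL"
        using LR mem eq by (blast intro: imageI)+
      then have "y \<in> fst ` CL" "z \<in> fst ` CL" by (simp_all add: yp_def zp_def)
      ultimately have "u0 \<in> fst ` CL"
        using connectedD_interval[of "fst ` CL" y z u0] yz ab by auto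
      then obtain v \<omega> where q: "(u0, v, \<omega>) \<in> CL" by auto
      then have "(u0, v, \<omega>) \<in> ?K0" using CX by (auto simp: graph_event_def)
      then show False using K q CX by blast
    qed
    moreover have "{C \<in> components (?X - K). \<not> compact (?X \<inter> closure C)} = {CL, CR}"
      using comp ncL ncR other by blast
    ultimately show ?thesis by simp
  qed
  have "compact ?K0" by (rule compact_graph_event) auto
  moreover have "?K0 \<subseteq> ?X" by (rule mono) (use u0 in auto)
  ultimately show ?thesis unfolding has_ends_def using main by blast
qed

section \<open>Profile curves\<close>

text \<open>The product and the time determine |U| |V| and |V| / |U|, hence both absolute values;
  the signs su and sv do the rest.\<close>

lemma kruskal_quadrant_eq:
  assumes "M > 0" "u * v = u' * v'" "kruskal_t M u v = kruskal_t M u' v'"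
    and "su * u > 0" "su * u' > 0" "sv * v > 0" "sv * v' > (0::real)"
  shows "u = u' \<and> v = v'"
proof -
  have nz: "u \<noteq> 0" "v \<noteq> 0" "u' \<noteq> 0" "v' \<noteq> 0" using assms by auto
  have "ln \<bar>v / u\<bar> = ln \<bar>v' / u'\<bar>" using assms(1,3) by (simp add: kruskal_t_def)
  then have "\<bar>v / u\<bar> = \<bar>v' / u'\<bar>" using nz by (subst (asm) ln_inj_iff) auto
  then have 1: "\<bar>v\<bar> * \<bar>u'\<bar> = \<bar>v'\<bar> * \<bar>u\<bar>" using nz by (simp add: field_simps)
  have 2: "\<bar>u\<bar> * \<bar>v\<bar> = \<bar>u'\<bar> * \<bar>v'\<bar>" using assms(2) by (metis abs_mult)
  have "(\<bar>u\<bar> * \<bar>u\<bar>) * (\<bar>v\<bar> * \<bar>v'\<bar>) = (\<bar>u\<bar> * \<bar>v\<bar>) * (\<bar>v'\<bar> * \<bar>u\<bar>)" by (simp add: mult_ac)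
  also have "\<dots> = (\<bar>u'\<bar> * \<bar>u'\<bar>) * (\<bar>v\<bar> * \<bar>v'\<bar>)" unfolding 2 1[symmetric] by (simp add: mult_ac)
  finally have "\<bar>u\<bar> * \<bar>u\<bar> = \<bar>u'\<bar> * \<bar>u'\<bar>" using nz by simp
  then have "\<bar>u\<bar> = \<bar>u'\<bar>" by (simp add: abs_eq_iff square_eq_iff)
  then have "u = u'" using assms(4,5) by (auto simp: abs_if zero_less_mult_iff split: if_splits)
  then show ?thesis using assms(2) nz by simp
qed

text \<open>Regions I, II' and I' as one family indexed by two signs, so that graphs are compared
  with the curve only once.\<close>

definition quadrant :: "real \<Rightarrow> real \<Rightarrow> real \<Rightarrow> event set" where
  "quadrant M su sv = {(U, V, \<omega>) \<in> kruskal M. su * U > 0 \<and> sv * V > 0}"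

lemma region_quadrant:
  "region_I M = quadrant M 1 1" "region_I' M = quadrant M (-1) (-1)" "region_II' M = quadrant M 1 (-1)"
  by (auto simp: region_I_def region_I'_def region_II'_def quadrant_def)

lemma closure_quadrant: "closure (quadrant M su sv) \<subseteq> {(U, V, \<omega>). su * U \<ge> 0 \<and> sv * V \<ge> 0 \<and> norm \<omega> = 1}"
proof (rule closure_minimal)
  have "closed ({x::event. 0 \<le> su * fst x} \<inter> {x. 0 \<le> sv * fst (snd x)} \<inter> {x. norm (snd (snd x)) = 1})"
    by (intro closed_Int closed_Collect_le closed_Collect_eq continuous_intros)
  moreover have "{(U, V, \<omega>). su * U \<ge> 0 \<and> sv * V \<ge> 0 \<and> norm \<omega> = 1} =
      {x::event. 0 \<le> su * fst x} \<inter> {x. 0 \<le> sv * fst (snd x)} \<inter> {x. norm (snd (snd x)) = 1}"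
    by auto
  ultimately show "closed {(U, V, \<omega> :: real^3). su * U \<ge> 0 \<and> sv * V \<ge> 0 \<and> norm \<omega> = 1}" by simp
qed (auto simp: quadrant_def kruskal_def)

text \<open>\<open>y\<close> is a parameter of the profile curve of the hypersurface in the \<open>(U, V)\<close>-plane and
  \<open>a\<close> the derivative of \<open>y\<close> along the unit tangent. The unit tangent is \<open>(n, m)\<close>, the future
  unit normal is \<open>(-n, m)\<close>, and \<open>p\<close>, \<open>kfun\<close> are their \<open>r\<close>-components. All
  functions are smooth across \<open>r = 2M\<close>, and \<open>U\<close>, \<open>V\<close> are recovered from them algebraically.\<close>

locale profile_data =
  fixes M H c :: real and I :: "real set" and r a p :: "real \<Rightarrow> real"
  assumes M: "M > 0" and I: "open I" "connected I" "I \<noteq> {}"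
    and r_pos: "\<And>y. y \<in> I \<Longrightarrow> r y > 0" and a_pos: "\<And>y. y \<in> I \<Longrightarrow> a y > 0"
    and smooth: "smooth1 I r" "smooth1 I a" "smooth1 I p"
    and dr: "\<And>y. y \<in> I \<Longrightarrow> (r has_real_derivative p y / a y) (at y)"
    and dp: "\<And>y. y \<in> I \<Longrightarrow> (p has_real_derivative
        (kfun H c (r y) * (H - 2 * c / (r y)^3) + M / (r y)\<^sup>2) / a y) (at y)"
    and p2: "\<And>y. y \<in> I \<Longrightarrow> (p y)\<^sup>2 = Wfun M H c (r y)"

text \<open>The radial motion leaves a constant factor of n free: multiplying n by it multiplies U
  and divides V by the same factor, which is the isometry that shifts t. Keeping n apart from
  \<open>profile_data\<close> reserves this freedom for prescribing t at one point.\<close>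

locale profile = profile_data M H c I r a p for M H c I r a p +
  fixes n :: "real \<Rightarrow> real"
  assumes n_pos: "\<And>y. y \<in> I \<Longrightarrow> n y > 0"
    and dn: "\<And>y. y \<in> I \<Longrightarrow> (n has_real_derivative
        ((1 / r y + 1 / (2 * M)) * (p y - kfun H c (r y)) / 2 - (H - 2 * c / (r y)^3)) / a y * n y) (at y)"
begin

definition k where "k y = kfun H c (r y)"
definition k' where "k' y = H - 2 * c / (r y)^3"
definition \<beta> where "\<beta> y = (1 / r y + 1 / (2 * M)) * (p y - k y) / 2 - k' y"
definition \<alpha> where "\<alpha> y = (1 / r y + 1 / (2 * M)) * (p y + k y) / 2 + k' y"
definition m where "m y = Pk M (r y) / (8 * M * n y)"
text \<open>That tangent and normal change r at the rates p and k reads U m + V n = P p and U m - V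
  n = P k. Solved for U and V, with P = 8 M n m, these are the formulas for \<open>U\<close> and
  \<open>V\<close>.\<close>

definition U where "U y = 4 * M * (p y + k y) * n y"
definition V where "V y = 4 * M * (p y - k y) * m y"

lemma m_pos: "y \<in> I \<Longrightarrow> m y > 0"
  using Pk_pos[OF M r_pos] n_pos M by (simp add: m_def)

lemma Pk_m: "y \<in> I \<Longrightarrow> Pk M (r y) = 8 * M * n y * m y"
  using n_pos[of y] M by (simp add: m_def)

lemma p2_k2: "y \<in> I \<Longrightarrow> (p y)\<^sup>2 - (k y)\<^sup>2 = schw_h M (r y)"
  using p2 by (simp add: k_def Wfun_def)

lemma UV: assumes "y \<in> I" shows "U y * V y = Gk M (r y)"
proof -
  have "U y * V y = 2 * M * ((p y)\<^sup>2 - (k y)\<^sup>2) * (8 * M * n y * m y)"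
    by (simp add: U_def V_def power2_eq_square algebra_simps)
  then show ?thesis
    unfolding p2_k2[OF assms] Gk_Pk[OF M r_pos[OF assms]] Pk_m[OF assms] .
qed

lemma UV_gt: "y \<in> I \<Longrightarrow> U y * V y > - 2 * M"
  using UV Gk_gt[OF M r_pos] by simp

lemma kruskal_r_UV: "y \<in> I \<Longrightarrow> kruskal_r M (U y) (V y) = r y"
  using kruskal_r_unique[OF M r_pos] UV by simp

lemma dk: assumes "y \<in> I" shows "(k has_real_derivative k' y * (p y / a y)) (at y)"
proof -
  have r: "r y > 0" by (rule r_pos[OF assms])
  have "((\<lambda>x. H * x + c / x^2) has_real_derivative k' y) (at (r y))"
    using r by (auto intro!: derivative_eq_intros simp: k'_def field_simps power2_eq_square power3_eq_cube)
  from DERIV_chain2[OF this dr[OF assms]] show ?thesis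
    unfolding k_def[abs_def] kfun_def .
qed

text \<open>Multiplied by 4 M n / a and 4 M m / a, the left sides are the derivatives of U and V.
  \<beta> and \<alpha> carry the factors p - k and p + k, so that the products form p^2 - k^2 = h
  and no division by a quantity vanishing at the horizon remains.\<close>

lemma key_identity:
  assumes "y \<in> I"
  shows "k y * k' y + M / (r y)\<^sup>2 + k' y * p y + (p y + k y) * \<beta> y = 1 / (4 * M)"
    and "k y * k' y + M / (r y)\<^sup>2 - k' y * p y + (p y - k y) * \<alpha> y = 1 / (4 * M)"
proof -
  have r: "r y > 0" by (rule r_pos[OF assms])
  have h: "M / (r y)\<^sup>2 + (1 / r y + 1 / (2 * M)) * schw_h M (r y) / 2 = 1 / (4 * M)"
    using r M by (simp add: schw_h_def field_simps power2_eq_square)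
  define q where "q = 1 / r y + 1 / (2 * M)"
  have "(p y + k y) * \<beta> y = q * ((p y)\<^sup>2 - (k y)\<^sup>2) / 2 - k' y * p y - k y * k' y"
    unfolding \<beta>_def q_def[symmetric] power2_eq_square by (simp add: field_simps)
  then show "k y * k' y + M / (r y)\<^sup>2 + k' y * p y + (p y + k y) * \<beta> y = 1 / (4 * M)"
    using h unfolding p2_k2[OF assms] q_def by simp
  have "(p y - k y) * \<alpha> y = q * ((p y)\<^sup>2 - (k y)\<^sup>2) / 2 + k' y * p y - k y * k' y"
    unfolding \<alpha>_def q_def[symmetric] power2_eq_square by (simp add: field_simps)
  then show "k y * k' y + M / (r y)\<^sup>2 - k' y * p y + (p y - k y) * \<alpha> y = 1 / (4 * M)"
    using h unfolding p2_k2[OF assms] q_def by simp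
qed

lemma DERIV_n: "y \<in> I \<Longrightarrow> (n has_real_derivative \<beta> y / a y * n y) (at y)"
  using dn by (simp add: \<beta>_def k_def k'_def)

lemma DERIV_p: "y \<in> I \<Longrightarrow> (p has_real_derivative (k y * k' y + M / (r y)\<^sup>2) / a y) (at y)"
  using dp by (simp add: k_def k'_def)

lemma DERIV_m:
  assumes "y \<in> I" shows "(m has_real_derivative \<alpha> y / a y * m y) (at y)"
proof -
  have pos: "r y > 0" "a y > 0" "n y > 0" using r_pos a_pos n_pos assms by auto
  define q where "q = 1 / r y + 1 / (2 * M)"
  have "((\<lambda>y. Pk M (r y) / (8 * M * n y)) has_real_derivative
      (q * Pk M (r y) * (p y / a y) * (8 * M * n y) - Pk M (r y) * (8 * M * (\<beta> y / a y * n y)))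
        / (8 * M * n y * (8 * M * n y))) (at y)"
    unfolding q_def
    by (intro DERIV_divide DERIV_chain2[OF DERIV_Pk[OF M pos(1)] dr[OF assms]] DERIV_cmult DERIV_n assms)
      (use M pos in simp)
  also have "(q * Pk M (r y) * (p y / a y) * (8 * M * n y) - Pk M (r y) * (8 * M * (\<beta> y / a y * n y)))
        / (8 * M * n y * (8 * M * n y)) = (q * p y - \<beta> y) / a y * m y"
    using M pos by (simp add: m_def field_simps)
  also have "q * p y - \<beta> y = \<alpha> y"
    unfolding \<alpha>_def \<beta>_def q_def[symmetric] by (simp add: field_simps)
  finally show ?thesis unfolding m_def[abs_def] .
qed

lemma DERIV_U:
  assumes "y \<in> I" shows "(U has_real_derivative n y / a y) (at y)"
proof -
  have "((\<lambda>y. 4 * M * (p y + k y) * n y) has_real_derivative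
     4 * M * ((k y * k' y + M / (r y)\<^sup>2) / a y + k' y * (p y / a y)) * n y +
     \<beta> y / a y * n y * (4 * M * (p y + k y))) (at y)"
    by (intro DERIV_mult DERIV_cmult DERIV_add DERIV_n DERIV_p dk assms)
  also have "4 * M * ((k y * k' y + M / (r y)\<^sup>2) / a y + k' y * (p y / a y)) * n y +
     \<beta> y / a y * n y * (4 * M * (p y + k y)) =
     4 * M * (k y * k' y + M / (r y)\<^sup>2 + k' y * p y + (p y + k y) * \<beta> y) * n y / a y"
    using a_pos[OF assms] by (simp add: add_divide_distrib distrib_left distrib_right mult_ac)
  also have "\<dots> = n y / a y" unfolding key_identity(1)[OF assms] using M by simp
  finally show ?thesis unfolding U_def[abs_def] .
qed

lemma DERIV_V:
  assumes "y \<in> I" shows "(V has_real_derivative m y / a y) (at y)"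
proof -
  have "((\<lambda>y. 4 * M * (p y - k y) * m y) has_real_derivative
     4 * M * ((k y * k' y + M / (r y)\<^sup>2) / a y - k' y * (p y / a y)) * m y +
     \<alpha> y / a y * m y * (4 * M * (p y - k y))) (at y)"
    by (intro DERIV_mult DERIV_cmult DERIV_diff DERIV_m DERIV_p dk assms)
  also have "4 * M * ((k y * k' y + M / (r y)\<^sup>2) / a y - k' y * (p y / a y)) * m y +
     \<alpha> y / a y * m y * (4 * M * (p y - k y)) =
     4 * M * (k y * k' y + M / (r y)\<^sup>2 - k' y * p y + (p y - k y) * \<alpha> y) * m y / a y"
    using a_pos[OF assms]
    by (simp add: add_divide_distrib diff_divide_distrib right_diff_distrib left_diff_distrib distrib_left distrib_right mult_ac)
  also have "\<dots> = m y / a y" unfolding key_identity(2)[OF assms] using M by simp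
  finally show ?thesis unfolding V_def[abs_def] .
qed

lemma segment_in_I: "x \<in> I \<Longrightarrow> y \<in> I \<Longrightarrow> x \<le> z \<Longrightarrow> z \<le> y \<Longrightarrow> z \<in> I"
  using I(2) connectedD_interval by blast

lemma U_strict_mono: "x \<in> I \<Longrightarrow> y \<in> I \<Longrightarrow> x < y \<Longrightarrow> U x < U y"
  by (rule DERIV_pos_imp_increasing, assumption)
    (metis DERIV_U a_pos n_pos segment_in_I divide_pos_pos)

lemma V_strict_mono: "x \<in> I \<Longrightarrow> y \<in> I \<Longrightarrow> x < y \<Longrightarrow> V x < V y"
  by (rule DERIV_pos_imp_increasing, assumption)
    (metis DERIV_V a_pos m_pos segment_in_I divide_pos_pos)

lemma U_inj: "inj_on U I"
  by (rule linorder_inj_onI') (use U_strict_mono in force)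

lemma V_inj: "inj_on V I"
  by (rule linorder_inj_onI') (use V_strict_mono in force)

lemma smooth_k: "smooth1 I k" and smooth_k': "smooth1 I k'"
proof -
  have r0: "\<And>y. y \<in> I \<Longrightarrow> r y \<noteq> 0" using r_pos by force
  show "smooth1 I k" unfolding k_def[abs_def] kfun_def
    by (intro smooth1_add smooth1_mult smooth1_const smooth1_divide smooth1_power smooth I) (use r0 in auto)
  show "smooth1 I k'" unfolding k'_def[abs_def]
    by (intro smooth1_diff smooth1_const smooth1_divide smooth1_power smooth I) (use r0 in auto)
qed

lemma smooth_\<beta>: "smooth1 I \<beta>" and smooth_\<alpha>: "smooth1 I \<alpha>"
proof -
  have r0: "\<And>y. y \<in> I \<Longrightarrow> r y \<noteq> 0" using r_pos by force
  have q: "smooth1 I (\<lambda>y. 1 / r y + 1 / (2 * M))"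
    by (intro smooth1_add smooth1_const smooth1_divide smooth I) (use r0 in auto)
  show "smooth1 I \<beta>" unfolding \<beta>_def[abs_def]
    by (rule smooth1_diff[OF smooth1_divide[OF I(1) smooth1_mult[OF q smooth1_diff[OF smooth(3) smooth_k]] smooth1_const] smooth_k']) simp
  show "smooth1 I \<alpha>" unfolding \<alpha>_def[abs_def]
    by (rule smooth1_add[OF smooth1_divide[OF I(1) smooth1_mult[OF q smooth1_add[OF smooth(3) smooth_k]] smooth1_const] smooth_k']) simp
qed

lemma smooth_n: "smooth1 I n" and smooth_m: "smooth1 I m"
proof -
  have a0: "\<And>y. y \<in> I \<Longrightarrow> a y \<noteq> 0" using a_pos by force
  show "smooth1 I n"
    by (rule smooth1_linear_ode[OF DERIV_n smooth1_divide[OF I(1) smooth_\<beta> smooth(2) a0]])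
  show "smooth1 I m"
    by (rule smooth1_linear_ode[OF DERIV_m smooth1_divide[OF I(1) smooth_\<alpha> smooth(2) a0]])
qed

lemma smooth_V: "smooth1 I V"
  unfolding V_def[abs_def] by (intro smooth1_mult smooth1_diff smooth1_const smooth smooth_k smooth_m)

lemma isCont_U: "y \<in> I \<Longrightarrow> isCont U y" and isCont_V: "y \<in> I \<Longrightarrow> isCont V y"
  by (auto intro: DERIV_isCont DERIV_U DERIV_V)

section \<open>The profile curve as a graph over U\<close>

definition Y where "Y = inv_into I U"

lemma Y_U: "y \<in> I \<Longrightarrow> Y (U y) = y"
  unfolding Y_def by (rule inv_into_f_f[OF U_inj])

lemma DERIV_Y: assumes "y \<in> I" shows "(Y has_real_derivative a y / n y) (at (U y))"
proof -
  have "(Y has_real_derivative inverse (n y / a y)) (at (U y))"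
    by (rule DERIV_inverse_strong[where S = I, OF I(1) assms _ _ DERIV_U[OF assms]])
      (use a_pos[OF assms] n_pos[OF assms] in \<open>auto intro!: continuous_at_imp_continuous_on isCont_U Y_U\<close>)
  then show ?thesis by simp
qed

lemma open_U_image: "T \<subseteq> I \<Longrightarrow> open T \<Longrightarrow> open (U ` T)"
  by (rule invariance_of_domain)
    (auto intro!: continuous_at_imp_continuous_on isCont_U inj_on_subset[OF U_inj])

text \<open>The derivative of the inverse function is a / n composed with Y itself, so the bootstrap
  applies.\<close>

lemma smooth_Y: "smooth1 (U ` I) Y"
proof (rule smooth1_bootstrap)
  show "(Y has_real_derivative (\<lambda>x. a x / n x) (Y u)) (at u)" if "u \<in> U ` I" for u
    using that DERIV_Y Y_U by auto
  have n0: "\<And>y. y \<in> I \<Longrightarrow> n y \<noteq> 0" using n_pos by force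
  show "Cr k (U ` I) (\<lambda>u. (\<lambda>x. a x / n x) (Y u))" if "Cr k (U ` I) Y" for k
    by (rule Cr_compose[OF _ that, of I])
      (use smooth1_divide[OF I(1) smooth(2) smooth_n n0] Y_U in \<open>auto simp: smooth1_def\<close>)
qed

lemma smooth_comp_Y: "smooth1 I f \<Longrightarrow> smooth1 (U ` I) (\<lambda>u. f (Y u))"
  by (rule smooth1_compose[OF _ smooth_Y]) (auto simp: Y_U)

lemma DERIV_comp_Y:
  assumes "y \<in> I" "(f has_real_derivative d) (at y)"
  shows "((\<lambda>u. f (Y u)) has_real_derivative d * (a y / n y)) (at (U y))"
  by (rule DERIV_chain2[OF _ DERIV_Y]) (use assms Y_U in auto)

definition curve :: "real set \<Rightarrow> event set" where
  "curve T = {(u, v, \<omega>). \<exists>y\<in>T. u = U y \<and> v = V y \<and> norm \<omega> = 1}"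

lemma curve_graph: "T \<subseteq> I \<Longrightarrow> curve T = graph_event (U ` T) (\<lambda>u. V (Y u))"
  by (auto simp: curve_def graph_event_def Y_U subset_iff)

lemma DERIV_\<phi>:
  assumes "y \<in> I" shows "((\<lambda>u. V (Y u)) has_real_derivative m y / n y) (at (U y))"
  using DERIV_comp_Y[OF assms DERIV_V[OF assms]] a_pos[OF assms] by simp

lemma curve_spacelike:
  assumes "T \<subseteq> I" "open T" shows "spacelike_hypersurface M (curve T)"
  unfolding curve_graph[OF assms(1)]
proof (rule spacelike_graph[OF M open_U_image[OF assms], where d = "\<lambda>u. m (Y u) / n (Y u)"])
  show "smooth1 (U ` T) (\<lambda>u. V (Y u))"
    by (rule smooth1_subset[OF smooth_comp_Y[OF smooth_V]]) (use assms in auto)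
qed (use assms UV_gt DERIV_\<phi> m_pos n_pos in \<open>auto simp: Y_U subset_iff\<close>)

lemma curve_hypersurface: "T \<subseteq> I \<Longrightarrow> open T \<Longrightarrow> hypersurface M (curve T)"
  using curve_spacelike by (simp add: spacelike_hypersurface_def)

lemma curve_ss_cmc: "ss_cmc M H (curve I)"
  unfolding curve_graph[OF order_refl]
proof (rule ss_cmc_graph[OF M open_U_image[OF order_refl I(1)] smooth_comp_Y[OF smooth_V]
      smooth_comp_Y[OF smooth_n] smooth_comp_Y[OF smooth_m],
      where \<alpha> = "\<lambda>u. \<alpha> (Y u)" and \<beta> = "\<lambda>u. \<beta> (Y u)" and c = c])
  fix u assume "u \<in> U ` I"
  then obtain y where y: "y \<in> I" "u = U y" by auto
  note pos = m_pos[OF y(1)] n_pos[OF y(1)] a_pos[OF y(1)] r_pos[OF y(1)]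
  show "u * V (Y u) > - 2 * M" "n (Y u) > 0" "m (Y u) > 0"
    using y pos UV_gt by (simp_all add: Y_U)
  show "((\<lambda>u. V (Y u)) has_real_derivative m (Y u) / n (Y u)) (at u)"
    using DERIV_\<phi>[OF y(1)] y by (simp add: Y_U)
  show "((\<lambda>u. n (Y u)) has_real_derivative \<beta> (Y u)) (at u)"
    using DERIV_comp_Y[OF y(1) DERIV_n[OF y(1)]] y pos by (simp add: Y_U)
  show "((\<lambda>u. m (Y u)) has_real_derivative \<alpha> (Y u) * m (Y u) / n (Y u)) (at u)"
    using DERIV_comp_Y[OF y(1) DERIV_m[OF y(1)]] y pos by (simp add: Y_U)
  show "n (Y u) * m (Y u) * Fk M (kruskal_r M u (V (Y u))) = 1"
  proof -
    have "8 * M * (n y * m y * Fk M (r y)) = 8 * M"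
      using Fk_Pk[OF M pos(4)] unfolding Pk_m[OF y(1)] by (simp add: mult_ac)
    then show ?thesis using M y by (simp add: Y_U kruskal_r_UV)
  qed
  show "u * m (Y u) - V (Y u) * n (Y u) =
      Pk M (kruskal_r M u (V (Y u))) * kfun H c (kruskal_r M u (V (Y u)))"
    using y by (simp add: Y_U kruskal_r_UV Pk_m k_def[symmetric]) (simp add: U_def V_def algebra_simps)
  show "\<alpha> (Y u) - \<beta> (Y u) = 2 * (H - 2 * c / (kruskal_r M u (V (Y u)))^3) +
      (1 / kruskal_r M u (V (Y u)) + 1 / (2 * M)) * kfun H c (kruskal_r M u (V (Y u)))"
  proof -
    \<comment> \<open>The terms with p cancel in this difference, so the curvature condition
      involves r only.\<close>
    have "\<alpha> y - \<beta> y = 2 * k' y + (1 / r y + 1 / (2 * M)) * k y"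
    proof -
      have "q * (p y + k y) / 2 + k' y - (q * (p y - k y) / 2 - k' y) = 2 * k' y + q * k y" for q
        by (simp add: field_simps)
      then show ?thesis unfolding \<alpha>_def \<beta>_def by blast
    qed
    then show ?thesis using y by (simp add: Y_U kruskal_r_UV k'_def k_def)
  qed
qed

lemma curve_has_ends: "has_ends (curve I) 2"
  unfolding curve_graph[OF order_refl]
proof (rule has_ends_graph[OF open_U_image[OF order_refl I(1)]])
  show "connected (U ` I)"
    by (intro connected_continuous_image I continuous_at_imp_continuous_on ballI isCont_U)
  show "continuous_on (U ` I) (\<lambda>u. V (Y u))"
    by (rule smooth1_imp_continuous_on[OF smooth_comp_Y[OF smooth_V]])
qed (use I in auto)

end

section \<open>The time coordinate along the curve\<close>

lemma kruskal_t_eq: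
  assumes "u \<noteq> 0" "v \<noteq> 0"
  shows "kruskal_t M u v = M * (ln (v\<^sup>2) - ln (u\<^sup>2))"
proof -
  have "ln (x\<^sup>2) = 2 * ln \<bar>x\<bar>" if "x \<noteq> 0" for x :: real
    using that ln_realpow[of "\<bar>x\<bar>" 2] by simp
  then show ?thesis
    using assms by (simp add: kruskal_t_def abs_divide ln_div algebra_simps)
qed

context profile
begin

definition \<tau> where "\<tau> y = kruskal_t M (U y) (V y)"

lemma DERIV_\<tau>:
  assumes y: "y \<in> I" and nz: "U y \<noteq> 0" "V y \<noteq> 0"
  shows "(\<tau> has_real_derivative k y / (a y * schw_h M (r y))) (at y)"
proof -
  have pos: "a y > 0" "n y > 0" "m y > 0" using y a_pos n_pos m_pos by auto
  have pk: "p y + k y \<noteq> 0" "p y - k y \<noteq> 0" using nz by (auto simp: U_def V_def)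
  have ln2: "((\<lambda>y. ln ((f y)\<^sup>2)) has_real_derivative 2 * d / f y) (at y)"
    if "(f has_real_derivative d) (at y)" "f y \<noteq> 0" for f d
  proof -
    have "((\<lambda>y. (f y)\<^sup>2) has_real_derivative 2 * f y * d) (at y)"
      using DERIV_power[OF that(1), of 2] by (simp add: mult_ac)
    moreover have "(f y)\<^sup>2 > 0" using that(2) by simp
    ultimately have "((\<lambda>y. ln ((f y)\<^sup>2)) has_real_derivative 1 / (f y)\<^sup>2 * (2 * f y * d)) (at y)"
      by (intro DERIV_chain2[OF DERIV_ln_divide])
    also have "1 / (f y)\<^sup>2 * (2 * f y * d) = 2 * d / f y" using that(2) by (simp add: power2_eq_square)
    finally show ?thesis .
  qed
  \<comment> \<open>Squares under the logarithms remove the signs of U and V, so one computation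
    covers all quadrants.\<close>
  have "((\<lambda>y. M * (ln ((V y)\<^sup>2) - ln ((U y)\<^sup>2))) has_real_derivative
      M * (2 * (m y / a y) / V y - 2 * (n y / a y) / U y)) (at y)"
    by (intro DERIV_cmult DERIV_diff ln2 DERIV_U DERIV_V y nz)
  also have "M * (2 * (m y / a y) / V y - 2 * (n y / a y) / U y) =
      (1 / (p y - k y) - 1 / (p y + k y)) / (2 * a y)"
  proof -
    have "M * (2 * (m y / a y) / (4 * M * d1 * m y) - 2 * (n y / a y) / (4 * M * d2 * n y)) =
        (1 / d1 - 1 / d2) / (2 * a y)" if "d1 \<noteq> 0" "d2 \<noteq> 0" for d1 d2
      using pos M that by (simp add: field_simps)
    from this[OF pk(2,1)] show ?thesis unfolding U_def V_def .
  qed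
  also have "\<dots> = k y / (a y * ((p y)\<^sup>2 - (k y)\<^sup>2))"
  proof -
    have f: "(p y)\<^sup>2 - (k y)\<^sup>2 = (p y - k y) * (p y + k y)"
      by (simp add: power2_eq_square algebra_simps)
    show ?thesis unfolding f using pk pos by (simp add: divide_simps)
  qed
  also have "\<dots> = k y / (a y * schw_h M (r y))" unfolding p2_k2[OF y] ..
  finally have *: "((\<lambda>y. M * (ln ((V y)\<^sup>2) - ln ((U y)\<^sup>2))) has_real_derivative k y / (a y * schw_h M (r y))) (at y)" .
  have "\<forall>\<^sub>F x in nhds y. U x \<noteq> 0 \<and> V x \<noteq> 0"
    unfolding eventually_nhds_conv_at using nz isCont_U[OF y] isCont_V[OF y]
    by (auto simp: isCont_def intro!: eventually_conj tendsto_imp_eventually_ne)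
  then have "\<forall>\<^sub>F x in nhds y. \<tau> x = M * (ln ((V x)\<^sup>2) - ln ((U x)\<^sup>2))"
    by eventually_elim (simp add: \<tau>_def kruskal_t_eq)
  from DERIV_cong_ev[OF refl this refl] * show ?thesis by (rule iffD2)
qed

text \<open>In the applications Z is a branch of the inverse of r; as r has derivative p / a in the
  parameter, Z has derivative a / p. Time thereby becomes a function of r, and the sign of p tells
  the branches apart.\<close>

lemma DERIV_\<tau>_section:
  assumes "Z x \<in> I" "U (Z x) \<noteq> 0" "V (Z x) \<noteq> 0" "p (Z x) \<noteq> 0"
    and "(Z has_real_derivative a (Z x) / p (Z x)) (at x)"
  shows "((\<lambda>x. \<tau> (Z x)) has_real_derivative k (Z x) / (schw_h M (r (Z x)) * p (Z x))) (at x)"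
proof -
  have "k (Z x) / (a (Z x) * schw_h M (r (Z x))) * (a (Z x) / p (Z x)) = k (Z x) / (schw_h M (r (Z x)) * p (Z x))"
    using a_pos[OF assms(1)] by simp
  then show ?thesis using DERIV_chain2[OF DERIV_\<tau>[OF assms(1-3)] assms(5)] by simp
qed

text \<open>Within a quadrant the pair (r, t) determines (U, V), so it is enough that the curve
  attains exactly the radii of D, each time with the prescribed t.\<close>

lemma graph_over_curve:
  assumes "T \<subseteq> I" "\<And>y. y \<in> T \<Longrightarrow> su * U y > 0" "\<And>y. y \<in> T \<Longrightarrow> sv * V y > 0"
    and "r ` T = D" "\<And>y. y \<in> T \<Longrightarrow> \<tau> y = f (r y)"
  shows "graph_over M (quadrant M su sv) D f = curve T"
proof (intro equalityI subsetI)
  fix q assume q: "q \<in> graph_over M (quadrant M su sv) D f"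
  obtain u v \<omega> where [simp]: "q = (u, v, \<omega>)" by (cases q) auto
  have uv: "su * u > 0" "sv * v > 0" "norm \<omega> = 1" "u * v > - 2 * M"
    "kruskal_r M u v \<in> D" "kruskal_t M u v = f (kruskal_r M u v)"
    using q by (auto simp: graph_over_def quadrant_def kruskal_def)
  then obtain y where y: "y \<in> T" "kruskal_r M u v = r y" using assms(4) by auto
  have yI: "y \<in> I" using y assms(1) by auto
  have "u * v = U y * V y" using Gk_kruskal_r[OF M uv(4)] y UV[OF yI] by simp
  moreover have "kruskal_t M u v = kruskal_t M (U y) (V y)"
    using uv(6) assms(5)[OF y(1)] y(2) by (simp add: \<tau>_def)
  ultimately have "u = U y \<and> v = V y"
    using kruskal_quadrant_eq[OF M] uv assms(2,3)[OF y(1)] by blast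
  then show "q \<in> curve T" using y uv by (auto simp: curve_def)
next
  fix q assume "q \<in> curve T"
  then obtain y \<omega> where q: "q = (U y, V y, \<omega>)" "y \<in> T" "norm \<omega> = 1" by (auto simp: curve_def)
  then have yI: "y \<in> I" using assms(1) by auto
  have "\<tau> y = f (r y)" "r y \<in> D" using assms(4,5) q by auto
  then show "q \<in> graph_over M (quadrant M su sv) D f"
    using q assms(2,3)[OF q(2)] UV_gt[OF yI] kruskal_r_UV[OF yI]
    by (simp add: graph_over_def quadrant_def kruskal_def \<tau>_def)
qed

section \<open>Closedness and the junctions at the horizons\<close>

lemma curve_Un: "curve (S \<union> T) = curve S \<union> curve T"
  by (auto simp: curve_def)

lemma curve_mono: "S \<subseteq> T \<Longrightarrow> curve S \<subseteq> curve T"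
  by (auto simp: curve_def)

lemma curve_quadrant:
  assumes "T \<subseteq> I" "\<And>y. y \<in> T \<Longrightarrow> su * U y > 0" "\<And>y. y \<in> T \<Longrightarrow> sv * V y > 0"
  shows "curve T \<subseteq> quadrant M su sv"
  using assms UV_gt by (auto simp: curve_def quadrant_def kruskal_def subset_iff)

text \<open>The radius is a continuous function of UV, so it converges along any sequence whose
  limit lies in the spacetime. Convergence of r is what later controls the parameters
  \<open>ys\<close>.\<close>

lemma curve_closedin:
  assumes "\<And>ys u v. (\<And>i. ys i \<in> I) \<Longrightarrow> (\<lambda>i. U (ys i)) \<longlonglongrightarrow> u \<Longrightarrow> (\<lambda>i. V (ys i)) \<longlonglongrightarrow> v \<Longrightarrow>
     u * v > - 2 * M \<Longrightarrow> (\<lambda>i. r (ys i)) \<longlonglongrightarrow> kruskal_r M u v \<Longrightarrow> \<exists>y\<in>I. u = U y \<and> v = V y"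
  shows "closedin (top_of_set (kruskal M)) (curve I)"
proof -
  have "curve I \<subseteq> kruskal M" using UV_gt by (auto simp: curve_def kruskal_def)
  moreover have "q \<in> curve I" if q: "q \<in> closure (curve I)" "q \<in> kruskal M" for q
  proof -
    obtain u v \<omega> where [simp]: "q = (u, v, \<omega>)" by (cases q) auto
    have uv: "u * v > - 2 * M" "norm \<omega> = 1" using q(2) by (auto simp: kruskal_def)
    obtain xs where xs: "\<And>i. xs i \<in> curve I" "xs \<longlonglongrightarrow> q" using q(1) unfolding closure_sequential by blast
    have "\<forall>i. \<exists>y. y \<in> I \<and> fst (xs i) = U y \<and> fst (snd (xs i)) = V y"
    proof
      show "\<exists>y. y \<in> I \<and> fst (xs i) = U y \<and> fst (snd (xs i)) = V y" for i
        using xs(1)[of i] by (auto simp: curve_def)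
    qed
    then obtain ys where ys: "\<And>i. ys i \<in> I" "\<And>i. fst (xs i) = U (ys i)" "\<And>i. fst (snd (xs i)) = V (ys i)"
      by metis
    have lim: "(\<lambda>i. U (ys i)) \<longlonglongrightarrow> u" "(\<lambda>i. V (ys i)) \<longlonglongrightarrow> v"
      using tendsto_fst[OF xs(2)] tendsto_fst[OF tendsto_snd[OF xs(2)]] by (simp_all add: ys)
    have "isCont (kruskal_r M 1) (u * v)" by (rule DERIV_isCont[OF DERIV_kruskal_r[OF M uv(1)]])
    from isCont_tendsto_compose[OF this tendsto_mult[OF lim]]
    have "(\<lambda>i. r (ys i)) \<longlonglongrightarrow> kruskal_r M u v"
      by (simp flip: kruskal_r_prod add: kruskal_r_UV ys)
    from assms[OF ys(1) lim uv(1) this] show ?thesis using uv by (auto simp: curve_def)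
  qed
  ultimately have "curve I = kruskal M \<inter> closure (curve I)" using closure_subset by blast
  then show ?thesis using closedin_closed by blast
qed

lemma curve_in_closure:
  assumes "T \<subseteq> I" "y \<in> I" "y \<in> closure T"
  shows "curve {y} \<subseteq> closure (curve T)"
proof
  fix q assume "q \<in> curve {y}"
  then obtain \<omega> where q: "q = (U y, V y, \<omega>)" "norm \<omega> = 1" by (auto simp: curve_def)
  obtain xs where xs: "\<And>i. xs i \<in> T" "xs \<longlonglongrightarrow> y" using assms(3) unfolding closure_sequential by blast
  have "(\<lambda>i. (U (xs i), V (xs i), \<omega>)) \<longlonglongrightarrow> q"
    unfolding q by (intro tendsto_Pair tendsto_const isCont_tendsto_compose[OF isCont_U xs(2)]
        isCont_tendsto_compose[OF isCont_V xs(2)] assms)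
  moreover have "(U (xs i), V (xs i), \<omega>) \<in> curve T" for i using xs q by (auto simp: curve_def)
  ultimately show "q \<in> closure (curve T)"
    unfolding closure_sequential by (intro exI[of _ "\<lambda>i. (U (xs i), V (xs i), \<omega>)"]) simp
qed

text \<open>Z plays the horizon between R and R'. A limit point on Z of either piece lies on the
  relatively closed curve, which meets Z at most in the sphere over y, and y is a limit of both
  parameter sets; so both limit sets are this sphere. The join is then an open stretch of one smooth
  curve, with nothing to be matched.\<close>

lemma connects:
  assumes closed: "closedin (top_of_set (kruskal M)) (curve I)"
    and y: "y \<in> I" "TA \<subseteq> I" "TB \<subseteq> I" "y \<in> closure TA" "y \<in> closure TB" "open (TA \<union> TB \<union> {y})"
    and R: "curve TA \<subseteq> R" "curve TB \<subseteq> R'" "closure R \<inter> closure R' \<subseteq> Z" "Z \<subseteq> kruskal M"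
      "curve I \<inter> Z \<subseteq> curve {y}"
  shows "connects_smoothly M R R' (curve TA) (curve TB)"
    and "join R R' (curve TA) (curve TB) = curve (TA \<union> TB \<union> {y})"
proof -
  obtain C where C: "closed C" "curve I = kruskal M \<inter> C" using closed unfolding closedin_closed by blast
  have cl: "closure (curve T) \<inter> Z \<subseteq> curve {y}" if "T \<subseteq> I" for T
  proof -
    have "closure (curve T) \<subseteq> C"
      by (rule closure_minimal[OF _ C(1)]) (use curve_mono[OF that] C(2) in blast)
    then show ?thesis using R(4,5) C(2) by blast
  qed
  have in_cl: "curve {y} \<subseteq> closure (curve TA)" "curve {y} \<subseteq> closure (curve TB)"
    using curve_in_closure y by blast+
  moreover have "closure (curve TA) \<subseteq> closure R" "closure (curve TB) \<subseteq> closure R'"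
    using closure_mono[OF R(1)] closure_mono[OF R(2)] by simp_all
  ultimately have lim: "limit_set R R' (curve TA) = curve {y}" "limit_set R R' (curve TB) = curve {y}"
    using cl[OF y(2)] cl[OF y(3)] R(3) unfolding limit_set_def by blast+
  show J: "join R R' (curve TA) (curve TB) = curve (TA \<union> TB \<union> {y})"
    unfolding join_def lim curve_Un by simp
  have "curve {y} = {U y} \<times> {V y} \<times> sphere 0 1" by (auto simp: curve_def)
  moreover have "spacelike_hypersurface M (join R R' (curve TA) (curve TB))"
    unfolding J by (rule curve_spacelike) (use y in auto)
  ultimately show "connects_smoothly M R R' (curve TA) (curve TB)"
    unfolding connects_smoothly_def lim by blast
qed

lemma connects_I_II':
  assumes closed: "closedin (top_of_set (kruskal M)) (curve I)"
    and y: "y \<in> I" "TA \<subseteq> I" "TB \<subseteq> I" "y \<in> closure TA" "y \<in> closure TB" "open (TA \<union> TB \<union> {y})"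
    and R: "curve TA \<subseteq> region_I M" "curve TB \<subseteq> region_II' M" and V0: "V y = 0"
  shows "connects_smoothly M (region_I M) (region_II' M) (curve TA) (curve TB)"
    and "join (region_I M) (region_II' M) (curve TA) (curve TB) = curve (TA \<union> TB \<union> {y})"
proof -
  let ?Z = "{(u, v, \<omega>). v = 0 \<and> norm \<omega> = 1} :: event set"
  have "closure (region_I M) \<inter> closure (region_II' M) \<subseteq> ?Z"
    using closure_quadrant[of M 1 1] closure_quadrant[of M 1 "-1"] unfolding region_quadrant by fastforce
  moreover have "?Z \<subseteq> kruskal M" using M by (auto simp: kruskal_def)
  moreover have "curve I \<inter> ?Z \<subseteq> curve {y}"
  proof
    fix q assume "q \<in> curve I \<inter> ?Z"
    then obtain x \<omega> where x: "q = (U x, V x, \<omega>)" "x \<in> I" "norm \<omega> = 1" "V x = 0"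
      by (auto simp: curve_def)
    then have "x = y" using inj_onD[OF V_inj, of x y] V0 y(1) by simp
    then show "q \<in> curve {y}" using x by (simp add: curve_def)
  qed
  ultimately show "connects_smoothly M (region_I M) (region_II' M) (curve TA) (curve TB)"
    "join (region_I M) (region_II' M) (curve TA) (curve TB) = curve (TA \<union> TB \<union> {y})"
    using connects[OF closed y R] by blast+
qed

lemma connects_II'_I':
  assumes closed: "closedin (top_of_set (kruskal M)) (curve I)"
    and y: "y \<in> I" "TA \<subseteq> I" "TB \<subseteq> I" "y \<in> closure TA" "y \<in> closure TB" "open (TA \<union> TB \<union> {y})"
    and R: "curve TA \<subseteq> region_II' M" "curve TB \<subseteq> region_I' M" and U0: "U y = 0"
  shows "connects_smoothly M (region_II' M) (region_I' M) (curve TA) (curve TB)"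
    and "join (region_II' M) (region_I' M) (curve TA) (curve TB) = curve (TA \<union> TB \<union> {y})"
proof -
  let ?Z = "{(u, v, \<omega>). u = 0 \<and> norm \<omega> = 1} :: event set"
  have "closure (region_II' M) \<inter> closure (region_I' M) \<subseteq> ?Z"
    using closure_quadrant[of M 1 "-1"] closure_quadrant[of M "-1" "-1"] unfolding region_quadrant by fastforce
  moreover have "?Z \<subseteq> kruskal M" using M by (auto simp: kruskal_def)
  moreover have "curve I \<inter> ?Z \<subseteq> curve {y}"
  proof
    fix q assume "q \<in> curve I \<inter> ?Z"
    then obtain x \<omega> where x: "q = (U x, V x, \<omega>)" "x \<in> I" "norm \<omega> = 1" "U x = 0"
      by (auto simp: curve_def)
    then have "x = y" using inj_onD[OF U_inj, of x y] U0 y(1) by simp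
    then show "q \<in> curve {y}" using x by (simp add: curve_def)
  qed
  ultimately show "connects_smoothly M (region_II' M) (region_I' M) (curve TA) (curve TB)"
    "join (region_II' M) (region_I' M) (curve TA) (curve TB) = curve (TA \<union> TB \<union> {y})"
    using connects[OF closed y R] by blast+
qed

lemma curve_complete:
  "closedin (top_of_set (kruskal M)) (curve I) \<Longrightarrow> complete_hypersurface M (curve I)"
  by (simp add: complete_hypersurface_def curve_hypersurface I)

end

section \<open>Zeros of \<open>Wfun\<close>\<close>

lemma DERIV_kfun: "r > 0 \<Longrightarrow> (kfun H c has_real_derivative H - 2 * c / r^3) (at r)"
  unfolding kfun_def[abs_def]
  by (auto intro!: derivative_eq_intros simp: field_simps power2_eq_square power3_eq_cube)

lemma DERIV_Wfun:
  assumes "r > 0"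
  shows "(Wfun M H c has_real_derivative 2 * (kfun H c r * (H - 2 * c / r^3) + M / r\<^sup>2)) (at r)"
proof -
  have "(schw_h M has_real_derivative 2 * M / r\<^sup>2) (at r)"
    unfolding schw_h_def[abs_def] using assms
    by (auto intro!: derivative_eq_intros simp: power2_eq_square)
  from DERIV_add[OF this DERIV_power[OF DERIV_kfun[OF assms], of H c 2]] show ?thesis
    unfolding Wfun_def[abs_def] by (simp add: algebra_simps)
qed

text \<open>In the factorisation \<open>Wpoly_factor\<close> the first factor vanishes at r and the
  second equals 2 sqrt (r^3 (2M - r)), so the slope of \<open>ktilde\<close> alone decides between a
  simple and a multiple zero.\<close>

lemma pderiv_Wpoly:
  assumes "0 < r" "r < 2 * M" "ktilde M H r = c"
  shows "poly (pderiv (Wpoly M H c)) r =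
    - (r\<^sup>2 * (kt_slope M r - 3 * H)) * (2 * sqrt (r^3 * (2 * M - r)))"
proof -
  define s where "s = sqrt (r^3 * (2 * M - r))"
  define ds where "ds = (2 * r\<^sup>2 * (3 * M - 2 * r)) * (inverse (sqrt (r^3 * (2 * M - r))) / 2)"
  have s: "H * r^3 + c = s" using assms by (simp add: ktilde_eq s_def)
  have d1: "((\<lambda>r. c - ktilde M H r) has_real_derivative 0 - r\<^sup>2 * (kt_slope M r - 3 * H)) (at r)"
    by (rule DERIV_diff[OF DERIV_const DERIV_ktilde[OF assms(1,2)]])
  have d2: "((\<lambda>r. H * r^3 + c + sqrt (r^3 * (2 * M - r))) has_real_derivative (H * (3 * r\<^sup>2) + 0 + ds)) (at r)"
    unfolding ds_def
    by (rule DERIV_add[OF _ DERIV_sqrt_radicand[OF assms(1,2)]]) (auto intro!: derivative_eq_intros)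
  have "((\<lambda>r. (c - ktilde M H r) * (H * r^3 + c + sqrt (r^3 * (2 * M - r)))) has_real_derivative
     - (r\<^sup>2 * (kt_slope M r - 3 * H)) * (2 * s)) (at r)"
    using DERIV_mult[OF d1 d2] s assms(3) by (simp add: s_def)
  then have "(poly (Wpoly M H c) has_real_derivative - (r\<^sup>2 * (kt_slope M r - 3 * H)) * (2 * s)) (at r)"
    by (rule has_field_derivative_transform_within_open[where S = "{0<..<2*M}"])
      (use assms Wpoly_factor in auto)
  then show ?thesis using DERIV_unique[OF poly_DERIV] unfolding s_def by blast
qed

lemma Wpoly_root:
  assumes "0 < r" "r < 2 * M" "ktilde M H r = c"
  obtains q where "Wpoly M H c = [:- r, 1:] * q" "poly q r = poly (pderiv (Wpoly M H c)) r"
proof -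
  have "poly (Wpoly M H c) r = 0" using assms Wpoly_factor[of r M H c] by simp
  then obtain q where q: "Wpoly M H c = [:- r, 1:] * q" unfolding poly_eq_0_iff_dvd by (elim dvdE)
  have "poly (pderiv (Wpoly M H c)) r = poly q r"
    unfolding q pderiv_mult by (simp add: pderiv_pCons)
  with q that show ?thesis by simp
qed

text \<open>At \<open>R_max\<close> the polynomial and its derivative vanish, so (x - R)^2 divides
  it and the cofactor is bounded on [0, 2M]. Taking roots gives a bound linear in |x - R|, valid on
  both sides of R.\<close>

lemma Wfun_double_zero:
  assumes "M > 0"
  obtains B where "B > 0"
    "\<And>x. 0 < x \<Longrightarrow> x \<le> 2 * M \<Longrightarrow> sqrt (Wfun M H (C_max M H) x) \<le> B * \<bar>x - R_max M H\<bar> / x\<^sup>2"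
proof -
  define R c where "R = R_max M H" and "c = C_max M H"
  have R: "0 < R" "R < 2 * M" using R_max_in[OF assms] by (auto simp: R_def)
  have c: "ktilde M H R = c" by (simp add: R_def c_def C_max_def)
  obtain q where q: "Wpoly M H c = [:- R, 1:] * q" "poly q R = poly (pderiv (Wpoly M H c)) R"
    using Wpoly_root[OF R c] .
  have "poly q R = 0"
    unfolding q(2) pderiv_Wpoly[OF R c] using kt_slope_R_max[OF assms] by (simp add: R_def)
  then obtain q' where q': "q = [:- R, 1:] * q'" unfolding poly_eq_0_iff_dvd by (elim dvdE)
  have "compact (poly q' ` {0..2*M})"
    by (intro compact_continuous_image continuous_intros) auto
  then obtain B where B: "B > 0" "\<And>x. x \<in> {0..2*M} \<Longrightarrow> \<bar>poly q' x\<bar> \<le> B"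
    using compact_imp_bounded[of "poly q' ` {0..2*M}"] unfolding bounded_pos by auto
  have "sqrt (Wfun M H c x) \<le> sqrt B * \<bar>x - R\<bar> / x\<^sup>2" if "0 < x" "x \<le> 2 * M" for x
  proof -
    have "poly (Wpoly M H c) x = (x - R)\<^sup>2 * poly q' x"
      unfolding q q' by (simp add: power2_eq_square algebra_simps)
    also have "\<dots> \<le> (x - R)\<^sup>2 * B" using B(2)[of x] that by (intro mult_left_mono) auto
    finally have "Wfun M H c x \<le> (x - R)\<^sup>2 * B / x^4"
      using that by (simp add: Wfun_Wpoly divide_right_mono)
    then have "sqrt (Wfun M H c x) \<le> sqrt ((x - R)\<^sup>2 * B / x^4)" by simp
    also have "\<dots> = sqrt B * \<bar>x - R\<bar> / x\<^sup>2"
    proof -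
      have x4: "x^4 = (x\<^sup>2)\<^sup>2" by simp
      show ?thesis unfolding x4 real_sqrt_divide real_sqrt_mult real_sqrt_abs by simp
    qed
    finally show ?thesis .
  qed
  with B(1) that[of "sqrt B"] show ?thesis by (simp add: R_def c_def)
qed

lemma interval_integrable_min_max:
  "interval_lebesgue_integrable lborel (ereal (min s r)) (ereal (max s r)) f \<longleftrightarrow>
    set_integrable lborel {min s r<..<max s r} f"
proof -
  have "ereal (min s r) \<le> ereal (max s r)" unfolding ereal_less_eq by simp
  moreover have "einterval (ereal x) (ereal y) = {x<..<y}" for x y
    by (auto simp: einterval_def)
  ultimately show ?thesis unfolding interval_lebesgue_integrable_def by (simp only: if_True)
qed

section \<open>The domain of \<open>\<Sigma>\<^sup>4\<close>\<close>

lemma kfun_ge_sqrt: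
  assumes "0 < r" "r < 2 * M" "ktilde M H r \<le> c"
  shows "kfun H c r \<ge> sqrt (- schw_h M r)"
proof -
  have "kfun H c r = (H * r^3 + c) / r\<^sup>2"
    using assms by (simp add: kfun_def field_simps power2_eq_square power3_eq_cube)
  also have "\<dots> \<ge> sqrt (r^3 * (2 * M - r)) / r\<^sup>2"
    using kfun_pos_inside(2)[OF assms] by (intro divide_right_mono) auto
  also have "sqrt (r^3 * (2 * M - r)) / r\<^sup>2 = sqrt (r^3 * (2 * M - r) / (r\<^sup>2)\<^sup>2)"
    unfolding real_sqrt_divide real_sqrt_abs by simp
  also have "r^3 * (2 * M - r) / (r\<^sup>2)\<^sup>2 = - schw_h M r"
    using assms by (simp add: schw_h_def field_simps power2_eq_square power3_eq_cube)
  finally show ?thesis .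
qed

lemma f4_integrand_double_zero:
  assumes "M > 0" "- 8 * M^3 * H < C_max M H" "0 < m"
  obtains d where "d > 0" "\<And>x. m \<le> x \<Longrightarrow> x < 2 * M \<Longrightarrow> x \<noteq> R_max M H \<Longrightarrow>
    d * (1 / \<bar>x - R_max M H\<bar>) \<le> \<bar>f4_integrand M H (C_max M H) x\<bar>"
proof -
  obtain B where B: "B > 0" "\<And>x. 0 < x \<Longrightarrow> x \<le> 2 * M \<Longrightarrow>
      sqrt (Wfun M H (C_max M H) x) \<le> B * \<bar>x - R_max M H\<bar> / x\<^sup>2"
    by (rule Wfun_double_zero[OF assms(1), where H = H]) blast
  define c R where "c = C_max M H" and "R = R_max M H"
  \<comment> \<open>Two lower bounds are multiplied: k / |h| is at least 1 / sqrt |h|, hence at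
    least sqrt (m / 2M) because |h| \<le> 2M / x; and 1 / sqrt W is at least x^2 / (B |x -
    R|).\<close>
  define d where "d = sqrt (m / (2 * M)) * (m\<^sup>2 / B)"
  have "d > 0" using assms B by (simp add: d_def)
  moreover have "d * (1 / \<bar>x - R\<bar>) \<le> \<bar>f4_integrand M H c x\<bar>" if x: "m \<le> x" "x < 2 * M" "x \<noteq> R" for x
  proof -
    have x0: "0 < x" using x assms by simp
    have kt: "ktilde M H x < c"
      using ktilde_less_C_max[OF assms(1) x0 x(2)] x(3) by (simp add: c_def R_def)
    have h: "- schw_h M x > 0" "- schw_h M x \<le> 2 * M / x" using x x0 by (simp_all add: schw_h_def)
    have k: "kfun H c x \<ge> sqrt (- schw_h M x)" by (rule kfun_ge_sqrt) (use x x0 kt in auto)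
    have k0: "kfun H c x \<ge> 0" using kfun_pos_inside(1)[OF x0 x(2)] kt by (simp add: less_imp_le)
    have W: "Wfun M H c x > 0" by (rule Wfun_pos) (use assms x0 kt in \<open>auto simp: c_def\<close>)
    have "sqrt (m / (2 * M)) \<le> sqrt (1 / (- schw_h M x))"
    proof (rule real_sqrt_le_mono)
      have "m / (2 * M) \<le> x / (2 * M)" using x assms by (simp add: divide_right_mono)
      also have "\<dots> = 1 / (2 * M / x)" by simp
      also have "\<dots> \<le> 1 / (- schw_h M x)" using h x0 assms(1)
        by (intro divide_left_mono mult_pos_pos divide_pos_pos) simp_all
      finally show "m / (2 * M) \<le> 1 / (- schw_h M x)" .
    qed
    also have "\<dots> = sqrt (- schw_h M x) / (- schw_h M x)"
    proof -
      have "sqrt (1 / t) = sqrt t / t" if "t > 0" for t :: real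
        using that by (simp add: real_sqrt_divide field_simps)
      from this[OF h(1)] show ?thesis .
    qed
    also have "\<dots> \<le> kfun H c x / (- schw_h M x)" using k h by (intro divide_right_mono) auto
    finally have 1: "sqrt (m / (2 * M)) \<le> kfun H c x / (- schw_h M x)" .
    have "m\<^sup>2 / B * (1 / \<bar>x - R\<bar>) = m\<^sup>2 / (B * \<bar>x - R\<bar>)" by simp
    also have "\<dots> \<le> x\<^sup>2 / (B * \<bar>x - R\<bar>)" using x assms B by (intro divide_right_mono power_mono) auto
    also have "\<dots> = 1 / (B * \<bar>x - R\<bar> / x\<^sup>2)" by simp
    also have "\<dots> \<le> 1 / sqrt (Wfun M H c x)"
      using B(2)[OF x0] B(1) x x0 W by (intro divide_left_mono mult_pos_pos) (auto simp: c_def R_def)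
    finally have 2: "m\<^sup>2 / B * (1 / \<bar>x - R\<bar>) \<le> 1 / sqrt (Wfun M H c x)" .
    have "d * (1 / \<bar>x - R\<bar>) = sqrt (m / (2 * M)) * (m\<^sup>2 / B * (1 / \<bar>x - R\<bar>))"
      by (simp add: d_def)
    also have "\<dots> \<le> kfun H c x / (- schw_h M x) * (1 / sqrt (Wfun M H c x))"
    proof (rule mult_mono[OF 1 2])
      show "0 \<le> kfun H c x / (- schw_h M x)" using k0 h(1) by (rule divide_nonneg_pos)
      show "0 \<le> m\<^sup>2 / B * (1 / \<bar>x - R\<bar>)" using B(1) by simp
    qed
    also have "\<dots> = \<bar>f4_integrand M H c x\<bar>"
      using f4_integrand_eq[OF assms(1) x0 x(2) kt] assms(2) h W k0 by (simp add: c_def abs_mult)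
    finally show ?thesis .
  qed
  ultimately show ?thesis using that[of d] by (simp add: c_def R_def)
qed

text \<open>The integrand dominates a multiple of 1 / |x - R|, whose primitive is a logarithm. Both
  sides of R are treated because a finite integral from either one would put R into the
  domain.\<close>

lemma f4_not_integrable:
  assumes "M > 0" "- 8 * M^3 * H < C_max M H" "s \<in> {0<..<2*M}" "s \<noteq> R_max M H"
  shows "\<not> interval_lebesgue_integrable lborel (ereal (min s (R_max M H))) (ereal (max s (R_max M H)))
    (f4_integrand M H (C_max M H))"
proof
  define R where "R = R_max M H"
  have R: "0 < R" "R < 2 * M" using R_max_in[OF assms(1)] by (auto simp: R_def)
  assume "interval_lebesgue_integrable lborel (ereal (min s (R_max M H))) (ereal (max s (R_max M H)))
    (f4_integrand M H (C_max M H))"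
  then have int: "set_integrable lborel {min s R<..<max s R} (f4_integrand M H (C_max M H))"
    unfolding interval_integrable_min_max R_def .
  obtain d where d: "d > 0" "\<And>x. min s R \<le> x \<Longrightarrow> x < 2 * M \<Longrightarrow> x \<noteq> R \<Longrightarrow>
    d * (1 / \<bar>x - R\<bar>) \<le> \<bar>f4_integrand M H (C_max M H) x\<bar>"
    using f4_integrand_double_zero[OF assms(1,2), of "min s R"] R assms(3) unfolding R_def by auto
  have "set_integrable lborel {min s R<..<max s R} (\<lambda>x. d * (1 / \<bar>x - R\<bar>))"
  proof (rule set_integrable_bound[OF int])
    show "set_borel_measurable lborel {min s R<..<max s R} (\<lambda>x. d * (1 / \<bar>x - R\<bar>))"
      unfolding set_borel_measurable_def by measurable
    show "AE x in lborel. x \<in> {min s R<..<max s R} \<longrightarrow>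
        norm (d * (1 / \<bar>x - R\<bar>)) \<le> norm (f4_integrand M H (C_max M H) x)"
    proof (intro AE_I2 impI)
      fix x assume x: "x \<in> {min s R<..<max s R}"
      then have "d * (1 / \<bar>x - R\<bar>) \<le> \<bar>f4_integrand M H (C_max M H) x\<bar>"
        using d(2)[of x] R assms(3) by (auto simp: min_def max_def split: if_splits)
      moreover have "norm (d * (1 / \<bar>x - R\<bar>)) = d * (1 / \<bar>x - R\<bar>)" using d(1) by simp
      ultimately show "norm (d * (1 / \<bar>x - R\<bar>)) \<le> norm (f4_integrand M H (C_max M H) x)"
        unfolding real_norm_def by linarith
    qed
  qed
  from set_integrable_mult_right[OF this, of "1 / d"]
  have 1: "set_integrable lborel {min s R<..<max s R} (\<lambda>x. 1 / \<bar>x - R\<bar>)"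
    using d(1) by simp
  show False
  proof (cases "s < R")
    case True
    have "set_integrable lborel {s<..<R} (\<lambda>x. 1 / (R - x))"
      using 1 True by (subst set_integrable_cong[where f' = "\<lambda>x. 1 / \<bar>x - R\<bar>"]) (auto simp: abs_if)
    then show False using not_integrable_simple_pole_left[OF True] by blast
  next
    case False
    then have sR: "R < s" using assms(4) by (simp add: R_def)
    have "set_integrable lborel {R<..<s} (\<lambda>x. 1 / (x - R))"
      using 1 sR by (subst set_integrable_cong[where f' = "\<lambda>x. 1 / \<bar>x - R\<bar>"]) (auto simp: abs_if)
    then show False using not_integrable_simple_pole_right[OF sR] by blast
  qed
qed

lemma f4_domI: "0 < r \<Longrightarrow> r < 2 * M \<Longrightarrow> ktilde M H r < c \<Longrightarrow> r \<in> f4_dom M H c"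
  unfolding f4_dom_def by simp

lemma f4_domD: "r \<in> f4_dom M H c \<Longrightarrow> ktilde M H r \<le> c"
  unfolding f4_dom_def mem_Collect_eq by (elim conjE disjE) simp_all

lemma Sigma4_dom_supercritical:
  assumes "M > 0" "c > C_max M H"
  shows "Sigma4_dom M H c = {0<..<2*M}"
proof -
  have "ktilde M H r < c" if "0 < r" "r < 2 * M" for r
    using ktilde_less_C_max[OF assms(1) that, of H] assms(2) by (cases "r = R_max M H") (auto simp: C_max_def)
  then have sub: "{r..<2*M} \<subseteq> f4_dom M H c" if "0 < r" for r using that by (auto intro: f4_domI)
  show ?thesis
  proof (intro equalityI subsetI)
    fix r assume "r \<in> Sigma4_dom M H c"
    then show "r \<in> {0<..<2*M}" unfolding Sigma4_dom_def by simp
  next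
    fix r assume "r \<in> {0<..<2*M}"
    then show "r \<in> Sigma4_dom M H c" unfolding Sigma4_dom_def using sub[of r] by simp
  qed
qed

lemma Sigma4_dom_critical:
  assumes "M > 0" "- 8 * M^3 * H < C_max M H"
  shows "Sigma4_dom M H (C_max M H) = {R_max M H<..<2*M}"
proof -
  let ?R = "R_max M H" and ?D = "f4_dom M H (C_max M H)"
  have R: "0 < ?R" "?R < 2 * M" using R_max_in[OF assms(1), of H] by auto
  have "?R \<notin> ?D"
    using f4_not_integrable[OF assms] unfolding f4_dom_def C_max_def by auto
  then have "\<not> {r..<2*M} \<subseteq> ?D" if "r \<le> ?R" for r using that R by auto
  moreover have "{r..<2*M} \<subseteq> ?D" if "?R < r" for r
  proof
    fix x assume "x \<in> {r..<2*M}"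
    then show "x \<in> ?D" using ktilde_less_C_max[OF assms(1), of x H] that R by (intro f4_domI) auto
  qed
  ultimately have "{r..<2*M} \<subseteq> ?D \<longleftrightarrow> ?R < r" for r by (cases "?R < r") auto
  then show ?thesis using R unfolding Sigma4_dom_def by auto
qed

text \<open>To the right of \<open>R_max\<close> the function \<open>ktilde\<close> decreases
  through the value c at r, so points just below r are outside the domain; r itself is inside by
  integrability on one interval to its right.\<close>

lemma Sigma4_dom_subcritical:
  assumes "M > 0" "R_max M H < r" "r < 2 * M" "ktilde M H r = c"
    and "s \<in> {r<..<2*M}" "set_integrable lborel {r<..<s} (f4_integrand M H c)"
  shows "Sigma4_dom M H c = {r..<2*M}" "r_turn M H c = r"
proof -
  define R where "R = R_max M H"
  have R: "0 < R" "R < r" using R_max_in[OF assms(1), of H] assms(2) by (auto simp: R_def)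
  have less: "ktilde M H x < c" if "r < x" "x < 2 * M" for x
    using ktilde_decreasing[OF assms(1), of H r x] that assms by simp
  have "\<forall>x\<in>closed_segment s r - {r}. ktilde M H x < c"
    using less assms(5) by (auto simp: closed_segment_eq_real_ivl)
  then have "r \<in> f4_dom M H c"
    unfolding f4_dom_def interval_integrable_min_max using R assms
    by (auto simp: max_def min_def intro!: bexI[of _ s])
  moreover have "x \<notin> f4_dom M H c" if "R \<le> x" "x < r" for x
    using ktilde_decreasing[OF assms(1), of H x r] that assms f4_domD[of x M H c] by (auto simp: R_def)
  moreover have "x \<in> f4_dom M H c" if "r < x" "x < 2 * M" for x
    using less that R by (intro f4_domI) auto
  ultimately have dom_iff: "x \<in> f4_dom M H c \<longleftrightarrow> r \<le> x" if "R \<le> x" "x < 2 * M" for x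
    using that by (cases x r rule: linorder_cases) auto
  have sub_iff: "{x..<2*M} \<subseteq> f4_dom M H c \<longleftrightarrow> r \<le> x" if "0 < x" "x < 2 * M" for x
  proof
    assume "r \<le> x"
    then show "{x..<2*M} \<subseteq> f4_dom M H c" using dom_iff R by auto
  next
    assume "{x..<2*M} \<subseteq> f4_dom M H c"
    \<comment> \<open>To the left of \<open>R_max\<close> the value of \<open>ktilde\<close> can
      drop below c again, on another component of the domain; the point max x R stays in the range
      of \<open>dom_iff\<close>.\<close>
    then have "max x R \<in> f4_dom M H c" using that R assms(3) by auto
    then have "r \<le> max x R" using dom_iff that R assms(3) by simp
    then show "r \<le> x" using R by (auto simp: max_def split: if_splits)
  qed
  show dom: "Sigma4_dom M H c = {r..<2*M}"
  proof (intro equalityI subsetI)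
    fix x assume "x \<in> Sigma4_dom M H c"
    then show "x \<in> {r..<2*M}" unfolding Sigma4_dom_def using sub_iff[of x] by simp
  next
    fix x assume "x \<in> {r..<2*M}"
    then show "x \<in> Sigma4_dom M H c" unfolding Sigma4_dom_def using sub_iff[of x] R by simp
  qed
  show "r_turn M H c = r"
    unfolding r_turn_def
  proof (rule the_equality)
    fix r' assume "Sigma4_dom M H c = {r'..<2*M} \<and> r' \<in> {0<..<2*M} \<and> ktilde M H r' = c"
    then have "{r'..<2*M} = {r..<2*M}" "r' < 2 * M" using dom by auto
    then show "r' = r" using assms(3) by (metis atLeastLessThan_eq_iff)
  qed (use dom R assms in auto)
qed

section \<open>The time coordinate as an integral\<close>

lemma continuous_on_time_integrand:
  assumes "\<And>x. x \<in> S \<Longrightarrow> 0 < x \<and> schw_h M x \<noteq> 0 \<and> Wfun M H c x > 0"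
  shows "continuous_on S (\<lambda>x. kfun H c x / (schw_h M x * sqrt (Wfun M H c x)))"
proof (intro continuous_at_imp_continuous_on ballI)
  fix x assume "x \<in> S"
  then have x: "0 < x" "schw_h M x \<noteq> 0" "Wfun M H c x > 0" using assms by auto
  have "isCont (schw_h M) x" unfolding schw_h_def[abs_def] using x by (intro continuous_intros) auto
  then show "isCont (\<lambda>x. kfun H c x / (schw_h M x * sqrt (Wfun M H c x))) x"
    using x DERIV_isCont[OF DERIV_kfun[OF x(1)]] DERIV_isCont[OF DERIV_Wfun[OF x(1)]]
    by (intro isCont_divide isCont_mult isCont_o2[OF _ isCont_real_sqrt]) auto
qed

lemma LBINT_time_integrand:
  fixes u v :: real
  assumes "{min u v..max u v} \<subseteq> S"
    and "\<And>x. x \<in> S \<Longrightarrow> 0 < x \<and> schw_h M x \<noteq> 0 \<and> Wfun M H c x > 0"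
    and g: "\<And>x. x \<in> S \<Longrightarrow> g x = kfun H c x / (schw_h M x * sqrt (Wfun M H c x))"
    and F: "\<And>x. x \<in> S \<Longrightarrow> (F has_real_derivative kfun H c x / (schw_h M x * sqrt (Wfun M H c x))) (at x)"
  shows "(LBINT x=ereal u..ereal v. g x) = F v - F u"
proof (rule interval_integral_FTC_finite)
  have "continuous_on S g"
    using continuous_on_time_integrand[OF assms(2)] g by (simp cong: continuous_on_cong)
  then show "continuous_on {min u v..max u v} g" by (rule continuous_on_subset[OF _ assms(1)])
  fix x assume "min u v \<le> x" "x \<le> max u v"
  then have "x \<in> S" using assms(1) by auto
  from F[OF this] g[OF this] show "(F has_vector_derivative g x) (at x within {min u v..max u v})"
    by (simp add: has_real_derivative_iff_has_vector_derivative has_vector_derivative_at_within)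
qed

lemma outside_positive:
  "M > 0 \<Longrightarrow> 2 * M < x \<Longrightarrow> 0 < x \<and> schw_h M x \<noteq> 0 \<and> Wfun M H c x > 0"
proof -
  assume "M > 0" "2 * M < x"
  then have "schw_h M x > 0" by (simp add: schw_h_def)
  then show ?thesis using \<open>M > 0\<close> \<open>2 * M < x\<close> by (simp add: Wfun_def add_pos_nonneg)
qed

lemma f1_eq:
  assumes "M > 0" "r\<^sub>1 > 2 * M" "x > 2 * M"
    and F: "\<And>x. x > 2 * M \<Longrightarrow> (F has_real_derivative kfun H c x / (schw_h M x * sqrt (Wfun M H c x))) (at x)"
  shows "f1 M H c r\<^sub>1 cb x = F x - F r\<^sub>1 + cb"
proof -
  have "(LBINT x=ereal r\<^sub>1..ereal x. l1 M H c x / schw_h M x * (1 / sqrt (1 + (l1 M H c x)\<^sup>2))) = F x - F r\<^sub>1"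
    by (rule LBINT_time_integrand[where S = "{2*M<..}" and H = H and c = c and M = M])
      (use assms outside_positive f1_integrand_eq in auto)
  then show ?thesis by (simp add: f1_def)
qed

lemma f3_eq:
  assumes "M > 0" "r\<^sub>3 > 2 * M" "x > 2 * M"
    and F: "\<And>x. x > 2 * M \<Longrightarrow> (F has_real_derivative - (kfun H c x / (schw_h M x * sqrt (Wfun M H c x)))) (at x)"
  shows "f3 M H c r\<^sub>3 cb x = F x - F r\<^sub>3 + cb"
proof -
  let ?g = "\<lambda>x. l1 M H c x / schw_h M x * (1 / sqrt (1 + (l1 M H c x)\<^sup>2))"
  have "((\<lambda>x. - F x) has_real_derivative kfun H c x / (schw_h M x * sqrt (Wfun M H c x))) (at x)"
    if "x > 2 * M" for x
    using DERIV_minus[OF F[OF that]] by simp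
  then have "(LBINT x=ereal r\<^sub>3..ereal x. ?g x) = - F x - - F r\<^sub>3"
    by (intro LBINT_time_integrand[where S = "{2*M<..}" and H = H and c = c and M = M])
      (use assms outside_positive f1_integrand_eq in auto)
  moreover have "(LBINT x=ereal r\<^sub>3..ereal x. l3 M H c x / schw_h M x * (1 / sqrt (1 + (l3 M H c x)\<^sup>2)))
      = (LBINT x=ereal r\<^sub>3..ereal x. - ?g x)"
    by (simp add: l3_def)
  ultimately show ?thesis unfolding f3_def by (simp only: interval_lebesgue_integral_uminus)
qed

lemma inside_positive:
  assumes "M > 0" "c > - 8 * M^3 * H" "0 < x" "x < 2 * M" "ktilde M H x < c"
  shows "0 < x \<and> schw_h M x \<noteq> 0 \<and> Wfun M H c x > 0"
  using Wfun_pos[of M H c x] assms by (simp add: schw_h_def)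

lemma f4_star2_eq:
  assumes "M > 0" "c > - 8 * M^3 * H" "lo \<ge> 0" "s \<in> {lo<..<2*M}" "x \<in> {lo<..<2*M}"
    and kt: "\<And>x. lo < x \<Longrightarrow> x < 2 * M \<Longrightarrow> ktilde M H x < c"
    and F: "\<And>x. lo < x \<Longrightarrow> x < 2 * M \<Longrightarrow>
      (F has_real_derivative kfun H c x / (schw_h M x * sqrt (Wfun M H c x))) (at x)"
  shows "f4_star2 M H c s cb x = F x - F s + cb"
proof -
  have "(LBINT x=ereal s..ereal x. f4_integrand M H c x) = F x - F s"
    by (rule LBINT_time_integrand[where S = "{lo<..<2*M}" and H = H and c = c and M = M])
      (use assms inside_positive f4_integrand_eq in auto)
  then show ?thesis by (simp add: f4_star2_def)
qed

text \<open>Here k > 0 and h < 0, so minus the integrand is nonnegative and the fundamental theorem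
  for improper integrals applies to it. From the mere limit of F at lo it yields both the
  integrability that \<open>f4_dom\<close> asks for and the value of the integral.\<close>

lemma f4_improper:
  assumes "M > 0" "c > - 8 * M^3 * H" "0 < lo" "x \<in> {lo<..<2*M}"
    and kt: "\<And>x. lo < x \<Longrightarrow> x < 2 * M \<Longrightarrow> ktilde M H x < c"
    and F: "\<And>x. lo < x \<Longrightarrow> x < 2 * M \<Longrightarrow>
      (F has_real_derivative kfun H c x / (schw_h M x * sqrt (Wfun M H c x))) (at x)"
    and lim: "(F \<longlongrightarrow> F0) (at_right lo)"
  shows "set_integrable lborel {lo<..<x} (f4_integrand M H c)"
    and "(LBINT x=ereal lo..ereal x. f4_integrand M H c x) = F x - F0"
proof -
  let ?g = "\<lambda>x. - f4_integrand M H c x"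
  have eq: "f4_integrand M H c y = kfun H c y / (schw_h M y * sqrt (Wfun M H c y))" if "lo < y" "y < 2 * M" for y
    using f4_integrand_eq kt that assms by force
  have cont: "continuous_on {lo<..<2*M} (f4_integrand M H c)"
  proof (rule continuous_on_eq[OF continuous_on_time_integrand])
    show "0 < y \<and> schw_h M y \<noteq> 0 \<and> Wfun M H c y > 0" if "y \<in> {lo<..<2*M}" for y
      by (rule inside_positive[OF assms(1,2)]) (use kt assms(3) that in auto)
  qed (use eq in auto)
  have x: "lo < x" "x < 2 * M" using assms(4) by auto
  have 1: "ereal lo < ereal x" using x by simp
  have 2: "((\<lambda>x. - F x) has_real_derivative ?g y) (at y)" if "ereal lo < ereal y" "ereal y < ereal x" for y
    using DERIV_minus[OF F[of y]] eq[of y] that x by simp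
  have 3: "isCont ?g y" if "ereal lo < ereal y" "ereal y < ereal x" for y
    using cont that x by (intro isCont_minus) (simp add: continuous_on_eq_continuous_at)
  have 4: "AE y in lborel. ereal lo < ereal y \<longrightarrow> ereal y < ereal x \<longrightarrow> 0 \<le> ?g y"
  proof (intro AE_I2 impI)
    fix y assume "ereal lo < ereal y" "ereal y < ereal x"
    then have y: "lo < y" "y < 2 * M" using x by auto
    have "kfun H c y > 0" using kfun_pos_inside(1)[of y M H c] kt[OF y] y assms(3) by simp
    moreover have "Wfun M H c y > 0" using inside_positive[OF assms(1,2), of y] kt[OF y] y assms(3) by simp
    moreover have "schw_h M y < 0" using y assms(3) by (simp add: schw_h_def)
    ultimately have "kfun H c y / (schw_h M y * sqrt (Wfun M H c y)) < 0"
      by (intro divide_pos_neg mult_neg_pos) auto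
    then show "0 \<le> ?g y" using eq[OF y] by simp
  qed
  have 5: "(((\<lambda>x. - F x) \<circ> real_of_ereal) \<longlongrightarrow> - F0) (at_right (ereal lo))"
    unfolding ereal_tendsto_simps using tendsto_minus[OF lim] by (simp add: o_def)
  have "isCont F x" by (rule DERIV_isCont[OF F[OF x]])
  then have 6: "(((\<lambda>x. - F x) \<circ> real_of_ereal) \<longlongrightarrow> - F x) (at_left (ereal x))"
    unfolding ereal_tendsto_simps
    by (intro tendsto_minus) (simp add: isCont_def filterlim_at_split)
  note int = interval_integral_FTC_nonneg[OF 1 2 3 4 5 6]
  have "einterval (ereal lo) (ereal x) = {lo<..<x}" by (auto simp: einterval_def)
  then have "set_integrable lborel {lo<..<x} ?g" using int(1) by simp
  from set_integrable_mult_right[OF this, of "-1"]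
  show "set_integrable lborel {lo<..<x} (f4_integrand M H c)" by simp
  show "(LBINT x=ereal lo..ereal x. f4_integrand M H c x) = F x - F0"
    using int(2) unfolding interval_lebesgue_integral_uminus by simp
qed

text \<open>The condition p > |k| makes U and V positive at the chosen point, and the free constant
  factor of n moves t there over all real values.\<close>

lemma (in profile_data) exists_normalised:
  assumes I_eq: "I = einterval lo \<infinity>" and y: "y\<^sub>1 \<in> I" "p y\<^sub>1 > \<bar>kfun H c (r y\<^sub>1)\<bar>"
  obtains n where "profile M H c I r a p n" "profile.\<tau> M H c r p n y\<^sub>1 = cb"
proof -
  define b where "b y = ((1 / r y + 1 / (2 * M)) * (p y - kfun H c (r y)) / 2 - (H - 2 * c / (r y)^3)) / a y" for y
  have "isCont b y" if "y \<in> I" for y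
  proof -
    have "isCont r y" "isCont a y" "isCont p y"
      using smooth[THEN smooth1_imp_continuous_on] I(1) that by (auto simp: continuous_on_eq_continuous_at)
    then show ?thesis
      unfolding b_def kfun_def using r_pos[OF that] a_pos[OF that] M by (intro continuous_intros) auto
  qed
  moreover have "lo < \<infinity>" using y(1) I_eq by (auto simp: einterval_def)
  ultimately obtain B where B: "\<And>y. y \<in> I \<Longrightarrow> (B has_vector_derivative b y) (at y)"
    using einterval_antiderivative[of lo \<infinity> b] unfolding I_eq einterval_def by auto
  \<comment> \<open>With n = N at the chosen point, V / U equals Q / N^2; setting 2M ln (V / U) = cb
    gives the value of N.\<close>
  define Q where "Q = (p y\<^sub>1 - kfun H c (r y\<^sub>1)) / (p y\<^sub>1 + kfun H c (r y\<^sub>1)) * (Pk M (r y\<^sub>1) / (8 * M))"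
  define N where "N = sqrt (Q * exp (- cb / (2 * M)))"
  have pk: "p y\<^sub>1 - kfun H c (r y\<^sub>1) > 0" "p y\<^sub>1 + kfun H c (r y\<^sub>1) > 0" using y(2) by auto
  have Q: "Q > 0" using pk Pk_pos[OF M r_pos[OF y(1)]] M by (simp add: Q_def)
  have N: "N > 0" "N\<^sup>2 = Q * exp (- cb / (2 * M))" using Q by (simp_all add: N_def)
  define n where "n y = N * exp (B y - B y\<^sub>1)" for y
  have "(n has_real_derivative b y * n y) (at y)" if "y \<in> I" for y
  proof -
    have "(B has_real_derivative b y) (at y)"
      using B[OF that] by (simp add: has_real_derivative_iff_has_vector_derivative)
    then have "((\<lambda>y. B y - B y\<^sub>1) has_real_derivative b y - 0) (at y)"
      by (intro DERIV_diff DERIV_const)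
    from DERIV_cmult[OF DERIV_chain2[OF DERIV_exp this], of N] show ?thesis
      unfolding n_def[abs_def] by (simp add: mult_ac)
  qed
  then interpret P: profile M H c I r a p n
    by unfold_locales (use N in \<open>auto simp: b_def n_def\<close>)
  have "P.V y\<^sub>1 / P.U y\<^sub>1 = Q / N\<^sup>2"
  proof -
    have "4 * M * x * (z / (8 * M * N)) / (4 * M * y * N) = x / y * (z / (8 * M)) / N\<^sup>2" if "y > 0" for x y z
      using M N(1) that by (simp add: power2_eq_square)
    from this[OF pk(2)] show ?thesis
      unfolding P.V_def P.U_def P.k_def P.m_def Q_def n_def by simp
  qed
  also have "\<dots> = exp (cb / (2 * M))" using Q by (simp add: N(2) exp_minus field_simps)
  finally have "P.\<tau> y\<^sub>1 = cb" using M by (simp add: P.\<tau>_def kruskal_t_def)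
  with that[of n] P.profile_axioms show ?thesis by blast
qed

section \<open>The signs of U and V according to the radius\<close>

context profile
begin

lemma U_pos_iff: "y \<in> I \<Longrightarrow> U y > 0 \<longleftrightarrow> p y + k y > 0"
  and U_neg_iff: "y \<in> I \<Longrightarrow> U y < 0 \<longleftrightarrow> p y + k y < 0"
  using n_pos[of y] M by (auto simp: U_def zero_less_mult_iff mult_less_0_iff)

lemma V_pos_iff: "y \<in> I \<Longrightarrow> V y > 0 \<longleftrightarrow> p y > k y"
  and V_neg_iff: "y \<in> I \<Longrightarrow> V y < 0 \<longleftrightarrow> p y < k y"
  using m_pos[of y] M by (auto simp: V_def zero_less_mult_iff mult_less_0_iff)

lemma p_outside: assumes "y \<in> I" "r y > 2 * M" shows "\<bar>k y\<bar> < \<bar>p y\<bar>"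
proof -
  have "schw_h M (r y) > 0" using assms M by (simp add: schw_h_def)
  then have "(k y)\<^sup>2 < (p y)\<^sup>2" using p2_k2[OF assms(1)] by simp
  then show ?thesis by (simp add: abs_less_iff power2_less_imp_less abs_le_square_iff flip: not_le)
qed

lemma p_inside: assumes "y \<in> I" "r y < 2 * M" shows "\<bar>p y\<bar> < \<bar>k y\<bar>"
proof -
  have "schw_h M (r y) < 0" using assms r_pos[OF assms(1)] by (simp add: schw_h_def)
  then have "(p y)\<^sup>2 < (k y)\<^sup>2" using p2_k2[OF assms(1)] by simp
  then show ?thesis by (simp add: abs_le_square_iff flip: not_le)
qed

lemma p_horizon: assumes "y \<in> I" "r y = 2 * M" shows "\<bar>p y\<bar> = \<bar>k y\<bar>"
proof -
  have "schw_h M (r y) = 0" using assms M by (simp add: schw_h_def)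
  then have "(p y)\<^sup>2 = (k y)\<^sup>2" using p2_k2[OF assms(1)] by simp
  then show ?thesis by (simp add: power2_eq_iff abs_eq_iff)
qed

end

section \<open>The case \<open>c \<ge> C_max\<close>\<close>

text \<open>At a double zero of \<open>Wfun\<close> the curve needs infinite length to reach \<open>R_max\<close>, while
  \<open>ln U\<close> changes at a rate bounded below, so the curve escapes to \<open>U = 0\<close>, \<open>V = - \<infinity>\<close>.\<close>

lemma (in profile) critical_escape:
  assumes c: "c = C_max M H" and lo: "I = {R_max M H<..}" and par: "\<And>y. r y = y" "\<And>y. a y = p y"
    and p: "\<And>y. p y = sqrt (Wfun M H c y)"
    and pk: "\<And>y. R_max M H < y \<Longrightarrow> y < 2 * M \<Longrightarrow> p y > 0 \<and> k y > 0"
    and ys: "\<And>i. ys i \<in> I" "ys \<longlonglongrightarrow> R_max M H" "(\<lambda>i. U (ys i)) \<longlonglongrightarrow> u"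
  shows "u \<le> 0"
proof -
  define R where "R = R_max M H"
  have R: "0 < R" "R < 2 * M" using R_max_in[OF M, of H] by (auto simp: R_def)
  obtain B where B: "B > 0" "\<And>x. 0 < x \<Longrightarrow> x \<le> 2 * M \<Longrightarrow>
      sqrt (Wfun M H (C_max M H) x) \<le> B * \<bar>x - R_max M H\<bar> / x\<^sup>2"
    by (rule Wfun_double_zero[OF M, where H = H]) blast
  define K where "K = B * (2 * M) / R\<^sup>2 + (\<bar>H\<bar> * (2 * M) + \<bar>c\<bar> / R\<^sup>2)"
  have K: "K > 0" using B(1) M R by (auto simp: K_def intro!: add_pos_nonneg)
  \<comment> \<open>K bounds p + k on (R, 2M), and p is at most (B / R^2) (y - R). Since ln U has
    derivative 1 / (4 M p (p + k)), that derivative is at least d / (y - R).\<close>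
  define d where "d = 1 / (4 * M * (B / R\<^sup>2) * K)"
  have d: "d > 0" using B(1) M R K by (simp add: d_def)
  have rate: "d / (y - R) \<le> 1 / (4 * M * (p y * (p y + k y)))" if y: "R < y" "y < 2 * M" for y
  proof -
    have pos: "p y > 0" "k y > 0" using pk y by (auto simp: R_def)
    have "p y \<le> B * (y - R) / y\<^sup>2" using B(2)[of y] y R by (simp add: p c R_def)
    also have "\<dots> \<le> B * (y - R) / R\<^sup>2" using y R B(1) by (intro divide_left_mono power_mono) auto
    finally have p1: "p y \<le> B / R\<^sup>2 * (y - R)" by simp
    also have "\<dots> \<le> B / R\<^sup>2 * (2 * M)" using y R B(1) by (intro mult_left_mono) auto
    finally have p2: "p y \<le> B * (2 * M) / R\<^sup>2" by simp
    have "H * y \<le> \<bar>H\<bar> * (2 * M)" using y R by (intro mult_mono) auto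
    moreover have "c / y\<^sup>2 \<le> \<bar>c\<bar> / R\<^sup>2" using y R by (intro frac_le power_mono) auto
    ultimately have "p y + k y \<le> K" using p2 by (simp add: K_def k_def kfun_def par)
    with p1 have "p y * (p y + k y) \<le> B / R\<^sup>2 * (y - R) * K"
      using pos B(1) y by (intro mult_mono) auto
    then have "4 * M * (p y * (p y + k y)) \<le> 4 * M * (B / R\<^sup>2 * (y - R) * K)"
      by (rule mult_left_mono) (use M in simp)
    then have "1 / (4 * M * (B / R\<^sup>2 * (y - R) * K)) \<le> 1 / (4 * M * (p y * (p y + k y)))"
      using pos M B(1) K y R
      by (intro divide_left_mono mult_pos_pos divide_pos_pos add_pos_pos) auto
    moreover have "1 / (4 * M * (B / R\<^sup>2 * (y - R) * K)) = d / (y - R)"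
      by (simp add: d_def)
    ultimately show ?thesis by simp
  qed
  define z where "z = (R + 2 * M) / 2"
  have z: "R < z" "z < 2 * M" using R by (auto simp: z_def field_simps)
  \<comment> \<open>By \<open>rate\<close>, ln U grows at least as fast as d ln (y - R). So g is
    nondecreasing up to z, and U is at most a constant times (y - R)^d, which tends to 0 at
    R.\<close>
  define g where "g y = ln (U y) - d * ln (y - R)" for y
  have U0: "U y > 0" if "R < y" "y < 2 * M" for y
    using pk[of y] that U_pos_iff[of y] lo by (auto simp: R_def)
  have gmono: "g y \<le> g z" if "R < y" "y \<le> z" for y
  proof (rule DERIV_nonneg_imp_nondecreasing[OF that(2)])
    fix x assume "y \<le> x" "x \<le> z"
    then have x: "R < x" "x < 2 * M" "x \<in> I" using that z lo by (auto simp: R_def)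
    have pos: "p x > 0" "k x > 0" "n x > 0" using pk x n_pos by (auto simp: R_def)
    have "(g has_real_derivative 1 / U x * (n x / a x) - d * (1 / (x - R) * (1 - 0))) (at x)"
      unfolding g_def using U0[OF x(1,2)] x
      by (intro DERIV_diff DERIV_cmult DERIV_chain2[OF DERIV_ln_divide] DERIV_U DERIV_ident DERIV_const) auto
    moreover have "1 / U x * (n x / a x) = 1 / (4 * M * (p x * (p x + k x)))"
      using pos M by (simp add: U_def par)
    ultimately show "\<exists>D. (g has_real_derivative D) (at x) \<and> 0 \<le> D"
      using rate[OF x(1,2)] by (intro exI conjI) auto
  qed
  have bound: "U y \<le> exp (g z) * (y - R) powr d" if "R < y" "y \<le> z" for y
  proof -
    have "ln (U y) \<le> g z + d * ln (y - R)" using gmono[OF that] by (simp add: g_def)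
    then have "exp (ln (U y)) \<le> exp (g z + d * ln (y - R))" by simp
    then show ?thesis using U0[of y] that z by (simp add: exp_add powr_def)
  qed
  have lim: "(\<lambda>i. ys i - R) \<longlonglongrightarrow> 0"
    using tendsto_diff[OF ys(2) tendsto_const[of R]] by (simp add: R_def)
  have ysR: "ys i > R" for i using ys(1)[of i] lo by (simp add: R_def)
  have "(\<lambda>i. exp (g z) * (ys i - R) powr d) \<longlonglongrightarrow> exp (g z) * 0 powr d"
    by (intro tendsto_mult tendsto_const tendsto_powr'[OF lim])
      (use d ysR in \<open>auto intro!: always_eventually simp: less_imp_le\<close>)
  then have "(\<lambda>i. exp (g z) * (ys i - R) powr d) \<longlonglongrightarrow> 0" by simp
  moreover have "\<forall>\<^sub>F i in sequentially. U (ys i) \<le> exp (g z) * (ys i - R) powr d"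
  proof -
    have "\<forall>\<^sub>F i in sequentially. ys i < z"
      using order_tendstoD(2)[OF ys(2)] z(1) by (simp add: R_def)
    then show ?thesis by eventually_elim (use bound ysR in \<open>auto intro: less_imp_le\<close>)
  qed
  ultimately show "u \<le> 0" using tendsto_le[OF sequentially_bot _ ys(3)] by blast
qed

text \<open>As W > 0 for all r > lo, the radius never turns and serves as the parameter, with speed
  p. The endpoint lo is 0 for c > C_max and \<open>R_max\<close> for c = C_max; these cases differ
  only in why the curve is closed.\<close>

lemma outer_case:
  assumes M: "M > 0" and c: "c > - 8 * M^3 * H" and r1: "r\<^sub>1 > 2 * M"
    and lo: "0 \<le> lo" "lo < 2 * M" "lo > 0 \<Longrightarrow> c = C_max M H \<and> lo = R_max M H"
    and kt: "\<And>x. lo < x \<Longrightarrow> x < 2 * M \<Longrightarrow> ktilde M H x < c"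
    and r4: "r\<^sub>4 \<in> {lo<..<2*M}"
  obtains cb\<^sub>4 where "let S1 = Sigma1 M H c r\<^sub>1 cb\<^sub>1;
      S4 = graph_over M (region_II' M) {lo<..<2*M} (f4_star2 M H c r\<^sub>4 cb\<^sub>4);
      S14 = join (region_I M) (region_II' M) S1 S4
    in connects_smoothly M (region_I M) (region_II' M) S1 S4 \<and>
      complete_hypersurface M S14 \<and> ss_cmc M H S14 \<and> has_ends S14 2"
proof -
  define p where "p y = sqrt (Wfun M H c y)" for y
  define I where "I = {lo<..}"
  have W: "Wfun M H c y > 0" if "y \<in> I" for y
    by (rule Wfun_pos[OF M c]) (use kt that lo in \<open>auto simp: I_def\<close>)
  have y0: "y > 0" if "y \<in> I" for y using that lo by (auto simp: I_def)
  have pp: "p y > 0" if "y \<in> I" for y using W[OF that] by (simp add: p_def)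
  interpret D: profile_data M H c I "\<lambda>y. y" p p
  proof
    show "open I" "connected I" "I \<noteq> {}" by (auto simp: I_def)
    have "smooth1 I (Wfun M H c)"
      unfolding Wfun_def[abs_def] schw_h_def kfun_def
      by (intro smooth1_add smooth1_diff smooth1_power smooth1_mult smooth1_const smooth1_divide smooth1_ident)
        (use y0 in \<open>force simp: I_def\<close>)+
    then show "smooth1 I p"
      unfolding p_def[abs_def] by (intro smooth1_sqrt; use W in \<open>simp add: I_def\<close>)
    fix y assume y: "y \<in> I"
    show "((\<lambda>y. y) has_real_derivative p y / p y) (at y)" using pp[OF y] by simp
    show "(p has_real_derivative (kfun H c y * (H - 2 * c / y^3) + M / y\<^sup>2) / p y) (at y)"
    proof -
      have "(p has_real_derivative inverse (sqrt (Wfun M H c y)) / 2 *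
          (2 * (kfun H c y * (H - 2 * c / y^3) + M / y\<^sup>2))) (at y)"
        unfolding p_def[abs_def]
        by (rule DERIV_chain2[OF DERIV_real_sqrt[OF W[OF y]] DERIV_Wfun[OF y0[OF y]]])
      moreover have "inverse s / 2 * (2 * X) = X / s" for s X :: real by (simp add: field_simps)
      ultimately show ?thesis by (simp only: p_def)
    qed
    show "(p y)\<^sup>2 = Wfun M H c y" using W[OF y] by (simp add: p_def)
  qed (use M y0 pp smooth1_ident in auto)
  have I_eq: "I = einterval (ereal lo) \<infinity>" by (auto simp: I_def einterval_def)
  have r1I: "r\<^sub>1 \<in> I" using r1 lo by (simp add: I_def)
  have "schw_h M r\<^sub>1 > 0" using r1 M by (simp add: schw_h_def)
  then have "\<bar>kfun H c r\<^sub>1\<bar> < p r\<^sub>1"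
    unfolding p_def by (intro real_less_rsqrt) (simp add: Wfun_def)
  then obtain n where n: "profile M H c I (\<lambda>y. y) p p n" "profile.\<tau> M H c (\<lambda>y. y) p n r\<^sub>1 = cb\<^sub>1"
    using D.exists_normalised[OF I_eq r1I] by blast
  interpret P: profile M H c I "\<lambda>y. y" p p n by (rule n(1))
  have k: "P.k = kfun H c" by (simp add: P.k_def fun_eq_iff)
  have k_in: "kfun H c y > 0" if "lo < y" "y < 2 * M" for y
    using kfun_pos_inside(1)[of y M H c] kt[OF that] that lo by simp
  have out: "P.U y > 0" "P.V y > 0" if "y > 2 * M" for y
  proof -
    have y: "y \<in> I" using that lo by (simp add: I_def)
    have "\<bar>P.k y\<bar> < p y" using P.p_outside[OF y that] pp[OF y] by simp
    then show "P.U y > 0" "P.V y > 0" using P.U_pos_iff[OF y] P.V_pos_iff[OF y] by auto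
  qed
  have inn: "P.U y > 0" "P.V y < 0" if "lo < y" "y < 2 * M" for y
  proof -
    have y: "y \<in> I" using that by (simp add: I_def)
    have "p y < P.k y" using P.p_inside[OF y that(2)] pp[OF y] k_in[OF that] by (simp add: k)
    then show "P.U y > 0" "P.V y < 0" using P.U_pos_iff[OF y] P.V_neg_iff[OF y] pp[OF y] by auto
  qed
  have hor: "2 * M \<in> I" "P.U (2 * M) > 0" "P.V (2 * M) = 0"
  proof -
    show y: "2 * M \<in> I" using lo by (simp add: I_def)
    have "p (2 * M) = P.k (2 * M)"
      using P.p_horizon[OF y refl] pp[OF y] kfun_pos_horizon[OF M c] by (simp add: k)
    then show "P.U (2 * M) > 0" "P.V (2 * M) = 0"
      using P.U_pos_iff[OF y] pp[OF y] by (auto simp: P.V_def)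
  qed
  have d\<tau>: "(P.\<tau> has_real_derivative kfun H c y / (schw_h M y * sqrt (Wfun M H c y))) (at y)"
    if "y \<in> I" "y \<noteq> 2 * M" for y
  proof -
    have "P.U y \<noteq> 0" "P.V y \<noteq> 0"
      using out[of y] inn[of y] that by (cases "y < 2 * M"; auto simp: I_def)+
    then show ?thesis
      using P.DERIV_\<tau>[OF that(1)] by (simp add: k p_def mult.commute)
  qed
  have S1: "Sigma1 M H c r\<^sub>1 cb\<^sub>1 = P.curve {2*M<..}"
    unfolding Sigma1_def region_quadrant
  proof (rule P.graph_over_curve)
    show "P.\<tau> y = f1 M H c r\<^sub>1 cb\<^sub>1 y" if "y \<in> {2*M<..}" for y
      using f1_eq[OF M r1, of y P.\<tau> H c cb\<^sub>1] d\<tau> that n(2) lo by (simp add: I_def)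
  qed (use out lo in \<open>auto simp: I_def\<close>)
  have S4: "graph_over M (region_II' M) {lo<..<2*M} (f4_star2 M H c r\<^sub>4 (P.\<tau> r\<^sub>4)) = P.curve {lo<..<2*M}"
    unfolding region_quadrant
  proof (rule P.graph_over_curve)
    show "P.\<tau> y = f4_star2 M H c r\<^sub>4 (P.\<tau> r\<^sub>4) y" if "y \<in> {lo<..<2*M}" for y
      using f4_star2_eq[OF M c lo(1) r4 that kt, of P.\<tau> "P.\<tau> r\<^sub>4"] d\<tau> by (simp add: I_def)
  qed (use inn in \<open>auto simp: I_def\<close>)
  have closed: "closedin (top_of_set (kruskal M)) (P.curve I)"
  proof (rule P.curve_closedin)
    fix ys u v
    assume ys: "\<And>i. ys i \<in> I" "(\<lambda>i. P.U (ys i)) \<longlonglongrightarrow> u" "(\<lambda>i. P.V (ys i)) \<longlonglongrightarrow> v"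
      "u * v > - 2 * M" "ys \<longlonglongrightarrow> kruskal_r M u v"
    define \<rho> where "\<rho> = kruskal_r M u v"
    have \<rho>: "\<rho> > 0" "Gk M \<rho> = u * v"
      using kruskal_r_pos[OF M ys(4)] Gk_kruskal_r[OF M ys(4)] by (auto simp: \<rho>_def)
    have "\<rho> \<ge> lo"
      by (rule LIMSEQ_le_const[OF ys(5)[folded \<rho>_def]]) (use ys(1) in \<open>auto simp: I_def less_imp_le\<close>)
    \<comment> \<open>For lo = 0 this is the positivity of the limit radius. For lo =
      \<open>R_max\<close> the escape gives u \<le> 0 and U > 0 along the curve gives u \<ge> 0, so
      UV = 0 in the limit and the radius would be 2M.\<close>
    moreover have "\<rho> \<noteq> lo"
    proof
      assume eq: "\<rho> = lo"
      then have crit: "c = C_max M H" "lo = R_max M H" using lo(3) \<rho>(1) by auto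
      have "u \<le> 0"
      proof (rule P.critical_escape[OF crit(1), where ys = ys])
        show "I = {R_max M H<..}" by (simp add: I_def crit(2))
        show "p y = sqrt (Wfun M H c y)" for y by (rule p_def)
        show "p y > 0 \<and> P.k y > 0" if "R_max M H < y" "y < 2 * M" for y
          using pp[of y] k_in[of y] that unfolding k I_def crit(2) by simp
        show "ys i \<in> I" for i by (rule ys(1))
        show "ys \<longlonglongrightarrow> R_max M H" using ys(5) eq by (simp add: \<rho>_def crit(2))
        show "(\<lambda>i. P.U (ys i)) \<longlonglongrightarrow> u" by (rule ys(2))
      qed simp_all
      moreover have "u \<ge> 0"
      proof (rule LIMSEQ_le_const[OF ys(2)], intro exI allI impI)
        fix i
        show "0 \<le> P.U (ys i)" using inn[of "ys i"] out[of "ys i"] hor ys(1)[of i]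
          by (cases "ys i" "2 * M" rule: linorder_cases) (auto simp: I_def)
      qed
      ultimately have "Gk M \<rho> = 0" using \<rho>(2) by simp
      then show False using Gk_sgn(3)[OF M] eq lo(2) by simp
    qed
    ultimately have \<rho>I: "\<rho> \<in> I" by (simp add: I_def)
    have "(\<lambda>i. P.U (ys i)) \<longlonglongrightarrow> P.U \<rho>" "(\<lambda>i. P.V (ys i)) \<longlonglongrightarrow> P.V \<rho>"
      using isCont_tendsto_compose[OF P.isCont_U[OF \<rho>I] ys(5)[folded \<rho>_def]]
        isCont_tendsto_compose[OF P.isCont_V[OF \<rho>I] ys(5)[folded \<rho>_def]] .
    then show "\<exists>y\<in>I. u = P.U y \<and> v = P.V y"
      using LIMSEQ_unique ys(2,3) \<rho>I by blast
  qed
  have I_un: "{2*M<..} \<union> {lo<..<2*M} \<union> {2*M} = I" using lo by (auto simp: I_def)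
  have cl: "2 * M \<in> closure {2*M<..}" "2 * M \<in> closure {lo<..<2*M}" using lo by auto
  have sub: "{2*M<..} \<subseteq> I" "{lo<..<2*M} \<subseteq> I" using lo by (auto simp: I_def)
  have reg: "P.curve {2*M<..} \<subseteq> region_I M" "P.curve {lo<..<2*M} \<subseteq> region_II' M"
    unfolding region_quadrant by (rule P.curve_quadrant[OF sub(1)]; use out in simp)
      (rule P.curve_quadrant[OF sub(2)]; use inn in simp)
  have op: "open ({2*M<..} \<union> {lo<..<2*M} \<union> {2*M})" unfolding I_un by (simp add: I_def)
  note con = P.connects_I_II'[OF closed hor(1) sub cl op reg hor(3)]
  show ?thesis
    by (rule that[of "P.\<tau> r\<^sub>4"])
      (unfold Let_def S1 S4 con(2), unfold I_un,
        intro conjI con(1) P.curve_complete closed P.curve_ss_cmc P.curve_has_ends)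
qed

section \<open>The case \<open>c < C_max\<close>\<close>

lemma smooth1_poly: "smooth1 S (poly q)"
proof (induction q)
  case (pCons a q)
  then show ?case
    using smooth1_add[OF smooth1_const smooth1_mult[OF smooth1_ident pCons.IH], of a] by simp
qed (simp add: smooth1_const)

text \<open>At the turning point \<open>r\<^sub>0\<close> the function \<open>Wfun\<close> has a simple zero; with
  \<open>r = r\<^sub>0 + y\<^sup>2\<close> its square root becomes the smooth function \<open>y * sqrt w\<close>.\<close>

lemma turning_point:
  assumes M: "M > 0" and c: "c > - 8 * M^3 * H" "c < C_max M H"
  obtains r\<^sub>0 w dw where "0 < r\<^sub>0" "R_max M H < r\<^sub>0" "r\<^sub>0 < 2 * M" "ktilde M H r\<^sub>0 = c"
    "\<And>x. r\<^sub>0 < x \<Longrightarrow> x < 2 * M \<Longrightarrow> ktilde M H x < c"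
    "\<And>x. x > 0 \<Longrightarrow> Wfun M H c x = (x - r\<^sub>0) * w x" "\<And>x. r\<^sub>0 \<le> x \<Longrightarrow> w x > 0"
    "smooth1 {0<..} w" "\<And>x. x > 0 \<Longrightarrow> (w has_real_derivative dw x) (at x)"
    "\<And>x. x > 0 \<Longrightarrow> w x + (x - r\<^sub>0) * dw x = 2 * (kfun H c x * (H - 2 * c / x^3) + M / x\<^sup>2)"
proof -
  define R where "R = R_max M H"
  have R: "0 < R" "R < 2 * M" using R_max_in[OF M, of H] by (auto simp: R_def)
  have kR: "ktilde M H R > c" using c by (simp add: R_def C_max_def)
  have k2: "ktilde M H (2 * M) < c" using c M by (simp add: ktilde_eq power_mult_distrib mult_ac)
  have "continuous_on {R..2*M} (ktilde M H)"
    by (rule continuous_on_subset[OF continuous_on_ktilde]) (use R in auto)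
  then have "\<exists>x\<ge>R. x \<le> 2 * M \<and> ktilde M H x = c" using kR k2 R by (intro IVT2') auto
  then obtain r\<^sub>0 where r0: "R \<le> r\<^sub>0" "r\<^sub>0 \<le> 2 * M" "ktilde M H r\<^sub>0 = c" by auto
  then have r0: "0 < r\<^sub>0" "R < r\<^sub>0" "r\<^sub>0 < 2 * M" "ktilde M H r\<^sub>0 = c"
    using kR k2 R by (auto simp: less_le)
  have kt: "ktilde M H x < c" if "r\<^sub>0 < x" "x < 2 * M" for x
    using ktilde_decreasing[OF M, of H r\<^sub>0 x] r0 that by (simp add: R_def)
  obtain q where q: "Wpoly M H c = [:- r\<^sub>0, 1:] * q" "poly q r\<^sub>0 = poly (pderiv (Wpoly M H c)) r\<^sub>0"
    using Wpoly_root[OF r0(1,3,4)] .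
  define w where "w x = poly q x / x^4" for x
  have Ww: "Wfun M H c x = (x - r\<^sub>0) * w x" if "x > 0" for x
    using that by (simp add: Wfun_Wpoly q(1) w_def algebra_simps)
  \<comment> \<open>Beyond \<open>R_max\<close> the slope of \<open>ktilde\<close> is negative, so
    the derivative of \<open>Wpoly\<close> at its zero is positive.\<close>
  have qr: "poly q r\<^sub>0 > 0"
  proof -
    have "kt_slope M r\<^sub>0 < 3 * H"
      using kt_slope_decreasing[OF R(1) r0(2,3)] kt_slope_R_max[OF M, of H] by (simp add: R_def)
    moreover have "sqrt (r\<^sub>0^3 * (2 * M - r\<^sub>0)) > 0" using r0 by simp
    ultimately show ?thesis
      unfolding q(2) pderiv_Wpoly[OF r0(1,3,4)] using r0(1)
      by (intro mult_pos_pos) (auto simp: mult_less_0_iff)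
  qed
  have wpos: "w x > 0" if "r\<^sub>0 \<le> x" for x
  proof (cases "x = r\<^sub>0")
    case True
    then show ?thesis using qr r0 by (simp add: w_def)
  next
    case False
    then have x: "r\<^sub>0 < x" "x > 0" using that r0 by auto
    have "Wfun M H c x > 0" by (rule Wfun_pos[OF M c(1) x(2)]) (use kt x in auto)
    then show ?thesis using Ww[OF x(2)] x by (simp add: zero_less_mult_iff)
  qed
  have sw: "smooth1 {0<..} w"
    unfolding w_def[abs_def]
    by (intro smooth1_divide smooth1_poly smooth1_power smooth1_ident) auto
  have "Cr (Suc 0) {0<..} w" using sw unfolding smooth1_def by blast
  then obtain dw where dw: "\<And>x. x > 0 \<Longrightarrow> (w has_real_derivative dw x) (at x)" by auto
  \<comment> \<open>This is W = (x - \<open>r\<^sub>0\<close>) w differentiated, in the form in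
    which p = y sqrt w will meet the equation \<open>dp\<close>.\<close>
  have "w x + (x - r\<^sub>0) * dw x = 2 * (kfun H c x * (H - 2 * c / x^3) + M / x\<^sup>2)" if x: "x > 0" for x
  proof -
    have "((\<lambda>x. (x - r\<^sub>0) * w x) has_real_derivative (1 - 0) * w x + dw x * (x - r\<^sub>0)) (at x)"
      by (intro DERIV_mult DERIV_diff DERIV_ident DERIV_const dw x)
    moreover have "((\<lambda>x. (x - r\<^sub>0) * w x) has_real_derivative 2 * (kfun H c x * (H - 2 * c / x^3) + M / x\<^sup>2)) (at x)"
      by (rule has_field_derivative_transform_within_open[OF DERIV_Wfun[OF x], of "{0<..}"])
        (use x Ww in auto)
    ultimately show ?thesis using DERIV_unique by (fastforce simp: mult.commute)
  qed
  with r0 kt Ww wpos sw dw that show ?thesis unfolding R_def by blast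
qed

text \<open>The radius is a proper function of y, so its convergence confines the parameters to a
  compact interval. A convergent subsequence is enough, as U and V converge along the whole
  sequence.\<close>

lemma (in profile) closedin_of_turning:
  assumes I: "I = UNIV" and r: "\<And>y. r y = r\<^sub>0 + y\<^sup>2"
  shows "closedin (top_of_set (kruskal M)) (curve I)"
proof (rule curve_closedin)
  fix ys u v
  assume ys: "(\<lambda>i. U (ys i)) \<longlonglongrightarrow> u" "(\<lambda>i. V (ys i)) \<longlonglongrightarrow> v" "(\<lambda>i. r (ys i)) \<longlonglongrightarrow> kruskal_r M u v"
  have "Bseq (\<lambda>i. r (ys i))" using ys(3) by (intro convergent_imp_Bseq convergentI)
  then obtain B where B: "\<And>i. \<bar>r (ys i)\<bar> \<le> B" by (auto simp: Bseq_def)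
  define C where "C = B + \<bar>r\<^sub>0\<bar> + 1"
  have "ys i \<in> {- C..C}" for i
  proof -
    have "(ys i)\<^sup>2 \<le> B + \<bar>r\<^sub>0\<bar>" using B[of i] r[of "ys i"] by linarith
    moreover have "\<bar>ys i\<bar> \<le> (ys i)\<^sup>2 + 1"
      using zero_le_power2[of "\<bar>ys i\<bar> - 1"] zero_le_power2[of "ys i"]
      by (simp add: power2_diff)
    ultimately show ?thesis by (simp add: C_def abs_le_iff)
  qed
  then obtain y f where y: "strict_mono f" "(ys \<circ> f) \<longlonglongrightarrow> y"
    using seq_compactE[OF compact_imp_seq_compact[OF compact_Icc[of "- C" C]], of ys] by metis
  have yI: "y \<in> I" by (simp add: I)
  have "(\<lambda>i. U ((ys \<circ> f) i)) \<longlonglongrightarrow> U y" "(\<lambda>i. V ((ys \<circ> f) i)) \<longlonglongrightarrow> V y"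
    using isCont_tendsto_compose[OF isCont_U[OF yI] y(2)] isCont_tendsto_compose[OF isCont_V[OF yI] y(2)] .
  moreover have "(\<lambda>i. U ((ys \<circ> f) i)) \<longlonglongrightarrow> u" "(\<lambda>i. V ((ys \<circ> f) i)) \<longlonglongrightarrow> v"
    using LIMSEQ_subseq_LIMSEQ[OF ys(1) y(1)] LIMSEQ_subseq_LIMSEQ[OF ys(2) y(1)] by (simp_all add: o_def)
  ultimately show "\<exists>y\<in>I. u = U y \<and> v = V y" using LIMSEQ_unique yI by blast
qed

lemma inner_case:
  assumes M: "M > 0" and c: "c > - 8 * M^3 * H" "c < C_max M H" and r1: "r\<^sub>1 > 2 * M" and r3: "r\<^sub>3 > 2 * M"
  obtains cb\<^sub>4 cb\<^sub>3 where "let S1 = Sigma1 M H c r\<^sub>1 cb\<^sub>1; S4 = Sigma4 M H c r\<^sub>4 cb\<^sub>4; S3 = Sigma3 M H c r\<^sub>3 cb\<^sub>3;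
      S143 = join (region_I M) (region_II' M) S1 S4 \<union> join (region_II' M) (region_I' M) S4 S3
    in connects_smoothly M (region_I M) (region_II' M) S1 S4 \<and>
      connects_smoothly M (region_II' M) (region_I' M) S4 S3 \<and>
      complete_hypersurface M S143 \<and> ss_cmc M H S143 \<and> has_ends S143 2"
proof -
  obtain r\<^sub>0 w dw where r0: "0 < r\<^sub>0" "R_max M H < r\<^sub>0" "r\<^sub>0 < 2 * M" "ktilde M H r\<^sub>0 = c"
    and kt: "\<And>x. r\<^sub>0 < x \<Longrightarrow> x < 2 * M \<Longrightarrow> ktilde M H x < c"
    and Ww: "\<And>x. x > 0 \<Longrightarrow> Wfun M H c x = (x - r\<^sub>0) * w x" and wpos: "\<And>x. r\<^sub>0 \<le> x \<Longrightarrow> w x > 0"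
    and sw: "smooth1 {0<..} w" and dw: "\<And>x. x > 0 \<Longrightarrow> (w has_real_derivative dw x) (at x)"
    and wdw: "\<And>x. x > 0 \<Longrightarrow> w x + (x - r\<^sub>0) * dw x = 2 * (kfun H c x * (H - 2 * c / x^3) + M / x\<^sup>2)"
  proof (rule turning_point[OF M c], goal_cases)
    case (1 r\<^sub>0 w dw)
    from 1(1)[OF 1(2-)] show ?case .
  qed
  define r where "r y = r\<^sub>0 + y\<^sup>2" for y
  define s where "s y = sqrt (w (r y))" for y
  define p where "p y = y * s y" for y
  \<comment> \<open>Then p / a = 2 y, the derivative of r, and p and a remain smooth at the turning
    point y = 0, with a > 0.\<close>
  define a where "a y = s y / 2" for y
  have r_ge: "r y \<ge> r\<^sub>0" "r y > 0" for y using r0 by (auto simp: r_def add_pos_nonneg)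
  have s: "s y > 0" "(s y)\<^sup>2 = w (r y)" for y using wpos[OF r_ge(1)] by (auto simp: s_def less_imp_le)
  have dr0: "(r has_real_derivative 2 * y) (at y)" for y
    unfolding r_def[abs_def] by (auto intro!: derivative_eq_intros)
  interpret D: profile_data M H c UNIV r a p
  proof
    show sr: "smooth1 UNIV r" unfolding r_def[abs_def]
      by (intro smooth1_add smooth1_const smooth1_power smooth1_ident)
    have "smooth1 UNIV s" unfolding s_def[abs_def]
      by (rule smooth1_sqrt[OF open_UNIV smooth1_compose[OF sw sr]]) (use r_ge wpos in auto)
    then show "smooth1 UNIV a" "smooth1 UNIV p"
      unfolding a_def[abs_def] p_def[abs_def]
      by (intro smooth1_mult smooth1_divide smooth1_const smooth1_ident open_UNIV; simp)+
    fix y :: real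
    show "(r has_real_derivative p y / a y) (at y)"
      using dr0[of y] s(1)[of y] by (simp add: p_def a_def mult.commute)
    have "((\<lambda>y. w (r y)) has_real_derivative dw (r y) * (2 * y)) (at y)"
      by (rule DERIV_chain2[where f = w and g = r, OF dw[OF r_ge(2)] dr0])
    then have "(s has_real_derivative inverse (s y) / 2 * (dw (r y) * (2 * y))) (at y)"
      unfolding s_def[abs_def]
      by (rule DERIV_chain2[where f = sqrt and g = "\<lambda>y. w (r y)", OF DERIV_real_sqrt[OF wpos[OF r_ge(1)]]])
    then have "(p has_real_derivative 1 * s y + inverse (s y) / 2 * (dw (r y) * (2 * y)) * y) (at y)"
      unfolding p_def[abs_def] by (intro DERIV_mult DERIV_ident)
    also have "1 * s y + inverse (s y) / 2 * (dw (r y) * (2 * y)) * y = (w (r y) + (r y - r\<^sub>0) * dw (r y)) / s y"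
      unfolding s(2)[symmetric] using s(1)[of y] by (simp add: r_def field_simps power2_eq_square)
    also have "\<dots> = (kfun H c (r y) * (H - 2 * c / (r y)^3) + M / (r y)\<^sup>2) / a y"
      unfolding wdw[OF r_ge(2)] by (simp add: a_def)
    finally show "(p has_real_derivative (kfun H c (r y) * (H - 2 * c / (r y)^3) + M / (r y)\<^sup>2) / a y) (at y)" .
    show "(p y)\<^sup>2 = Wfun M H c (r y)"
      unfolding p_def power_mult_distrib s(2) Ww[OF r_ge(2)] by (simp add: r_def)
  qed (use M r_ge s in \<open>auto simp: a_def\<close>)
  \<comment> \<open>Z and -Z are the two branches of the inverse of r: Z with p > 0 covers region I
    and the graph of \<open>f4_star2\<close>, and -Z with p < 0 covers region I' and the graph of
    \<open>f4_star\<close>.\<close>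
  define Z where "Z x = sqrt (x - r\<^sub>0)" for x
  have Z: "Z x > 0" "r (Z x) = x" "r (- Z x) = x" if "x > r\<^sub>0" for x
    using that by (auto simp: Z_def r_def)
  have Zr: "Z (r y) = \<bar>y\<bar>" for y by (simp add: Z_def r_def)
  have dZ: "(Z has_real_derivative 1 / (2 * Z x)) (at x)" if "x > r\<^sub>0" for x
  proof -
    have "((\<lambda>x. sqrt (x - r\<^sub>0)) has_real_derivative inverse (sqrt (x - r\<^sub>0)) / 2 * (1 - 0)) (at x)"
      by (rule DERIV_chain2[where f = sqrt and g = "\<lambda>x. x - r\<^sub>0",
            OF DERIV_real_sqrt DERIV_diff[OF DERIV_ident DERIV_const]]) (use that in simp)
    also have "inverse (sqrt (x - r\<^sub>0)) / 2 * (1 - 0) = 1 / (2 * sqrt (x - r\<^sub>0))" by (simp add: field_simps)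
    finally show ?thesis unfolding Z_def[abs_def] .
  qed
  have pZ: "p (Z x) = sqrt (Wfun M H c x)" if "x > r\<^sub>0" for x
    using Z[OF that] Ww[of x] r0(1) that by (simp add: p_def s_def Z_def real_sqrt_mult)
  have psym: "p (- y) = - p y" "a (- y) = a y" "r (- y) = r y" for y by (simp_all add: p_def s_def a_def r_def)
  have aZ: "a (Z x) / p (Z x) = 1 / (2 * Z x)" if "x > r\<^sub>0" for x
    using s(1)[of "Z x"] by (simp add: a_def p_def)
  have r1': "r\<^sub>1 > r\<^sub>0" using r1 r0 by simp
  have "\<bar>kfun H c (r (Z r\<^sub>1))\<bar> < p (Z r\<^sub>1)"
  proof -
    have "schw_h M r\<^sub>1 > 0" using r1 M by (simp add: schw_h_def)
    then show ?thesis unfolding pZ[OF r1'] Z(2)[OF r1'] by (intro real_less_rsqrt) (simp add: Wfun_def)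
  qed
  moreover have "UNIV = einterval (-\<infinity>) \<infinity>" by (auto simp: einterval_def)
  ultimately obtain n where n: "profile M H c UNIV r a p n" "profile.\<tau> M H c r p n (Z r\<^sub>1) = cb\<^sub>1"
    using D.exists_normalised[of "-\<infinity>" "Z r\<^sub>1"] by blast
  interpret P: profile M H c UNIV r a p n by (rule n(1))
  define yh where "yh = Z (2 * M)"
  have yh: "yh > 0" "r yh = 2 * M" "r (- yh) = 2 * M" unfolding yh_def using Z[of "2 * M"] r0 by auto
  have r_out: "r y > 2 * M" if "\<bar>y\<bar> > yh" for y
    using abs_le_square_iff[of y yh] that yh by (auto simp: r_def)
  have r_in: "r y < 2 * M" if "\<bar>y\<bar> < yh" for y
    using abs_le_square_iff[of yh y] that yh by (auto simp: r_def)
  have k_in: "P.k y > 0" if "\<bar>y\<bar> < yh" for y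
  proof -
    have "ktilde M H (r y) \<le> c"
      using kt[of "r y"] r_ge(1)[of y] r_in[OF that] r0(4) by (cases "r y = r\<^sub>0") auto
    then show ?thesis using kfun_pos_inside(1)[OF r_ge(2) r_in[OF that]] by (simp add: P.k_def)
  qed
  have outp: "P.U y > 0" "P.V y > 0" if "y > yh" for y
  proof -
    have "p y > 0" using that yh s(1)[of y] by (simp add: p_def)
    then have "\<bar>P.k y\<bar> < p y" using P.p_outside[of y] r_out[of y] that yh by simp
    then show "P.U y > 0" "P.V y > 0" using P.U_pos_iff[of y] P.V_pos_iff[of y] by auto
  qed
  have outm: "P.U y < 0" "P.V y < 0" if "y < - yh" for y
  proof -
    have "p y < 0" using that yh s(1)[of y] by (simp add: p_def mult_neg_pos)
    then have "\<bar>P.k y\<bar> < - p y" using P.p_outside[of y] r_out[of y] that yh by simp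
    then show "P.U y < 0" "P.V y < 0" using P.U_neg_iff[of y] P.V_neg_iff[of y] by auto
  qed
  have inn: "P.U y > 0" "P.V y < 0" if "\<bar>y\<bar> < yh" for y
    using P.p_inside[of y] r_in[OF that] k_in[OF that] P.U_pos_iff[of y] P.V_neg_iff[of y] by auto
  have khor: "P.k yh > 0" "P.k (- yh) > 0"
    using kfun_pos_horizon[OF M c(1)] yh by (simp_all add: P.k_def)
  have hp: "P.V yh = 0"
  proof -
    have "p yh > 0" using yh s(1)[of yh] by (simp add: p_def)
    then have "p yh = P.k yh" using P.p_horizon[of yh] yh khor by simp
    then show ?thesis by (simp add: P.V_def)
  qed
  have hm: "P.U (- yh) = 0"
  proof -
    have "p (- yh) < 0" using yh s(1)[of "- yh"] by (simp add: p_def)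
    then have "p (- yh) = - P.k (- yh)" using P.p_horizon[of "- yh"] yh khor by simp
    then show ?thesis by (simp add: P.U_def)
  qed
  have nz: "P.U y \<noteq> 0 \<and> P.V y \<noteq> 0" if "r y \<noteq> 2 * M" for y
  proof -
    have "\<bar>y\<bar> \<noteq> yh" using that yh by (auto simp: abs_if split: if_splits)
    then consider "y > yh" | "y < - yh" | "\<bar>y\<bar> < yh" by linarith
    then show ?thesis
    proof cases
      case 1 then show ?thesis using outp[of y] by simp
    next
      case 2 then show ?thesis using outm[of y] by simp
    next
      case 3 then show ?thesis using inn[of y] by simp
    qed
  qed
  let ?g = "\<lambda>x. kfun H c x / (schw_h M x * sqrt (Wfun M H c x))"
  have Fp: "((\<lambda>x. P.\<tau> (Z x)) has_real_derivative ?g x) (at x)" if "x > r\<^sub>0" "x \<noteq> 2 * M" for x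
    using P.DERIV_\<tau>_section[of Z x] nz[of "Z x"] dZ[OF that(1)] aZ[OF that(1)] Z[OF that(1)] that pZ[OF that(1)] s(1)[of "Z x"]
    by (simp add: P.k_def p_def)
  have Fm: "((\<lambda>x. P.\<tau> (- Z x)) has_real_derivative - ?g x) (at x)" if "x > r\<^sub>0" "x \<noteq> 2 * M" for x
  proof -
    have "((\<lambda>x. - Z x) has_real_derivative a (- Z x) / p (- Z x)) (at x)"
      using DERIV_minus[OF dZ[OF that(1)]] unfolding psym aZ[OF that(1), symmetric] by simp
    moreover have "p (- Z x) \<noteq> 0" using Z[OF that(1)] s(1)[of "Z x"] unfolding psym by (simp add: p_def)
    ultimately have "((\<lambda>x. P.\<tau> (- Z x)) has_real_derivative
        P.k (- Z x) / (schw_h M (r (- Z x)) * p (- Z x))) (at x)"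
      using nz[of "- Z x"] Z[OF that(1)] that by (intro P.DERIV_\<tau>_section) auto
    then show ?thesis using Z[OF that(1)] unfolding psym pZ[OF that(1)] by (simp add: P.k_def psym)
  qed
  have S1: "Sigma1 M H c r\<^sub>1 cb\<^sub>1 = P.curve {yh<..}"
    unfolding Sigma1_def region_quadrant
  proof (rule P.graph_over_curve)
    show "r ` {yh<..} = {2*M<..}"
    proof (intro equalityI subsetI)
      fix x assume x: "x \<in> {2*M<..}"
      then have "yh < Z x" using r0 by (simp add: yh_def Z_def)
      then show "x \<in> r ` {yh<..}" using Z(2)[of x] x r0 by (intro image_eqI[of _ _ "Z x"]) auto
    qed (use r_out yh in auto)
    show "P.\<tau> y = f1 M H c r\<^sub>1 cb\<^sub>1 (r y)" if "y \<in> {yh<..}" for y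
      using f1_eq[OF M r1, of "r y" "\<lambda>x. P.\<tau> (Z x)" H c cb\<^sub>1] Fp r0 r_out[of y] that yh n(2) by (simp add: Zr)
  qed (use outp in auto)
  have S3: "Sigma3 M H c r\<^sub>3 (P.\<tau> (- Z r\<^sub>3)) = P.curve {..<- yh}"
    unfolding Sigma3_def region_quadrant
  proof (rule P.graph_over_curve)
    show "r ` {..<- yh} = {2*M<..}"
    proof (intro equalityI subsetI)
      fix x assume x: "x \<in> {2*M<..}"
      then have "yh < Z x" using r0 by (simp add: yh_def Z_def)
      then show "x \<in> r ` {..<- yh}" using Z(3)[of x] x r0 by (intro image_eqI[of _ _ "- Z x"]) auto
    qed (use r_out yh in auto)
    show "P.\<tau> y = f3 M H c r\<^sub>3 (P.\<tau> (- Z r\<^sub>3)) (r y)" if "y \<in> {..<- yh}" for y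
      using f3_eq[OF M r3, of "r y" "\<lambda>x. P.\<tau> (- Z x)" H c "P.\<tau> (- Z r\<^sub>3)"] Fm r0 r_out[of y] that yh
      by (simp add: Zr)
  qed (use outm in auto)
  \<comment> \<open>The turning point lies inside region II', so the time is regular at y = 0; its
    value there is the common additive constant of both integrals.\<close>
  have cont0: "isCont P.\<tau> 0"
    by (rule DERIV_isCont[OF P.DERIV_\<tau>]) (use nz[of 0] r0 in \<open>auto simp: r_def\<close>)
  have "isCont Z r\<^sub>0" unfolding Z_def[abs_def] by (intro continuous_intros)
  then have Z0: "(Z \<longlongrightarrow> 0) (at_right r\<^sub>0)"
    by (simp add: isCont_def Z_def filterlim_at_split)
  have limp: "((\<lambda>x. P.\<tau> (Z x)) \<longlongrightarrow> P.\<tau> 0) (at_right r\<^sub>0)"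
    by (rule isCont_tendsto_compose[OF cont0 Z0])
  have "((\<lambda>x. - Z x) \<longlongrightarrow> 0) (at_right r\<^sub>0)" using tendsto_minus[OF Z0] by simp
  then have limm: "((\<lambda>x. - P.\<tau> (- Z x)) \<longlongrightarrow> - P.\<tau> 0) (at_right r\<^sub>0)"
    by (intro tendsto_minus isCont_tendsto_compose[OF cont0])
  \<comment> \<open>On the branch -Z the time has the opposite rate in r, because p is negative;
    this is the sign in \<open>f4_star\<close>.\<close>
  have Fm': "((\<lambda>x. - P.\<tau> (- Z x)) has_real_derivative ?g x) (at x)" if "r\<^sub>0 < x" "x < 2 * M" for x
    using DERIV_minus[OF Fm[of x]] that by simp
  have star2: "P.\<tau> (Z x) = f4_star2 M H c r\<^sub>0 (P.\<tau> 0) x" if "r\<^sub>0 \<le> x" "x < 2 * M" for x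
  proof (cases "x = r\<^sub>0")
    case False
    then have "(LBINT x=ereal r\<^sub>0..ereal x. f4_integrand M H c x) = P.\<tau> (Z x) - P.\<tau> 0"
      using that by (intro f4_improper(2)[OF M c(1) r0(1) _ kt Fp limp]) auto
    then show ?thesis by (simp add: f4_star2_def)
  qed (simp add: f4_star2_def Z_def)
  have star: "P.\<tau> (- Z x) = f4_star M H c r\<^sub>0 (P.\<tau> 0) x" if "r\<^sub>0 \<le> x" "x < 2 * M" for x
  proof (cases "x = r\<^sub>0")
    case False
    then have "(LBINT x=ereal r\<^sub>0..ereal x. f4_integrand M H c x) = - P.\<tau> (- Z x) - - P.\<tau> 0"
      using that by (intro f4_improper(2)[OF M c(1) r0(1) _ kt Fm' limm]) auto
    then show ?thesis unfolding f4_star_def interval_lebesgue_integral_uminus by simp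
  qed (simp add: f4_star_def Z_def)
  define z where "z = (r\<^sub>0 + 2 * M) / 2"
  have z: "z \<in> {r\<^sub>0<..<2*M}" using r0 by (auto simp: z_def field_simps)
  have "set_integrable lborel {r\<^sub>0<..<z} (f4_integrand M H c)"
    by (rule f4_improper(1)[OF M c(1) r0(1) z kt Fp limp]) auto
  note dom = Sigma4_dom_subcritical[OF M r0(2,3,4) z this]
  have graphp: "graph_over M (quadrant M 1 (-1)) {r\<^sub>0..<2*M} (f4_star2 M H c r\<^sub>0 (P.\<tau> 0)) = P.curve {0..<yh}"
  proof (rule P.graph_over_curve)
    show "r ` {0..<yh} = {r\<^sub>0..<2*M}"
    proof (intro equalityI subsetI)
      fix x assume x: "x \<in> {r\<^sub>0..<2*M}"
      then have "0 \<le> Z x" "Z x < yh" "r (Z x) = x" using r0 by (auto simp: yh_def Z_def r_def)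
      then show "x \<in> r ` {0..<yh}" by (intro image_eqI[of _ _ "Z x"]) auto
    qed (use r_in r_ge in auto)
    show "P.\<tau> y = f4_star2 M H c r\<^sub>0 (P.\<tau> 0) (r y)" if "y \<in> {0..<yh}" for y
      using star2[of "r y"] r_in[of y] r_ge(1)[of y] that by (simp add: Zr)
  qed (use inn in auto)
  have graphm: "graph_over M (quadrant M 1 (-1)) {r\<^sub>0..<2*M} (f4_star M H c r\<^sub>0 (P.\<tau> 0)) = P.curve {- yh<..0}"
  proof (rule P.graph_over_curve)
    show "r ` {- yh<..0} = {r\<^sub>0..<2*M}"
    proof (intro equalityI subsetI)
      fix x assume x: "x \<in> {r\<^sub>0..<2*M}"
      then have "0 \<le> Z x" "Z x < yh" "r (- Z x) = x" using r0 by (auto simp: yh_def Z_def r_def)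
      then show "x \<in> r ` {- yh<..0}" by (intro image_eqI[of _ _ "- Z x"]) auto
    qed (use r_in r_ge in auto)
    show "P.\<tau> y = f4_star M H c r\<^sub>0 (P.\<tau> 0) (r y)" if "y \<in> {- yh<..0}" for y
      using star[of "r y"] r_in[of y] r_ge(1)[of y] that by (simp add: Zr)
  qed (use inn in auto)
  \<comment> \<open>The two graphs share the sphere over y = 0, so their union is an open stretch of
    the curve.\<close>
  have "{- yh<..0} \<union> {0..<yh} = {- yh<..<yh}" using yh by auto
  then have S4: "Sigma4 M H c r\<^sub>4 (P.\<tau> 0) = P.curve {- yh<..<yh}"
    using c(2) unfolding Sigma4_def dom region_quadrant graphp graphm P.curve_Un[symmetric] by simp
  have closed: "closedin (top_of_set (kruskal M)) (P.curve UNIV)"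
    by (rule P.closedin_of_turning[OF refl, of r\<^sub>0]) (simp add: r_def)
  have un: "{yh<..} \<union> {- yh<..<yh} \<union> {yh} = {- yh<..}" "{- yh<..<yh} \<union> {..<- yh} \<union> {- yh} = {..<yh}"
    using yh by auto
  have reg1: "P.curve {yh<..} \<subseteq> region_I M"
    unfolding region_quadrant by (rule P.curve_quadrant; use outp in simp)
  have reg2: "P.curve {- yh<..<yh} \<subseteq> region_II' M"
    unfolding region_quadrant by (rule P.curve_quadrant; use inn in \<open>simp add: abs_less_iff\<close>)
  have reg3: "P.curve {..<- yh} \<subseteq> region_I' M"
    unfolding region_quadrant by (rule P.curve_quadrant; use outm in simp)
  have cl: "yh \<in> closure {yh<..}" "yh \<in> closure {- yh<..<yh}"
    "- yh \<in> closure {- yh<..<yh}" "- yh \<in> closure {..<- yh}" using yh by auto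
  have op: "open ({yh<..} \<union> {- yh<..<yh} \<union> {yh})" "open ({- yh<..<yh} \<union> {..<- yh} \<union> {- yh})"
    unfolding un by auto
  note con1 = P.connects_I_II'[OF closed UNIV_I subset_UNIV subset_UNIV cl(1,2) op(1) reg1 reg2 hp]
  note con2 = P.connects_II'_I'[OF closed UNIV_I subset_UNIV subset_UNIV cl(3,4) op(2) reg2 reg3 hm]
  have all: "P.curve {- yh<..} \<union> P.curve {..<yh} = P.curve UNIV"
  proof -
    have "{- yh<..} \<union> {..<yh} = UNIV" using yh by auto
    then show ?thesis unfolding P.curve_Un[symmetric] by simp
  qed
  show ?thesis
    by (rule that[of "P.\<tau> 0" "P.\<tau> (- Z r\<^sub>3)"])
      (unfold Let_def S1 S3 S4 con1(2) con2(2), unfold un all,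
        intro conjI con1(1) con2(1) P.curve_complete closed P.curve_ss_cmc P.curve_has_ends)
qed

section \<open>Assembly of the three ranges of the constant c\<close>

theorem theorem3:
  fixes M H c\<^sub>1 cb\<^sub>1 r\<^sub>1 r\<^sub>3 r\<^sub>4 :: real
  assumes "M > 0"
    and "c\<^sub>1 > - 8 * M^3 * H"
    and "r\<^sub>1 > 2 * M"
    and "r\<^sub>3 > 2 * M"
    and "r\<^sub>4 \<in> Sigma4_dom M H c\<^sub>1"
  shows "\<exists>cb\<^sub>4.
    (let S1 = Sigma1 M H c\<^sub>1 r\<^sub>1 cb\<^sub>1;
         S4 = Sigma4 M H c\<^sub>1 r\<^sub>4 cb\<^sub>4;
         S14 = join (region_I M) (region_II' M) S1 S4
     in connects_smoothly M (region_I M) (region_II' M) S1 S4 \<and>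
        (c\<^sub>1 > C_max M H \<longrightarrow>
           Sigma4_dom M H c\<^sub>1 = {0<..<2*M} \<and>
           complete_hypersurface M S14 \<and> ss_cmc M H S14 \<and> has_ends S14 2) \<and>
        (c\<^sub>1 = C_max M H \<longrightarrow>
           Sigma4_dom M H c\<^sub>1 = {R_max M H<..<2*M} \<and>
           complete_hypersurface M S14 \<and> ss_cmc M H S14 \<and> has_ends S14 2) \<and>
        (c\<^sub>1 < C_max M H \<longrightarrow>
           (\<exists>cb\<^sub>3.
              (let S3 = Sigma3 M H c\<^sub>1 r\<^sub>3 cb\<^sub>3;
                   S143 = S14 \<union> join (region_II' M) (region_I' M) S4 S3
               in connects_smoothly M (region_II' M) (region_I' M) S4 S3 \<and>
                  complete_hypersurface M S143 \<and> ss_cmc M H S143 \<and> has_ends S143 2))))"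
proof -
  note M = assms(1) and c = assms(2)
  consider (super) "c\<^sub>1 > C_max M H" | (crit) "c\<^sub>1 = C_max M H" | (sub) "c\<^sub>1 < C_max M H" by linarith
  then show ?thesis
  proof cases
    case super
    have dom: "Sigma4_dom M H c\<^sub>1 = {0<..<2*M}" by (rule Sigma4_dom_supercritical[OF M super])
    have kt: "ktilde M H x < c\<^sub>1" if "0 < x" "x < 2 * M" for x
      using ktilde_less_C_max[OF M that, of H] super by (cases "x = R_max M H") (auto simp: C_max_def)
    obtain cb\<^sub>4 where "let S1 = Sigma1 M H c\<^sub>1 r\<^sub>1 cb\<^sub>1;
        S4 = graph_over M (region_II' M) {0<..<2*M} (f4_star2 M H c\<^sub>1 r\<^sub>4 cb\<^sub>4);
        S14 = join (region_I M) (region_II' M) S1 S4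
      in connects_smoothly M (region_I M) (region_II' M) S1 S4 \<and>
        complete_hypersurface M S14 \<and> ss_cmc M H S14 \<and> has_ends S14 2"
      by (rule outer_case[OF M c assms(3), of 0 r\<^sub>4 cb\<^sub>1]) (use M kt assms(5) dom in auto)
    then show ?thesis using super dom
      by (intro exI[of _ cb\<^sub>4]) (simp add: Let_def Sigma4_def)
  next
    case crit
    have dom: "Sigma4_dom M H c\<^sub>1 = {R_max M H<..<2*M}"
      using Sigma4_dom_critical[OF M, of H] c crit by simp
    have R: "0 < R_max M H" "R_max M H < 2 * M" using R_max_in[OF M, of H] by auto
    have kt: "ktilde M H x < c\<^sub>1" if "R_max M H < x" "x < 2 * M" for x
      using ktilde_less_C_max[OF M, of x H] that R crit by simp
    obtain cb\<^sub>4 where "let S1 = Sigma1 M H c\<^sub>1 r\<^sub>1 cb\<^sub>1;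
        S4 = graph_over M (region_II' M) {R_max M H<..<2*M} (f4_star2 M H c\<^sub>1 r\<^sub>4 cb\<^sub>4);
        S14 = join (region_I M) (region_II' M) S1 S4
      in connects_smoothly M (region_I M) (region_II' M) S1 S4 \<and>
        complete_hypersurface M S14 \<and> ss_cmc M H S14 \<and> has_ends S14 2"
      by (rule outer_case[OF M c assms(3), of "R_max M H" r\<^sub>4 cb\<^sub>1]) (use R kt assms(5) dom crit in auto)
    then show ?thesis using crit dom
      by (intro exI[of _ cb\<^sub>4]) (simp add: Let_def Sigma4_def)
  next
    case sub
    obtain cb\<^sub>4 cb\<^sub>3 where "let S1 = Sigma1 M H c\<^sub>1 r\<^sub>1 cb\<^sub>1; S4 = Sigma4 M H c\<^sub>1 r\<^sub>4 cb\<^sub>4; S3 = Sigma3 M H c\<^sub>1 r\<^sub>3 cb\<^sub>3;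
        S143 = join (region_I M) (region_II' M) S1 S4 \<union> join (region_II' M) (region_I' M) S4 S3
      in connects_smoothly M (region_I M) (region_II' M) S1 S4 \<and>
        connects_smoothly M (region_II' M) (region_I' M) S4 S3 \<and>
        complete_hypersurface M S143 \<and> ss_cmc M H S143 \<and> has_ends S143 2"
      by (rule inner_case[OF M c sub assms(3,4), of cb\<^sub>1 r\<^sub>4])
    then show ?thesis using sub
      unfolding Let_def by (intro exI[of _ cb\<^sub>4] conjI impI exI[of _ cb\<^sub>3]) auto
  qed
qed

end
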